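(* Let $0\le k\le n$, and let $\lambda,\mu,\nu\in\binom{n}{k}$, indexing equivariant Schubert classes $\tilde S_\lambda,\tilde S_\mu,\tilde S_\nu$ in $H^*_T(\mathrm{Gr}_k(\mathbb{C}^n))$. Let $c_{\lambda\mu}^\nu\in\mathbb{Z}[y_1,\dots,y_n]$ be the structure constants defined by $\tilde S_\lambda\tilde S_\mu=\sum_{\nu\in\binom nk} c_{\lambda\mu}^\nu\tilde S_\nu$. Then the following (equivalent) statements hold: (1) $c_{\lambda\mu}^\nu=\sum_{P} wt(P)$, the sum being over all puzzles $P$ (equivariant pieces allowed) with $\partial P=\Delta_{\lambda\mu}^\nu$. In particular, $c_{\lambda\mu}^\nu$ is a polynomial with nonnegative integer coefficients in the differences $y_2-y_1,\,y_3-y_2,\dots,y_n-y_{n-1}$. (2) $$\tilde S_\lambda\,\tilde S_\mu=\sum_{P:\ P_{NW}=\lambda,\ P_{NE}=\mu} wt(P)\,\tilde S_{w_0\cdot P_S},$$ the sum being over all puzzles $P$ (equivariant pieces allowed) with $P_{NW}=\lambda$ and $P_{NE}=\mu$.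
   Context: **Strings.** $\binom nk$ denotes the set of strings $\lambda=\lambda_1\cdots\lambda_n$ of $k$ ones and $n-k$ zeroes. $\mathrm{inv}(\lambda)=\{(i,j):1\le i<j\le n,\ \lambda_i=1,\ \lambda_j=0\}$ and $l(\lambda)=|\mathrm{inv}(\lambda)|$. $w_0\cdot\lambda$ is the reversed string. Partial order: $\lambda'\ge\lambda$ iff $\sum_{i\le j}\lambda'_i\ge\sum_{i\le j}\lambda_i$ for all $j=1,\dots,n$. **Equivariant cohomology ring.** $H^*_T(pt)=\mathbb{Z}[y_1,\dots,y_n]$ with $\deg y_i=1$. $H^*_T(\mathrm{Gr}_k(\mathbb{C}^n))$ is the subring (and $H^*_T(pt)$-submodule) of $\bigoplus_{\lambda\in\binom nk}H^*_T(pt)$ (componentwise operations) consisting of the lists $\alpha=(\alpha|_\lambda)_\lambda$, called classes, such that $\alpha|_\lambda-\alpha|_{\lambda'}$ is a multiple of $y_i-y_j$ whenever $\lambda,\lambda'$ differ only in places $i$ and $j$ (GKM conditions). For each $\lambda\in\binom nk$ there is exactly one class $\tilde S_\lambda$ (the equivariant Schubert class) such that: $\tilde S_\lambda|_\mu\neq0$ implies $\mu\ge\lambda$; $\tilde S_\lambda|_\lambda=\prod_{(i,j)\in\mathrm{inv}(\lambda)}(y_j-y_i)$; and every $\tilde S_\lambda|_\mu$ is homogeneous of degree $l(\lambda)$ (zero allowed). The $\tilde S_\lambda$ form an $H^*_T(pt)$-basis of $H^*_T(\mathrm{Gr}_k(\mathbb{C}^n))$. **Puzzles.** Take an upward-pointing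 equilateral triangle of side $n$ with horizontal South side, subdivided in the standard way into unit triangles. Lattice edges are E-W (horizontal), SW-NE (parallel to the NW side of the big triangle) or NW-SE (parallel to the NE side). Puzzle pieces, with edges along the lattice and labeled 0 or 1: (a) a unit triangle (upward or downward) with all edges labeled 0; (b) a unit triangle (upward or downward) with all edges labeled 1; (c) a unit rhombus (two unit triangles glued along an edge), in any of its three orientations, where the two edges clockwise of acute vertices are labeled 0 and the other two are labeled 1. Explicitly for (c): the N-S rhombus (two triangles glued along a horizontal edge) has NE and SW edges labeled 0 and NW and SE edges labeled 1; the SW-NE rhombus (edges E-W and SW-NE) has SW-NE edges labeled 0 and E-W edges labeled 1; the NW-SE rhombus (edges E-W and NW-SE) has E-W edges labeled 0 and NW-SE edges labeled 1. (d) The equivariant piece: the N-S rhombus with 0s and 1s exchanged, i.e. NW and SE edges labeled 0, NE and SW edges labeled 1 (only in this orientation). A puzzle $P$ is a decomposition of the big triangle into such pieces, with the labels of adjacent pieces agreeing on shared edges. $P_{NW},P_{NE},P_S$ are the strings of labels on the three sides, all read clockwise. $\partial P=\Delta_{\lambda\mu}^\nu$ means that the NW, NE, S sides are labeled $\lambda,\mu,\nu$, all read left to right (so $P_{NW}=\lambda$, $P_{NE}=\mu$, $w_0\cdot P_S=\nu$). **Weights.** For an equivariant piece $p$, moving from $p$ in the SW direction (along SW-NE lattice lines) one leaves through the $i$-th unit edge of the South side, and in the SE direction (along NW-SE lattice lines) through the $j$-th unit edge (counted from the left); $wt(p)=y_j-y_i$. $wt(P)=\prod_p wt(p)$ over the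 equivariant pieces $p$ of $P$ (empty product $=1$). *)

theory Defs
  imports
    Complex_Main
    "HOL-Library.Poly_Mapping"
    "HOL-Library.Function_Algebras"
begin

text \<open>
  Integer polynomials in variables indexed by the natural numbers: finitely supported
  functions from exponent vectors to coefficients. The product is the convolution product
  of \<^theory>\<open>HOL-Library.Poly_Mapping\<close>.
\<close>

type_synonym ypoly = "(nat \<Rightarrow>\<^sub>0 nat) \<Rightarrow>\<^sub>0 int"

definition yvar :: "nat \<Rightarrow> ypoly" where
  "yvar i = Poly_Mapping.single (Poly_Mapping.single i 1) 1"

text \<open>The ring \<open>\<int>[y\<^sub>1, \<dots>, y\<^sub>n]\<close>, that is \<open>H\<^sup>*\<^sub>T(pt)\<close>.\<close>

definition HT_pt :: "nat \<Rightarrow> ypoly set" where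
  "HT_pt n = {p. \<forall>m \<in> Poly_Mapping.keys p. Poly_Mapping.keys m \<subseteq> {1..n}}"

definition homogeneous :: "nat \<Rightarrow> ypoly \<Rightarrow> bool" where
  "homogeneous d p \<longleftrightarrow>
     (\<forall>m \<in> Poly_Mapping.keys p. (\<Sum>i \<in> Poly_Mapping.keys m. Poly_Mapping.lookup m i) = d)"

definition subst_poly :: "(nat \<Rightarrow> ypoly) \<Rightarrow> ypoly \<Rightarrow> ypoly" where
  "subst_poly f q = (\<Sum>m \<in> Poly_Mapping.keys q.
     of_int (Poly_Mapping.lookup q m) *
     (\<Prod>i \<in> Poly_Mapping.keys m. f i ^ Poly_Mapping.lookup m i))"

definition nonneg_in_differences :: "nat \<Rightarrow> ypoly \<Rightarrow> bool" where
  "nonneg_in_differences n p \<longleftrightarrow>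
     (\<exists>q. (\<forall>m \<in> Poly_Mapping.keys q. Poly_Mapping.keys m \<subseteq> {1..<n}) \<and>
          (\<forall>m. Poly_Mapping.lookup q m \<ge> 0) \<and>
          p = subst_poly (\<lambda>i. yvar (i + 1) - yvar i) q)"


text \<open>
  A string of ones and zeroes is a list of Booleans (\<open>True\<close> is 1, \<open>False\<close> is 0). Places are
  counted from 1, so place \<open>i\<close> is list position \<open>i - 1\<close>. The reversed string
  \<open>w\<^sub>0 \<cdot> \<lambda>\<close> is \<^term>\<open>rev l\<close>.
\<close>

definition strings :: "nat \<Rightarrow> nat \<Rightarrow> bool list set" where
  "strings n k = {l. length l = n \<and> count_list l True = k}"

definition place :: "bool list \<Rightarrow> nat \<Rightarrow> bool" where
  "place l i = l ! (i - 1)"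

definition inversions :: "bool list \<Rightarrow> (nat \<times> nat) set" where
  "inversions l =
     {(i, j). 1 \<le> i \<and> i < j \<and> j \<le> length l \<and> place l i = True \<and> place l j = False}"

definition dominates :: "bool list \<Rightarrow> bool list \<Rightarrow> bool" where
  "dominates l' l \<longleftrightarrow>
     (\<forall>j \<in> {1..length l}. (\<Sum>i = 1..j. of_bool (place l' i) :: nat) \<ge> (\<Sum>i = 1..j. of_bool (place l i)))"


text \<open>
  A list of polynomials indexed by \<^term>\<open>strings n k\<close> is a function that vanishes on all
  other Boolean lists. With this convention the componentwise operations are the pointwise
  operations of \<^theory>\<open>HOL-Library.Function_Algebras\<close>, and equality of lists is
  equality of functions. Divisibility by \<open>y\<^sub>i - y\<^sub>j\<close> is required inside
  \<^term>\<open>HT_pt n\<close>.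
\<close>

definition HT_Gr :: "nat \<Rightarrow> nat \<Rightarrow> (bool list \<Rightarrow> ypoly) set" where
  "HT_Gr n k = {\<alpha>.
     (\<forall>l \<in> strings n k. \<alpha> l \<in> HT_pt n) \<and>
     (\<forall>l. l \<notin> strings n k \<longrightarrow> \<alpha> l = 0) \<and>
     (\<forall>l \<in> strings n k. \<forall>l' \<in> strings n k. \<forall>i \<in> {1..n}. \<forall>j \<in> {1..n}.
        (\<forall>m \<in> {1..n} - {i, j}. place l m = place l' m) \<longrightarrow>
        (\<exists>q \<in> HT_pt n. \<alpha> l - \<alpha> l' = q * (yvar i - yvar j)))}"

definition scale :: "ypoly \<Rightarrow> (bool list \<Rightarrow> ypoly) \<Rightarrow> bool list \<Rightarrow> ypoly" (infixr \<open>*\<^sub>T\<close> 75) where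
  "p *\<^sub>T \<alpha> = (\<lambda>l. p * \<alpha> l)"

definition is_schubert_class :: "nat \<Rightarrow> nat \<Rightarrow> bool list \<Rightarrow> (bool list \<Rightarrow> ypoly) \<Rightarrow> bool" where
  "is_schubert_class n k l \<alpha> \<longleftrightarrow>
     \<alpha> \<in> HT_Gr n k \<and>
     (\<forall>m \<in> strings n k. \<alpha> m \<noteq> 0 \<longrightarrow> dominates m l) \<and>
     \<alpha> l = (\<Prod>(i, j) \<in> inversions l. yvar j - yvar i) \<and>
     (\<forall>m \<in> strings n k. homogeneous (card (inversions l)) (\<alpha> m))"

definition schubert :: "nat \<Rightarrow> nat \<Rightarrow> bool list \<Rightarrow> bool list \<Rightarrow> ypoly" where
  "schubert n k l = (THE \<alpha>. is_schubert_class n k l \<alpha>)"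

definition structure_constant ::
    "nat \<Rightarrow> nat \<Rightarrow> bool list \<Rightarrow> bool list \<Rightarrow> bool list \<Rightarrow> ypoly" where
  "structure_constant n k l m =
     (THE c. (\<forall>v \<in> strings n k. c v \<in> HT_pt n) \<and>
             (\<forall>v. v \<notin> strings n k \<longrightarrow> c v = 0) \<and>
             schubert n k l * schubert n k m = (\<Sum>v \<in> strings n k. c v *\<^sub>T schubert n k v))"


text \<open>
  The lattice point \<open>(a, b)\<close> lies \<open>a\<close> unit steps to the East and \<open>b\<close> unit steps to the
  North-East of the South-West corner of the big triangle, which consists of the points with
  \<open>a + b \<le> n\<close>. \<open>Up a b\<close> has vertices \<open>(a, b)\<close>, \<open>(a+1, b)\<close>, \<open>(a, b+1)\<close>, and
  \<open>Down a b\<close> has vertices \<open>(a+1, b)\<close>, \<open>(a, b+1)\<close>, \<open>(a+1, b+1)\<close>.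
\<close>

datatype tri = Up nat nat | Down nat nat

definition triangles :: "nat \<Rightarrow> tri set" where
  "triangles n = {Up a b | a b. a + b + 1 \<le> n} \<union> {Down a b | a b. a + b + 2 \<le> n}"

text \<open>
  Every unit edge of the subdivided big triangle is an edge of exactly one upward triangle:
  \<open>EW a b\<close>, \<open>SWNE a b\<close> and \<open>NWSE a b\<close> are the South, North-West and North-East edges of
  \<open>Up a b\<close>. They join \<open>(a, b)\<close> to \<open>(a+1, b)\<close>, \<open>(a, b)\<close> to \<open>(a, b+1)\<close>, and
  \<open>(a, b+1)\<close> to \<open>(a+1, b)\<close>.
\<close>

datatype edge = EW nat nat | SWNE nat nat | NWSE nat nat

fun tri_edges :: "tri \<Rightarrow> edge set" where
  "tri_edges (Up a b) = {EW a b, SWNE a b, NWSE a b}"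
| "tri_edges (Down a b) = {EW a (b + 1), NWSE a b, SWNE (a + 1) b}"

text \<open>
  \<open>Equivariant\<close> has the shape of \<open>RhombusNS\<close>. The indices of a rhombus are those of its
  downward triangle.
\<close>

datatype piece =
    Triangle tri bool
  | RhombusNS nat nat
  | RhombusSWNE nat nat
  | RhombusNWSE nat nat
  | Equivariant nat nat

fun piece_triangles :: "piece \<Rightarrow> tri set" where
  "piece_triangles (Triangle t x) = {t}"
| "piece_triangles (RhombusNS a b) = {Down a b, Up a (b + 1)}"
| "piece_triangles (RhombusSWNE a b) = {Down a b, Up a b}"
| "piece_triangles (RhombusNWSE a b) = {Down a b, Up (a + 1) b}"
| "piece_triangles (Equivariant a b) = {Down a b, Up a (b + 1)}"

text \<open>
  The labeled edges of a piece. For a rhombus the edge along which its two triangles are glued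
  is not an edge of the piece. The order of the edges is NE, SW, NW, SE for \<open>RhombusNS\<close>
  and \<open>Equivariant\<close>, left, right, top, bottom for \<open>RhombusSWNE\<close>, and top, bottom, left,
  right for \<open>RhombusNWSE\<close>.
\<close>

fun piece_labels :: "piece \<Rightarrow> (edge \<times> bool) set" where
  "piece_labels (Triangle t x) = tri_edges t \<times> {x}"
| "piece_labels (RhombusNS a b) =
     {(NWSE a (b + 1), False), (NWSE a b, False), (SWNE a (b + 1), True), (SWNE (a + 1) b, True)}"
| "piece_labels (RhombusSWNE a b) =
     {(SWNE a b, False), (SWNE (a + 1) b, False), (EW a (b + 1), True), (EW a b, True)}"
| "piece_labels (RhombusNWSE a b) =
     {(EW a (b + 1), False), (EW (a + 1) b, False), (NWSE a b, True), (NWSE (a + 1) b, True)}"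
| "piece_labels (Equivariant a b) =
     {(NWSE a (b + 1), True), (NWSE a b, True), (SWNE a (b + 1), False), (SWNE (a + 1) b, False)}"

definition puzzles :: "nat \<Rightarrow> piece set set" where
  "puzzles n = {P.
     (\<Union>p \<in> P. piece_triangles p) = triangles n \<and>
     (\<forall>p \<in> P. \<forall>q \<in> P. p \<noteq> q \<longrightarrow> piece_triangles p \<inter> piece_triangles q = {}) \<and>
     (\<forall>p \<in> P. \<forall>q \<in> P. \<forall>e x y. (e, x) \<in> piece_labels p \<longrightarrow> (e, y) \<in> piece_labels q \<longrightarrow> x = y)}"

definition edge_label :: "piece set \<Rightarrow> edge \<Rightarrow> bool" where
  "edge_label P e = (THE x. \<exists>p \<in> P. (e, x) \<in> piece_labels p)"

text \<open>All three sides are read clockwise; in particular the South side from right to left.\<close>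

definition side_NW :: "nat \<Rightarrow> piece set \<Rightarrow> bool list" where
  "side_NW n P = map (\<lambda>b. edge_label P (SWNE 0 b)) [0..<n]"

definition side_NE :: "nat \<Rightarrow> piece set \<Rightarrow> bool list" where
  "side_NE n P = map (\<lambda>a. edge_label P (NWSE a (n - 1 - a))) [0..<n]"

definition side_S :: "nat \<Rightarrow> piece set \<Rightarrow> bool list" where
  "side_S n P = map (\<lambda>a. edge_label P (EW a 0)) (rev [0..<n])"

definition boundary_is :: "nat \<Rightarrow> piece set \<Rightarrow> bool list \<Rightarrow> bool list \<Rightarrow> bool list \<Rightarrow> bool" where
  "boundary_is n P l m v \<longleftrightarrow> side_NW n P = l \<and> side_NE n P = m \<and> rev (side_S n P) = v"

text \<open>
  All points \<open>(x, y)\<close> of the rhombus \<open>Equivariant a b\<close> satisfy \<open>a \<le> x \<le> a + 1\<close> and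
  \<open>a + b + 1 \<le> x + y \<le> a + b + 2\<close>. The first strip is the one swept out along SW-NE lines; it
  meets the South side in the edge \<open>EW a 0\<close>, which is number \<open>a + 1\<close> from the left. The
  second strip is swept out along NW-SE lines; it meets the South side in \<open>EW (a + b + 1) 0\<close>,
  which is number \<open>a + b + 2\<close>.
\<close>

definition puzzle_weight :: "piece set \<Rightarrow> ypoly" where
  "puzzle_weight P = (\<Prod>(a, b) \<in> {(a, b). Equivariant a b \<in> P}. yvar (a + b + 2) - yvar (a + 1))"

end

theory Submission
  imports Defs "HOL-Library.Multiset"
begin

text \<open>
  Cutting a puzzle into N-S rhombi and the bottom row of triangles turns the sum over puzzles into the
  partition function of a vertex model. Line \<open>i\<close> enters through edge \<open>i\<close> of the NW side and another
  line \<open>i\<close> through edge \<open>i\<close> of the NE side; both carry \<open>y\<^sub>i\<close>, they leave together through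
  edge \<open>i\<close> of the South side, and a NE line \<open>i\<close> crosses a NW line \<open>j > i\<close> with parameter
  \<open>y\<^sub>j - y\<^sub>i\<close>. The R-matrix \<open>1 + (y\<^sub>i\<^sub>+\<^sub>1 - y\<^sub>i) N\<close> satisfies three local exchange relations with
  these vertices, so that it can be moved from the South side to the NW and NE sides, at the cost of
  exchanging \<open>y\<^sub>i\<close> and \<open>y\<^sub>i\<^sub>+\<^sub>1\<close>.

  Let \<open>c(l, m, v)\<close> be the puzzle sum. Conservation laws of the vertices give \<open>v \<ge> m\<close> whenever
  \<open>c(l, m, v) \<noteq> 0\<close>. With the exchange relation this shows that \<open>S\<^sub>l|\<^sub>s = c(l, s, s)\<close> satisfies the
  recursion of left divided differences, from which the GKM conditions, the support condition, the
  diagonal values and homogeneity follow. The same recursion and the exchange relation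
  prove \<open>\<Sum>\<^sub>v c(l, m, v) S\<^sub>v|\<^sub>s = S\<^sub>l|\<^sub>s S\<^sub>m|\<^sub>s\<close> by induction on the number of inversions of \<open>s\<close>; for
  sorted \<open>s\<close> only one puzzle has South side \<open>s\<close>.
\<close>

section \<open>Puzzles as a vertex model\<close>

text \<open>Exchanging \<open>y_i\<close> with \<open>y_(i+1)\<close> and at the same time letters
  \<open>i\<close> and \<open>i+1\<close> of the fixed points is a ring automorphism, and it carries
  the Schubert basis to itself through the R-matrix (\<open>restr_swap_at\<close>). Structure
  constants must therefore intertwine R on the index \<open>v\<close> with a product of two copies
  of R, one on \<open>l\<close> and one on \<open>m\<close>. The exchange relation states exactly
  this for puzzle sums, so they obey the law of structure constants before any class has been
  constructed. The doubling of R takes place at the South side, where a NW line and a NE line with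
  the same variable leave through one edge.

  Since the variables get permuted, puzzle sums are taken over a list \<open>ys\<close> of ring
  elements rather than over fixed variables; distinct entries of an integral domain allow a root to
  be cancelled. The polynomial variables are inserted only afterwards.

  The label \<open>Ten\<close> cuts each ordinary rhombus into two triangles. All constraints then
  become local, and every relation with R is a finite case distinction over labels.\<close>

text \<open>\<^term>\<open>Ten\<close> labels the edge along which the two triangles of an ordinary rhombus are glued.\<close>

datatype lab = Zero | Ten | One

text \<open>R exchanges neighbouring labels at descents, so the place of \<open>Ten\<close> in the
  order is part of the definition of R. The three local relations below are checked for
  \<open>Ten\<close> strictly between the two bits.\<close>

instantiation lab :: ord
begin
definition "x < y \<longleftrightarrow> x = Zero \<and> y \<noteq> Zero \<or> x = Ten \<and> y = One"
definition "x \<le> y \<longleftrightarrow> x = (y::lab) \<or> x < y"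
instance ..
end

lemma UNIV_lab: "UNIV = {Zero, Ten, One}"
  using lab.exhaust by auto

instance lab :: finite
  by standard (simp add: UNIV_lab)

lemma sum_lab: "(\<Sum>x\<in>UNIV. f x) = f Zero + f Ten + (f One :: 'a::comm_monoid_add)"
  by (simp add: UNIV_lab add.assoc)

text \<open>A \<open>Down\<close> triangle and the \<open>Up\<close> triangle above it form a vertex: the label \<open>a\<close> of the NW edge and
  \<open>s\<close> of the NE edge come in, the label \<open>t\<close> of the SW edge and \<open>b\<close> of the SE edge go out.
  The pair \<open>(a, s)\<close> determines the horizontal edge between the triangles. The equivariant piece is the
  vertex of weight \<open>u\<close>.\<close>

definition vertex_weight :: "'a::comm_ring_1 \<Rightarrow> lab \<Rightarrow> lab \<Rightarrow> lab \<Rightarrow> lab \<Rightarrow> 'a" where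
  "vertex_weight u a s t b =
    (if (a, s) \<in> {(Zero, Zero), (Ten, One)} \<and> (t, b) \<in> {(Zero, Zero), (One, Ten)} \<or>
        (a, s) \<in> {(One, One), (Zero, Ten)} \<and> (t, b) \<in> {(One, One), (Ten, Zero)} \<or>
        (a, s) = (One, Zero) \<and> (t, b) = (Zero, One) then 1
     else if (a, s) = (Zero, One) \<and> (t, b) = (One, Zero) then u else 0)"

text \<open>An upward triangle on the South side. Its South label must be a bit, so the pairs
  \<open>(One, Zero)\<close> and \<open>(Zero, One)\<close>, which belong to vertical rhombi, have
  weight 0.\<close>

definition bottom_weight :: "lab \<Rightarrow> lab \<Rightarrow> bool \<Rightarrow> 'a::comm_ring_1" where
  "bottom_weight a t v = of_bool ((a, t) \<in> (if v then {(One, One), (Zero, Ten)} else {(Zero, Zero), (Ten, One)}))"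

text \<open>The strip next to the NW side: \<open>as\<close> and \<open>bs\<close> label its NW and SE edges from bottom to top (without the
  bottom triangle), \<open>s\<close> enters at the top and \<open>t\<close> leaves at the bottom. The variable \<open>x\<close> belongs to
  the strip, \<open>ys\<close> to the lines crossing it.\<close>

fun strip :: "'a::comm_ring_1 \<Rightarrow> 'a list \<Rightarrow> lab list \<Rightarrow> lab list \<Rightarrow> lab \<Rightarrow> lab \<Rightarrow> 'a" where
  "strip x [] [] [] t s = of_bool (t = s)"
| "strip x (y # ys) (a # as) (b # bs) t s = (\<Sum>q\<in>UNIV. vertex_weight (y - x) a q t b * strip x ys as bs q s)"
| "strip x _ _ _ t s = 0"

definition lab_lists :: "nat \<Rightarrow> lab list set" where
  "lab_lists n = {bs. length bs = n}"

text \<open>Transfer matrix recursion: \<open>bs\<close> labels the SE edges of the first strip,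
  which are the NW side of the remaining triangle, and \<open>t\<close> is the NE edge of the bottom
  triangle.\<close>

fun puzzle_sum :: "'a::comm_ring_1 list \<Rightarrow> lab list \<Rightarrow> lab list \<Rightarrow> bool list \<Rightarrow> 'a" where
  "puzzle_sum [] [] [] [] = 1"
| "puzzle_sum (y # ys) (a # as) (m # ms) (v # vs) =
    (\<Sum>bs\<in>lab_lists (length as). \<Sum>t\<in>UNIV. bottom_weight a t v * strip y ys as bs t m * puzzle_sum ys bs ms vs)"
| "puzzle_sum _ _ _ _ = 0"

lemma finite_lab_lists [simp, intro]: "finite (lab_lists n)"
  using finite_lists_length_eq[of "UNIV::lab set" n] by (simp add: lab_lists_def)

lemma lab_lists_0: "lab_lists 0 = {[]}"
  by (auto simp: lab_lists_def)

lemma sum_lab_lists_Suc: "(\<Sum>bs\<in>lab_lists (Suc n). f bs) = (\<Sum>b\<in>UNIV. \<Sum>bs\<in>lab_lists n. f (b # bs))"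
proof -
  have "(\<Sum>bs\<in>lab_lists (Suc n). f bs) = (\<Sum>(b, bs)\<in>UNIV \<times> lab_lists n. f (b # bs))"
    by (rule sum.reindex_bij_witness[of _ "\<lambda>(b, bs). b # bs" "\<lambda>bs. (hd bs, tl bs)"])
      (auto simp: lab_lists_def length_Suc_conv)
  then show ?thesis by (simp add: sum.cartesian_product)
qed

section \<open>R-matrices and their local exchange relations\<close>

definition swap_at :: "nat \<Rightarrow> 'b list \<Rightarrow> 'b list" where
  "swap_at i xs = xs[i := xs ! Suc i, Suc i := xs ! i]"

definition desc :: "nat \<Rightarrow> 'b::ord list \<Rightarrow> bool" where
  "desc i xs \<longleftrightarrow> xs ! Suc i < xs ! i"

definition asc :: "nat \<Rightarrow> 'b::ord list \<Rightarrow> bool" where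
  "asc i xs \<longleftrightarrow> xs ! i < xs ! Suc i"

lemma swap_at_simps [simp]:
  "swap_at 0 (a # b # xs) = b # a # xs" "swap_at (Suc i) (a # xs) = a # swap_at i xs" "length (swap_at i xs) = length xs"
  by (simp_all add: swap_at_def)

lemma desc_simps [simp]:
  "desc 0 (a # b # xs) \<longleftrightarrow> b < a" "desc (Suc i) (a # xs) \<longleftrightarrow> desc i xs"
  "asc 0 (a # b # xs) \<longleftrightarrow> a < b" "asc (Suc i) (a # xs) \<longleftrightarrow> asc i xs"
  by (simp_all add: desc_def asc_def)

lemma nth_swap_at: "Suc i < length xs \<Longrightarrow> p < length xs \<Longrightarrow>
   swap_at i xs ! p = xs ! (if p = i then Suc i else if p = Suc i then i else p)"
  by (auto simp: swap_at_def nth_list_update)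

lemma swap_at_swap_at [simp]: "Suc i < length xs \<Longrightarrow> swap_at i (swap_at i xs) = xs"
  by (rule nth_equalityI) (auto simp: nth_swap_at)

lemma desc_swap_at: "Suc i < length xs \<Longrightarrow> desc i (swap_at i xs) \<longleftrightarrow> asc i xs"
  "Suc i < length xs \<Longrightarrow> asc i (swap_at i xs) \<longleftrightarrow> desc i xs"
  by (auto simp: desc_def asc_def nth_swap_at)

lemma map_swap_at: "Suc i < length xs \<Longrightarrow> map f (swap_at i xs) = swap_at i (map f xs)"
  by (rule nth_equalityI) (auto simp: nth_swap_at)

text \<open>The R-matrix \<open>1 + u N\<close>, where \<open>N\<close> turns a descent at \<open>i\<close> into an ascent and kills everything else, acting
  from the left, and its transpose.\<close>

definition act :: "'a::comm_ring_1 \<Rightarrow> nat \<Rightarrow> ('b::ord list \<Rightarrow> 'a) \<Rightarrow> 'b list \<Rightarrow> 'a" where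
  "act u i F xs = F xs + (if desc i xs then u * F (swap_at i xs) else 0)"

definition coact :: "'a::comm_ring_1 \<Rightarrow> nat \<Rightarrow> ('b::ord list \<Rightarrow> 'a) \<Rightarrow> 'b list \<Rightarrow> 'a" where
  "coact u i F xs = F xs + (if asc i xs then u * F (swap_at i xs) else 0)"

definition act2 :: "'a::comm_ring_1 \<Rightarrow> ('b::ord \<Rightarrow> 'b \<Rightarrow> 'a) \<Rightarrow> 'b \<Rightarrow> 'b \<Rightarrow> 'a" where
  "act2 u F a b = F a b + (if b < a then u * F b a else 0)"

definition coact2 :: "'a::comm_ring_1 \<Rightarrow> ('b::ord \<Rightarrow> 'b \<Rightarrow> 'a) \<Rightarrow> 'b \<Rightarrow> 'b \<Rightarrow> 'a" where
  "coact2 u F a b = F a b + (if a < b then u * F b a else 0)"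

text \<open>The involution \<open>swap_at i\<close> of \<open>A\<close> matches descents with
  ascents.\<close>

lemma adjoint:
  fixes F :: "'b::ord list \<Rightarrow> 'a::comm_ring_1"
  assumes "\<And>xs. xs \<in> A \<Longrightarrow> Suc i < length xs \<and> swap_at i xs \<in> A"
  shows "(\<Sum>xs\<in>A. F xs * act u i G xs) = (\<Sum>xs\<in>A. coact u i F xs * G xs)"
proof (cases "finite A")
  case True
  have "(\<Sum>xs\<in>A. if desc i xs then u * F xs * G (swap_at i xs) else 0) =
    (\<Sum>xs\<in>A. if asc i xs then u * F (swap_at i xs) * G xs else 0)"
    by (rule sum.reindex_bij_witness[of _ "swap_at i" "swap_at i"])
      (use assms in \<open>auto simp: desc_swap_at\<close>)
  moreover have "F xs * act u i G xs = F xs * G xs + (if desc i xs then u * F xs * G (swap_at i xs) else 0)"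
    "coact u i F xs * G xs = F xs * G xs + (if asc i xs then u * F (swap_at i xs) * G xs else 0)" for xs
    by (simp_all add: act_def coact_def algebra_simps)
  ultimately show ?thesis
    by (simp add: sum.distrib)
qed simp

lemma adjoint2: "(\<Sum>a\<in>UNIV. \<Sum>b\<in>UNIV. act2 u F a b * G a b) = (\<Sum>a\<in>UNIV. \<Sum>b\<in>UNIV. F a b * coact2 u G a b)"
  for F :: "lab \<Rightarrow> lab \<Rightarrow> 'a::comm_ring_1"
  by (simp add: act2_def coact2_def sum_lab less_lab_def algebra_simps)

text \<open>Yang-Baxter equation for two NW lines \<open>y1\<close>, \<open>y2\<close> crossed by
  one NE line \<open>x\<close>: R passes from their outgoing labels to their incoming ones while the
  two vertices trade parameters. Six outer labels give 729 polynomial identities.\<close>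

lemma yang_baxter_NW:
  "coact2 (y2 - y1) (\<lambda>c1 c2. \<Sum>q\<in>UNIV. vertex_weight (y1 - x) a1 q t c1 * vertex_weight (y2 - x) a2 s q c2) c1 c2 =
   act2 (y2 - y1) (\<lambda>a1 a2. \<Sum>q\<in>UNIV. vertex_weight (y2 - x) a1 q t c1 * vertex_weight (y1 - x) a2 s q c2) a1 a2"
  by (cases a1; cases a2; cases s; cases t; cases c1; cases c2;
      simp add: act2_def coact2_def sum_lab less_lab_def vertex_weight_def)

text \<open>The same equation for two NE lines \<open>x1\<close>, \<open>x2\<close> crossed by one
  NW line \<open>y\<close>.\<close>

lemma yang_baxter_NE:
  "coact2 (x2 - x1) (\<lambda>t1 t2. \<Sum>b\<in>UNIV. vertex_weight (y - x1) a s1 t1 b * vertex_weight (y - x2) b s2 t2 c) t1 t2 =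
   act2 (x2 - x1) (\<lambda>s1 s2. \<Sum>b\<in>UNIV. vertex_weight (y - x2) a s1 t1 b * vertex_weight (y - x1) b s2 t2 c) s1 s2"
  by (cases a; cases c; cases s1; cases s2; cases t1; cases t2;
      simp add: act2_def coact2_def sum_lab less_lab_def vertex_weight_def)

text \<open>Two neighbouring bottom triangles and the vertex between them; \<open>t\<close> and
  \<open>b\<close> are the labels of the two edges inside.\<close>

definition corner :: "'a::comm_ring_1 \<Rightarrow> lab \<Rightarrow> lab \<Rightarrow> lab \<Rightarrow> lab \<Rightarrow> bool \<Rightarrow> bool \<Rightarrow> 'a" where
  "corner u a1 a2 m1 m2 v1 v2 =
    (\<Sum>t\<in>UNIV. \<Sum>b\<in>UNIV. bottom_weight a1 t v1 * vertex_weight u a2 m1 t b * bottom_weight b m2 v2)"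

text \<open>Here one R becomes two, one on the NW labels and one on the NE labels. The vertex has
  parameter \<open>y2 - y1\<close>, so trading the variables turns \<open>u\<close> into
  \<open>- u\<close>.\<close>

lemma corner_exchange:
  "coact2 u (corner u a1 a2 m1 m2) v1 v2 =
   act2 u (\<lambda>a1 a2. act2 u (\<lambda>m1 m2. corner (- u) a1 a2 m1 m2 v1 v2) m1 m2) a1 a2"
  by (cases a1; cases a2; cases m1; cases m2; cases v1; cases v2;
      simp add: act2_def coact2_def corner_def sum_lab less_lab_def vertex_weight_def bottom_weight_def)

lemma strip_Cons2:
  "strip x (y1 # y2 # ys) (a1 # a2 # as) (c1 # c2 # cs) t s =
   (\<Sum>r\<in>UNIV. (\<Sum>q\<in>UNIV. vertex_weight (y1 - x) a1 q t c1 * vertex_weight (y2 - x) a2 r q c2) * strip x ys as cs r s)"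
  by (simp add: sum_lab algebra_simps)

lemma coact_Suc: "coact u (Suc i) F (x # xs) = coact u i (\<lambda>xs. F (x # xs)) xs"
  by (simp add: coact_def)

lemma act_Suc: "act u (Suc i) F (x # xs) = act u i (\<lambda>xs. F (x # xs)) xs"
  by (simp add: act_def)

lemma coact_0: "coact u 0 F (x # y # xs) = coact2 u (\<lambda>x y. F (x # y # xs)) x y"
  by (simp add: coact_def coact2_def)

lemma act_0: "act u 0 F (x # y # xs) = act2 u (\<lambda>x y. F (x # y # xs)) x y"
  by (simp add: act_def act2_def)

lemma coact2_sum: "coact2 u (\<lambda>a b. \<Sum>r\<in>A. K r a b * S r) a b = (\<Sum>r\<in>A. coact2 u (K r) a b * S r)"
  by (simp add: coact2_def sum.distrib distrib_right sum_distrib_left mult.assoc)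

lemma act2_sum: "act2 u (\<lambda>a b. \<Sum>r\<in>A. K r a b * S r) a b = (\<Sum>r\<in>A. act2 u (K r) a b * S r)"
  by (simp add: act2_def sum.distrib distrib_right sum_distrib_left mult.assoc)

lemma coact2_sum2: "coact2 u (\<lambda>a b. \<Sum>q\<in>A. \<Sum>r\<in>B. K q r a b * S q r) a b =
    (\<Sum>q\<in>A. \<Sum>r\<in>B. coact2 u (K q r) a b * S q r)"
  by (simp add: coact2_def sum.distrib distrib_right sum_distrib_left mult.assoc)

lemma act2_sum2: "act2 u (\<lambda>a b. \<Sum>q\<in>A. \<Sum>r\<in>B. K q r * S q r a b) a b =
    (\<Sum>q\<in>A. \<Sum>r\<in>B. K q r * act2 u (S q r) a b)"
  by (simp add: act2_def sum.distrib distrib_left sum_distrib_left mult_ac)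

lemma coact_sum: "coact u i (\<lambda>xs. \<Sum>r\<in>A. c r * F r xs) xs = (\<Sum>r\<in>A. c r * coact u i (F r) xs)"
  by (simp add: coact_def sum.distrib distrib_left sum_distrib_left mult_ac)

lemma act_sum: "act u i (\<lambda>xs. \<Sum>r\<in>A. c r * F r xs) xs = (\<Sum>r\<in>A. c r * act u i (F r) xs)"
  by (simp add: act_def sum.distrib distrib_left sum_distrib_left mult_ac)

text \<open>Only the vertices \<open>i\<close> and \<open>i + 1\<close> of the strip meet R; those
  before them are constant factors, which the induction splits off.\<close>

lemma strip_exchange:
  assumes "Suc i < length ys" "length as = length ys" "length cs = length ys"
  shows "coact (ys ! Suc i - ys ! i) i (\<lambda>cs. strip x ys as cs t s) cs =
    act (ys ! Suc i - ys ! i) i (\<lambda>as. strip x (swap_at i ys) as cs t s) as"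
  using assms
proof (induction i arbitrary: ys as cs t)
  case 0
  obtain y1 y2 ys' where ys: "ys = y1 # y2 # ys'"
    using 0 by (cases ys; cases "tl ys"; auto)
  obtain a1 a2 as' c1 c2 cs' where as: "as = a1 # a2 # as'" and cs: "cs = c1 # c2 # cs'"
    using 0 ys by (auto simp: length_Suc_conv)
  show ?case
    unfolding ys as cs
    by (simp only: swap_at_simps nth_Cons_0 nth_Cons_Suc coact_0 act_0 strip_Cons2 coact2_sum act2_sum
        yang_baxter_NW)
next
  case (Suc i)
  obtain y ys' a as' c cs' where ys: "ys = y # ys'" and as: "as = a # as'" and cs: "cs = c # cs'"
    using Suc.prems by (cases ys; cases as; cases cs; auto)
  show ?case
    unfolding ys as cs
    using Suc.prems Suc.IH[of ys' as' cs'] ys as cs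
    by (simp add: coact_Suc act_Suc coact_sum act_sum)
qed

definition strip2 :: "'a::comm_ring_1 \<Rightarrow> 'a \<Rightarrow> 'a list \<Rightarrow> lab list \<Rightarrow> lab list \<Rightarrow> lab \<Rightarrow> lab \<Rightarrow> lab \<Rightarrow> lab \<Rightarrow> 'a" where
  "strip2 x1 x2 ys as cs t1 t2 s1 s2 =
    (\<Sum>bs\<in>lab_lists (length as). strip x1 ys as bs t1 s1 * strip x2 ys bs cs t2 s2)"

lemma strip2_Nil: "strip2 x1 x2 [] [] [] t1 t2 s1 s2 = of_bool (t1 = s1) * of_bool (t2 = s2)"
  by (simp add: strip2_def lab_lists_0)

lemma strip2_Cons:
  "strip2 x1 x2 (y # ys) (a # as) (c # cs) t1 t2 s1 s2 =
   (\<Sum>q1\<in>UNIV. \<Sum>q2\<in>UNIV. (\<Sum>b\<in>UNIV. vertex_weight (y - x1) a q1 t1 b * vertex_weight (y - x2) b q2 t2 c) *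
     strip2 x1 x2 ys as cs q1 q2 s1 s2)"
proof -
  have "strip2 x1 x2 (y # ys) (a # as) (c # cs) t1 t2 s1 s2 =
    (\<Sum>b\<in>UNIV. \<Sum>bs\<in>lab_lists (length as). \<Sum>q1\<in>UNIV. \<Sum>q2\<in>UNIV.
       (vertex_weight (y - x1) a q1 t1 b * vertex_weight (y - x2) b q2 t2 c) * (strip x1 ys as bs q1 s1 * strip x2 ys bs cs q2 s2))"
    by (simp add: strip2_def sum_lab_lists_Suc sum_product mult_ac)
  also have "\<dots> = (\<Sum>b\<in>UNIV. \<Sum>q1\<in>UNIV. \<Sum>q2\<in>UNIV.
       (vertex_weight (y - x1) a q1 t1 b * vertex_weight (y - x2) b q2 t2 c) * strip2 x1 x2 ys as cs q1 q2 s1 s2)"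
    unfolding strip2_def sum_distrib_left
    by (intro sum.cong refl) (simp add: sum.swap[of _ "UNIV::lab set" "lab_lists (length as)"])
  also have "\<dots> = (\<Sum>q1\<in>UNIV. \<Sum>q2\<in>UNIV. \<Sum>b\<in>UNIV.
       (vertex_weight (y - x1) a q1 t1 b * vertex_weight (y - x2) b q2 t2 c) * strip2 x1 x2 ys as cs q1 q2 s1 s2)"
    by (subst sum.swap, rule sum.cong[OF refl], rule sum.swap)
  finally show ?thesis by (simp add: sum_distrib_right)
qed

text \<open>R starts at the lower ends of two neighbouring NE lines, crosses one NW line by
  \<open>yang_baxter_NE\<close>, and passes by adjointness over the summed labels \<open>q1\<close>,
  \<open>q2\<close> to the shorter pair of strips.\<close>

lemma strip2_exchange:
  assumes "length as = length ys" "length cs = length ys"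
  shows "coact2 (x2 - x1) (\<lambda>t1 t2. strip2 x1 x2 ys as cs t1 t2 s1 s2) t1 t2 =
    act2 (x2 - x1) (\<lambda>s1 s2. strip2 x2 x1 ys as cs t1 t2 s1 s2) s1 s2"
  using assms
proof (induction ys arbitrary: as cs t1 t2)
  case Nil
  then show ?case
    by (cases t1; cases t2; cases s1; cases s2;
      simp add: strip2_Nil act2_def coact2_def less_lab_def)
next
  case (Cons y ys)
  obtain a as' c cs' where as: "as = a # as'" and cs: "cs = c # cs'"
    using Cons.prems by (auto simp: length_Suc_conv)
  let ?u = "x2 - x1"
  have "coact2 ?u (\<lambda>t1 t2. strip2 x1 x2 (y # ys) as cs t1 t2 s1 s2) t1 t2 =
    (\<Sum>q1\<in>UNIV. \<Sum>q2\<in>UNIV. coact2 ?u (\<lambda>t1 t2. \<Sum>b\<in>UNIV. vertex_weight (y - x1) a q1 t1 b * vertex_weight (y - x2) b q2 t2 c) t1 t2 *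
     strip2 x1 x2 ys as' cs' q1 q2 s1 s2)"
    unfolding as cs strip2_Cons by (rule coact2_sum2)
  also have "\<dots> = (\<Sum>q1\<in>UNIV. \<Sum>q2\<in>UNIV. (\<Sum>b\<in>UNIV. vertex_weight (y - x2) a q1 t1 b * vertex_weight (y - x1) b q2 t2 c) *
     coact2 ?u (\<lambda>q1 q2. strip2 x1 x2 ys as' cs' q1 q2 s1 s2) q1 q2)"
    unfolding yang_baxter_NE by (rule adjoint2)
  also have "\<dots> = (\<Sum>q1\<in>UNIV. \<Sum>q2\<in>UNIV. (\<Sum>b\<in>UNIV. vertex_weight (y - x2) a q1 t1 b * vertex_weight (y - x1) b q2 t2 c) *
     act2 ?u (\<lambda>s1 s2. strip2 x2 x1 ys as' cs' q1 q2 s1 s2) s1 s2)"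
    using Cons.IH[of as' cs'] Cons.prems as cs by simp
  also have "\<dots> = act2 ?u (\<lambda>s1 s2. strip2 x2 x1 (y # ys) as cs t1 t2 s1 s2) s1 s2"
    unfolding as cs strip2_Cons by (rule act2_sum2[symmetric])
  finally show ?case .
qed

lemma act2_sum2_right: "act2 u (\<lambda>a b. \<Sum>q\<in>A. \<Sum>r\<in>B. K q r a b * S q r) a b =
    (\<Sum>q\<in>A. \<Sum>r\<in>B. act2 u (K q r) a b * S q r)"
  by (simp add: act2_def sum.distrib distrib_right sum_distrib_left mult.assoc)

lemma act_sum_right: "act u i (\<lambda>xs. \<Sum>r\<in>A. F r xs * c r) xs = (\<Sum>r\<in>A. act u i (F r) xs * c r)"
  using act_sum[of u i c F A xs] by (simp add: mult.commute)

section \<open>Moving an R-matrix through a puzzle\<close>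

text \<open>Reorders the sums so that everything that R meets on its way from the first two South
  edges stands apart: the corner, then the double strip. The smaller puzzle is a mere
  factor.\<close>

lemma puzzle_sum_Cons2:
  "puzzle_sum (y1 # y2 # ys) (a1 # a2 # as) (m1 # m2 # ms) (v1 # v2 # vs) =
   (\<Sum>cs\<in>lab_lists (length as). (\<Sum>q\<in>UNIV. \<Sum>t\<in>UNIV. corner (y2 - y1) a1 a2 q t v1 v2 *
      strip2 y1 y2 ys as cs q t m1 m2) * puzzle_sum ys cs ms vs)"
proof -
  let ?N = "lab_lists (length as)" and ?u = "y2 - y1"
  have "puzzle_sum (y1 # y2 # ys) (a1 # a2 # as) (m1 # m2 # ms) (v1 # v2 # vs) =
    (\<Sum>b\<in>UNIV. \<Sum>bs\<in>?N. \<Sum>p\<in>UNIV. bottom_weight a1 p v1 * (\<Sum>q\<in>UNIV. vertex_weight ?u a2 q p b * strip y1 ys as bs q m1) *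
      (\<Sum>cs\<in>lab_lists (length bs). \<Sum>t\<in>UNIV. bottom_weight b t v2 * strip y2 ys bs cs t m2 * puzzle_sum ys cs ms vs))"
    by (simp add: sum_lab_lists_Suc)
  also have "\<dots> = (\<Sum>b\<in>UNIV. \<Sum>bs\<in>?N. \<Sum>p\<in>UNIV. bottom_weight a1 p v1 * (\<Sum>q\<in>UNIV. vertex_weight ?u a2 q p b * strip y1 ys as bs q m1) *
      (\<Sum>cs\<in>?N. \<Sum>t\<in>UNIV. bottom_weight b t v2 * strip y2 ys bs cs t m2 * puzzle_sum ys cs ms vs))"
    by (intro sum.cong refl) (simp add: lab_lists_def)
  also have "\<dots> = (\<Sum>b\<in>UNIV. \<Sum>bs\<in>?N. \<Sum>p\<in>UNIV. \<Sum>cs\<in>?N. \<Sum>q\<in>UNIV. \<Sum>t\<in>UNIV.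
      bottom_weight a1 p v1 * vertex_weight ?u a2 q p b * bottom_weight b t v2 * (strip y1 ys as bs q m1 * strip y2 ys bs cs t m2 * puzzle_sum ys cs ms vs))"
    by (simp add: sum_distrib_left sum_distrib_right mult_ac)
  also have "\<dots> = (\<Sum>cs\<in>?N. \<Sum>q\<in>UNIV. \<Sum>t\<in>UNIV. \<Sum>bs\<in>?N. \<Sum>p\<in>UNIV. \<Sum>b\<in>UNIV.
      bottom_weight a1 p v1 * vertex_weight ?u a2 q p b * bottom_weight b t v2 * (strip y1 ys as bs q m1 * strip y2 ys bs cs t m2 * puzzle_sum ys cs ms vs))"
    unfolding sum.cartesian_product
    by (rule sum.reindex_bij_witness[of _ "\<lambda>(cs, q, t, bs, p, b). (b, bs, p, cs, q, t)"
          "\<lambda>(b, bs, p, cs, q, t). (cs, q, t, bs, p, b)"]) auto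
  also have "\<dots> = (\<Sum>cs\<in>?N. (\<Sum>q\<in>UNIV. \<Sum>t\<in>UNIV. corner ?u a1 a2 q t v1 v2 *
      strip2 y1 y2 ys as cs q t m1 m2) * puzzle_sum ys cs ms vs)"
    unfolding corner_def strip2_def
    by (simp only: sum_distrib_left sum_distrib_right mult.assoc)
  finally show ?thesis .
qed

text \<open>R splits at the corner. Its NW copy is already on the outer side; its NE copy still has
  to cross the double strip.\<close>

lemma puzzle_sum_exchange_0:
  assumes "length as = length ys" "length ms = length ys" "length vs = length ys"
  shows "coact2 (y2 - y1) (\<lambda>v1 v2. puzzle_sum (y1 # y2 # ys) (a1 # a2 # as) (m1 # m2 # ms) (v1 # v2 # vs)) v1 v2 =
    act2 (y2 - y1) (\<lambda>a1 a2. act2 (y2 - y1) (\<lambda>m1 m2.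
      puzzle_sum (y2 # y1 # ys) (a1 # a2 # as) (m1 # m2 # ms) (v1 # v2 # vs)) m1 m2) a1 a2"
proof -
  let ?N = "lab_lists (length as)" and ?u = "y2 - y1"
  have "coact2 ?u (\<lambda>v1 v2. puzzle_sum (y1 # y2 # ys) (a1 # a2 # as) (m1 # m2 # ms) (v1 # v2 # vs)) v1 v2 =
    (\<Sum>cs\<in>?N. (\<Sum>q\<in>UNIV. \<Sum>t\<in>UNIV. coact2 ?u (corner ?u a1 a2 q t) v1 v2 *
      strip2 y1 y2 ys as cs q t m1 m2) * puzzle_sum ys cs ms vs)"
    unfolding puzzle_sum_Cons2 coact2_sum coact2_sum2 ..
  also have "\<dots> = act2 ?u (\<lambda>a1 a2. \<Sum>cs\<in>?N. (\<Sum>q\<in>UNIV. \<Sum>t\<in>UNIV.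
      act2 ?u (\<lambda>q t. corner (- ?u) a1 a2 q t v1 v2) q t * strip2 y1 y2 ys as cs q t m1 m2) * puzzle_sum ys cs ms vs) a1 a2"
    unfolding corner_exchange act2_sum by (simp add: act2_sum2_right )
  also have "\<dots> = act2 ?u (\<lambda>a1 a2. \<Sum>cs\<in>?N. (\<Sum>q\<in>UNIV. \<Sum>t\<in>UNIV. corner (- ?u) a1 a2 q t v1 v2 *
      act2 ?u (\<lambda>m1 m2. strip2 y2 y1 ys as cs q t m1 m2) m1 m2) * puzzle_sum ys cs ms vs) a1 a2"
    unfolding adjoint2
    by (intro arg_cong[where f = "\<lambda>F. act2 ?u F a1 a2"] ext sum.cong refl)
      (use assms in \<open>simp add: strip2_exchange lab_lists_def\<close>)
  also have "\<dots> = act2 ?u (\<lambda>a1 a2. act2 ?u (\<lambda>m1 m2. \<Sum>cs\<in>?N. (\<Sum>q\<in>UNIV. \<Sum>t\<in>UNIV. corner (- ?u) a1 a2 q t v1 v2 *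
      strip2 y2 y1 ys as cs q t m1 m2) * puzzle_sum ys cs ms vs) m1 m2) a1 a2"
    unfolding act2_sum act2_sum2 ..
  finally show ?thesis by (simp add: puzzle_sum_Cons2 del: puzzle_sum.simps)
qed

text \<open>By induction R leaves the puzzle behind the first strip as two copies. The one on
  \<open>ms\<close> has reached the NE side; the one on \<open>bs\<close> still has to cross the
  first strip.\<close>

theorem puzzle_sum_exchange:
  assumes "Suc i < length ys" "length as = length ys" "length ms = length ys" "length vs = length ys"
  shows "coact (ys ! Suc i - ys ! i) i (puzzle_sum ys as ms) vs =
    act (ys ! Suc i - ys ! i) i (\<lambda>as. act (ys ! Suc i - ys ! i) i (\<lambda>ms. puzzle_sum (swap_at i ys) as ms vs) ms) as"
  using assms
proof (induction i arbitrary: ys as ms vs)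
  case 0
  obtain y1 y2 ys' where ys: "ys = y1 # y2 # ys'"
    using 0 by (cases ys; cases "tl ys"; auto)
  obtain a1 a2 as' m1 m2 ms' v1 v2 vs' where
    as: "as = a1 # a2 # as'" and ms: "ms = m1 # m2 # ms'" and vs: "vs = v1 # v2 # vs'"
    using 0 ys by (auto simp: length_Suc_conv)
  show ?case
    using puzzle_sum_exchange_0[of as' ys' ms' vs'] 0(2-4)
    unfolding ys as ms vs by (simp add: coact_0 act_0 del: puzzle_sum.simps)
next
  case (Suc i)
  obtain y ys' a as' m ms' v vs' where ys: "ys = y # ys'" and as: "as = a # as'"
    and ms: "ms = m # ms'" and vs: "vs = v # vs'"
    using Suc.prems by (cases ys; cases as; cases ms; cases vs; auto)
  let ?u = "ys' ! Suc i - ys' ! i" and ?N = "lab_lists (length as')"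
  \<comment> \<open>\<open>G\<close> absorbs the copy of R that is already on the NE side, so that
    \<open>adjoint\<close> can be applied to the other copy alone.\<close>
  define G where "G = (\<lambda>bs. act ?u i (\<lambda>ms. puzzle_sum (swap_at i ys') bs ms vs') ms')"
  have len: "Suc i < length ys'" "length as' = length ys'" "length ms' = length ys'" "length vs' = length ys'"
    using Suc.prems ys as ms vs by auto
  have "coact ?u i (\<lambda>vs. puzzle_sum ys as ms (v # vs)) vs' =
    (\<Sum>bs\<in>?N. (\<Sum>t\<in>UNIV. bottom_weight a t v * strip y ys' as' bs t m) * coact ?u i (puzzle_sum ys' bs ms') vs')"
    unfolding ys as ms by (simp add: coact_sum flip: sum_distrib_right)
  also have "\<dots> = (\<Sum>bs\<in>?N. (\<Sum>t\<in>UNIV. bottom_weight a t v * strip y ys' as' bs t m) * act ?u i G bs)"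
    unfolding G_def using len by (intro sum.cong refl) (simp add: Suc.IH lab_lists_def)
  also have "\<dots> = (\<Sum>bs\<in>?N. coact ?u i (\<lambda>bs. \<Sum>t\<in>UNIV. bottom_weight a t v * strip y ys' as' bs t m) bs * G bs)"
    using len by (intro adjoint) (auto simp: lab_lists_def)
  also have "\<dots> = (\<Sum>bs\<in>?N. act ?u i (\<lambda>as. \<Sum>t\<in>UNIV. bottom_weight a t v * strip y (swap_at i ys') as bs t m) as' * G bs)"
    unfolding coact_sum act_sum using len by (intro sum.cong refl) (simp add: strip_exchange lab_lists_def)
  also have "\<dots> = act ?u i (\<lambda>as. \<Sum>bs\<in>?N. (\<Sum>t\<in>UNIV. bottom_weight a t v * strip y (swap_at i ys') as bs t m) * G bs) as'"
    by (simp add: act_sum_right)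
  also have "\<dots> = act ?u i (\<lambda>as. act ?u i (\<lambda>ms. \<Sum>bs\<in>?N. (\<Sum>t\<in>UNIV. bottom_weight a t v * strip y (swap_at i ys') as bs t m) *
      puzzle_sum (swap_at i ys') bs ms vs') ms') as'"
    unfolding G_def act_sum ..
  also have "\<dots> = act ?u i (\<lambda>as. act ?u i (\<lambda>ms. puzzle_sum (swap_at (Suc i) ys) (a # as) (m # ms) vs) ms') as'"
    unfolding ys vs by (simp add: act_def flip: sum_distrib_right)
  finally show ?case
    unfolding ys as ms vs coact_Suc act_Suc by simp
qed

section \<open>Conservation laws and triangularity\<close>

definition bit :: "bool \<Rightarrow> lab" where
  "bit b = (if b then One else Zero)"

lemma bit_simps [simp]: "bit True = One" "bit False = Zero" "bit b \<noteq> Ten" "bit b = One \<longleftrightarrow> b"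
    "bit b = Zero \<longleftrightarrow> \<not> b" "bit b < bit c \<longleftrightarrow> b < c" "bit b = bit c \<longleftrightarrow> b = c"
  by (auto simp: bit_def less_lab_def)

definition string_sum :: "'a::comm_ring_1 list \<Rightarrow> bool list \<Rightarrow> bool list \<Rightarrow> bool list \<Rightarrow> 'a" where
  "string_sum ys l m v = puzzle_sum ys (map bit l) (map bit m) v"

lemma act_map_bit:
  "Suc i < length xs \<Longrightarrow> act u i F (map bit xs) = act u i (\<lambda>xs. F (map bit xs)) xs"
  by (simp add: act_def desc_def map_swap_at)

lemma string_sum_exchange:
  assumes "Suc i < length ys" "length l = length ys" "length m = length ys" "length v = length ys"
  shows "coact (ys ! Suc i - ys ! i) i (string_sum ys l m) v =
    act (ys ! Suc i - ys ! i) i (\<lambda>l. act (ys ! Suc i - ys ! i) i (\<lambda>m. string_sum (swap_at i ys) l m v) m) l"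
  using puzzle_sum_exchange[of i ys "map bit l" "map bit m" v] assms
  by (simp add: act_map_bit) (auto simp: coact_def act_def string_sum_def split: if_splits)

lemma vertex_weight_conserve:
  "vertex_weight u a s t b \<noteq> 0 \<Longrightarrow> of_bool (s \<noteq> Zero) + of_bool (b = Ten) = of_bool (t \<noteq> Zero) + (of_bool (a = Ten) :: nat)"
  "vertex_weight u a s t b \<noteq> 0 \<Longrightarrow> of_bool (a = One) + of_bool (s = Ten) = of_bool (b = One) + (of_bool (t = Ten) :: nat)"
  by (auto simp: vertex_weight_def split: if_splits)

lemma bottom_weight_conserve:
  "bottom_weight a t v \<noteq> 0 \<Longrightarrow> of_bool (t \<noteq> Zero) = of_bool v + (of_bool (a = Ten) :: nat)"
  "bottom_weight a t v \<noteq> 0 \<Longrightarrow> of_bool (a = One) + of_bool (t = Ten) = (of_bool v :: nat)"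
  by (auto simp: bottom_weight_def split: if_splits)

lemma sum_nonzeroE:
  assumes "sum f A \<noteq> 0" obtains x where "x \<in> A" "f x \<noteq> 0"
  using assms by (meson sum.neutral)

lemma strip_nonzero_Cons:
  assumes "strip x (y # ys) (a # as) (b # bs) t s \<noteq> 0"
  obtains q where "vertex_weight (y - x) a q t b \<noteq> 0" "strip x ys as bs q s \<noteq> 0"
proof -
  from assms obtain q where "vertex_weight (y - x) a q t b * strip x ys as bs q s \<noteq> 0"
    by (auto elim: sum_nonzeroE)
  then show thesis using that[of q] by fastforce
qed

lemma strip_conserve:
  assumes "strip x ys as bs t s \<noteq> 0"
  shows "of_bool (s \<noteq> Zero) + count_list bs Ten = of_bool (t \<noteq> Zero) + count_list as Ten"
    and "count_list as One + of_bool (s = Ten) = count_list bs One + of_bool (t = Ten)"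
  using assms
proof (induction x ys as bs t s rule: strip.induct)
  case (2 x y ys a as b bs t s)
  {
    case 1
    then obtain q where q: "vertex_weight (y - x) a q t b \<noteq> 0" "strip x ys as bs q s \<noteq> 0"
      by (rule strip_nonzero_Cons)
    from vertex_weight_conserve(1)[OF q(1)] "2.IH"(1)[OF _ q(2)] show ?case
      by (auto simp: of_bool_def split: if_splits)
  next
    case 2
    then obtain q where q: "vertex_weight (y - x) a q t b \<noteq> 0" "strip x ys as bs q s \<noteq> 0"
      by (rule strip_nonzero_Cons)
    from vertex_weight_conserve(2)[OF q(1)] "2.IH"(2)[OF _ q(2)] show ?case
      by (auto simp: of_bool_def split: if_splits)
  }
qed (auto split: if_splits)

lemma puzzle_sum_nonzero_Cons:
  assumes "puzzle_sum (y # ys) (a # as) (m # ms) (v # vs) \<noteq> 0"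
  obtains bs t where "length bs = length as" "bottom_weight a t v \<noteq> (0::'a::comm_ring_1)"
    "strip y ys as bs t m \<noteq> 0" "puzzle_sum ys bs ms vs \<noteq> (0::'a)"
proof -
  from assms obtain bs t where "bs \<in> lab_lists (length as)"
    "bottom_weight a t v * strip y ys as bs t m * puzzle_sum ys bs ms vs \<noteq> (0::'a)"
    by (auto elim!: sum_nonzeroE)
  then show thesis using that[of bs t] by (fastforce simp: lab_lists_def)
qed

text \<open>In each strip the first charge gives: 1 if \<open>m\<close> is not \<open>Zero\<close>,
  plus the number of \<open>Ten\<close> in \<open>bs\<close>, equals 1 if \<open>v\<close> is one,
  plus the number of \<open>Ten\<close> in the NW labels. Adding up \<open>j\<close> strips
  telescopes; the \<open>Ten\<close> labels of the last column are dropped. With bits on the NW side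
  this is dominance.\<close>

lemma puzzle_sum_dominance:
  assumes "puzzle_sum ys as ms vs \<noteq> 0"
  shows "length (filter (\<lambda>m. m \<noteq> Zero) (take j ms)) \<le> count_list (take j vs) True + count_list as Ten"
  using assms
proof (induction ys as ms vs arbitrary: j rule: puzzle_sum.induct)
  case (2 y ys a as m ms v vs)
  from 2(2) obtain bs t where *: "length bs = length as" "bottom_weight a t v \<noteq> (0::'a)"
    "strip y ys as bs t m \<noteq> 0" "puzzle_sum ys bs ms vs \<noteq> (0::'a)"
    by (rule puzzle_sum_nonzero_Cons)
  have "length (filter (\<lambda>m. m \<noteq> Zero) (take j' ms)) \<le> count_list (take j' vs) True + count_list bs Ten" for j'
    using 2(1)[of bs] * by (auto simp: lab_lists_def)
  from this[of "j - 1"] strip_conserve(1)[OF *(3)] bottom_weight_conserve(1)[OF *(2)] show ?case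
    by (cases j) (auto simp: of_bool_def split: if_splits)
qed auto

lemma puzzle_sum_conserve:
  assumes "puzzle_sum ys as ms vs \<noteq> 0"
  shows "count_list as One + count_list ms Ten = count_list vs True"
  using assms
proof (induction ys as ms vs rule: puzzle_sum.induct)
  case (2 y ys a as m ms v vs)
  from 2(2) obtain bs t where *: "length bs = length as" "bottom_weight a t v \<noteq> (0::'a)"
    "strip y ys as bs t m \<noteq> 0" "puzzle_sum ys bs ms vs \<noteq> (0::'a)"
    by (rule puzzle_sum_nonzero_Cons)
  have "count_list bs One + count_list ms Ten = count_list vs True"
    using 2(1)[of bs] * by (auto simp: lab_lists_def)
  with strip_conserve(2)[OF *(3)] bottom_weight_conserve(2)[OF *(2)] show ?case
    by (auto simp: of_bool_def split: if_splits)
qed auto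

lemma count_list_map_bit [simp]:
  "count_list (map bit l) Ten = 0" "count_list (map bit l) One = count_list l True"
  by (induction l) auto

section \<open>Prefix counts, dominance and rank\<close>

definition ones :: "nat \<Rightarrow> bool list \<Rightarrow> nat" where
  "ones j l = count_list (take j l) True"

definition prefix_dom :: "bool list \<Rightarrow> bool list \<Rightarrow> bool" where
  "prefix_dom v l \<longleftrightarrow> (\<forall>j. ones j l \<le> ones j v)"

lemma string_sum_prefix_dom: "string_sum ys l m v \<noteq> 0 \<Longrightarrow> prefix_dom v m"
proof -
  have *: "length (filter ((\<lambda>m. m \<noteq> Zero) \<circ> bit) xs) = count_list xs True" for xs
    by (induction xs) auto
  assume "string_sum ys l m v \<noteq> 0"
  then show ?thesis
    unfolding prefix_dom_def ones_def string_sum_def using puzzle_sum_dominance[of ys "map bit l" "map bit m" v]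
    by (simp add: take_map filter_map *)
qed

lemma string_sum_content: "string_sum ys l m v \<noteq> 0 \<Longrightarrow> count_list l True = count_list v True"
  unfolding string_sum_def by (drule puzzle_sum_conserve) simp

lemma string_sum_length: "string_sum ys l m v \<noteq> 0 \<Longrightarrow> length l = length ys \<and> length m = length ys \<and> length v = length ys"
proof -
  have "length as = length ys \<and> length ms = length ys \<and> length vs = length ys"
    if "puzzle_sum ys as ms vs \<noteq> 0" for ys :: "'a list" and as ms vs
    using that
  proof (induction ys as ms vs rule: puzzle_sum.induct)
    case (2 y ys a as m ms v vs)
    from 2(2) obtain bs t where "length bs = length as" "puzzle_sum ys bs ms vs \<noteq> (0::'a)"
      by (rule puzzle_sum_nonzero_Cons)
    with 2(1)[of bs] show ?case by (auto simp: lab_lists_def)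
  qed auto
  from this[of ys "map bit l" "map bit m" v] show "string_sum ys l m v \<noteq> 0 \<Longrightarrow> ?thesis"
    by (simp add: string_sum_def)
qed

lemma ones_simps [simp]:
  "ones 0 l = 0" "ones (Suc j) (a # l) = of_bool a + ones j l" "ones j [] = 0"
  by (auto simp: ones_def)

lemma ones_swap_at:
  "Suc i < length s \<Longrightarrow> desc i s \<Longrightarrow> ones j s = ones j (swap_at i s) + of_bool (j = Suc i)"
proof (induction i arbitrary: s j)
  case 0
  then obtain s' where "s = True # False # s'"
    by (cases s; cases "tl s"; auto)
  then show ?case by (cases j; cases "j - 1"; auto)
next
  case (Suc i)
  then obtain a s' where s: "s = a # s'" by (cases s) auto
  show ?case using Suc.prems Suc.IH[of s' "j - 1"] s by (cases j) auto
qed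

lemma ones_Suc: "j < length l \<Longrightarrow> ones (Suc j) l = ones j l + of_bool (l ! j)"
  by (simp add: ones_def take_Suc_conv_app_nth)

text \<open>Monotone for dominance and lowered by exactly one when a descent is removed; on strings
  of fixed content it is the number of inversions up to a constant
  (\<open>card_inversions_rank\<close>).\<close>

definition rank :: "bool list \<Rightarrow> nat" where
  "rank l = (\<Sum>j\<le>length l. ones j l)"

lemma rank_swap_at:
  assumes "Suc i < length s" "desc i s"
  shows "rank s = Suc (rank (swap_at i s))"
proof -
  have "rank s = (\<Sum>j\<le>length s. ones j (swap_at i s) + of_bool (j = Suc i))"
    unfolding rank_def using ones_swap_at[OF assms] by simp
  also have "\<dots> = rank (swap_at i s) + (\<Sum>j\<le>length s. of_bool (j = Suc i))"
    by (simp add: sum.distrib rank_def)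
  also have "(\<Sum>j\<le>length s. of_bool (j = Suc i)) = (1::nat)"
    using assms(1) by (simp add: of_bool_def)
  finally show ?thesis by simp
qed

lemma ones_inject:
  assumes "length l = length l'" "\<And>j. j \<le> length l \<Longrightarrow> ones j l = ones j l'"
  shows "l = l'"
proof (rule nth_equalityI)
  fix j assume "j < length l"
  then show "l ! j = l' ! j"
    using assms(2)[of j] assms(2)[of "Suc j"] assms(1) by (simp add: ones_Suc of_bool_def split: if_splits)
qed (fact assms(1))

lemma prefix_dom_refl: "prefix_dom l l"
  by (simp add: prefix_dom_def)

lemma prefix_dom_trans: "prefix_dom a b \<Longrightarrow> prefix_dom b c \<Longrightarrow> prefix_dom a c"
  unfolding prefix_dom_def by (meson order_trans)

lemma prefix_dom_swap_at: "Suc i < length s \<Longrightarrow> desc i s \<Longrightarrow> prefix_dom s (swap_at i s)"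
  using ones_swap_at[of i s] by (simp add: prefix_dom_def)

lemma prefix_dom_rank: "prefix_dom v l \<Longrightarrow> length v = length l \<Longrightarrow> rank l \<le> rank v"
  unfolding prefix_dom_def rank_def by (simp add: sum_mono)

lemma prefix_dom_rank_less:
  assumes "prefix_dom v l" "length v = length l" "v \<noteq> l"
  shows "rank l < rank v"
proof -
  obtain j where "j \<le> length l" "ones j l \<noteq> ones j v"
    using ones_inject[of l v] assms by auto
  then have "ones j l < ones j v" using assms(1) by (auto simp: prefix_dom_def order_less_le)
  then show ?thesis
    unfolding rank_def using assms \<open>j \<le> length l\<close>
    by (simp add: prefix_dom_def) (rule sum_strict_mono_ex1, auto)
qed

lemma desc_bool: "desc i (s :: bool list) \<longleftrightarrow> s ! i \<and> \<not> s ! Suc i"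
  by (auto simp: desc_def)

lemma count_list_swap_at: "Suc i < length s \<Longrightarrow> count_list (swap_at i s) x = count_list s x"
  by (metis mset_swap Suc_lessD swap_at_def count_mset)

lemma swap_at_in_strings [simp]: "l \<in> strings n k \<Longrightarrow> Suc i < n \<Longrightarrow> swap_at i l \<in> strings n k"
  by (simp add: strings_def count_list_swap_at)

text \<open>Bubble sort: a string that is not sorted (zeroes first) has a descent at neighbouring
  positions, and removing it lowers \<open>rank\<close>.\<close>

lemma desc_induct [case_names sorted swap_at]:
  assumes "\<And>s. sorted s \<Longrightarrow> P s"
    and "\<And>s i. Suc i < length s \<Longrightarrow> desc i s \<Longrightarrow> P (swap_at i s) \<Longrightarrow> P s"
  shows "P (s :: bool list)"
proof (induction "rank s" arbitrary: s rule: less_induct)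
  case less
  show ?case
  proof (cases "sorted s")
    case False
    then obtain i where "Suc i < length s" "desc i s"
      by (auto simp: sorted_iff_nth_Suc desc_bool)
    then show ?thesis using assms(2) less rank_swap_at by auto
  qed (rule assms(1))
qed

lemma sorted_same_content:
  assumes "sorted s" "sorted t" "length s = length t" "count_list s True = count_list t True"
  shows "s = (t :: bool list)"
proof -
  have *: "count_list l False = length l - count_list l True" for l
    by (induction l) (auto simp: Suc_diff_le count_le_length)
  have "count_list s b = count_list t b" for b
    using assms(3,4) *[of s] *[of t] by (cases b) auto
  then have "mset s = mset t" by (intro multiset_eqI) (simp add: count_mset)
  then show ?thesis using assms(1,2) by (metis properties_for_sort sorted_sort_id)
qed

text \<open>If \<open>m\<close> had a descent, removing it would keep \<open>m\<close> below
  \<open>w\<close>, so the result would be \<open>w\<close> by induction; but then \<open>w\<close>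
  has smaller rank than \<open>m\<close>, which contradicts dominance.\<close>

lemma sorted_prefix_dom_eq:
  assumes "sorted w" "prefix_dom w m" "length m = length w" "count_list m True = count_list w True"
  shows "m = w"
  using assms(2-)
proof (induction m rule: desc_induct)
  case (sorted m)
  then show ?case using sorted_same_content[of m w] assms(1) by simp
next
  case (swap_at m i)
  then have "swap_at i m = w"
    using prefix_dom_trans[OF _ prefix_dom_swap_at] by (auto simp: count_list_swap_at)
  then show ?case using prefix_dom_rank[OF swap_at.prems(1)] rank_swap_at[of i m] swap_at by auto
qed

text \<open>With no \<open>Ten\<close> on the SE edges, the bit leaving at the bottom forces the
  same bit all along the line, and the NW labels pass straight through with weight 1. The hypothesis
  on \<open>v\<close> excludes a zero crossing a line that carries a one, where an equivariant piece
  could occur.\<close>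

lemma strip_frozen:
  assumes "length l = length ys" "length bs = length ys" "v \<Longrightarrow> \<forall>x\<in>set l. x" "Ten \<notin> set bs"
  shows "strip x ys (map bit l) bs (bit v) (bit v) = of_bool (bs = map bit l)"
  using assms
proof (induction ys arbitrary: l bs)
  case (Cons y ys)
  then obtain a l' b bs' where l: "l = a # l'" and bs: "bs = b # bs'"
    by (auto simp: length_Suc_conv)
  have "vertex_weight (y - x) (bit a) q (bit v) b = of_bool (q = bit v \<and> b = bit a)" for q
    using Cons.prems(3,4) l bs by (cases a; cases v; cases q; cases b; simp add: vertex_weight_def)
  then have "strip x (y # ys) (map bit l) bs (bit v) (bit v) =
      (\<Sum>q\<in>UNIV. of_bool (q = bit v \<and> b = bit a) * strip x ys (map bit l') bs' q (bit v))"
    by (simp only: l bs list.map strip.simps)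
  also have "\<dots> = of_bool (b = bit a) * strip x ys (map bit l') bs' (bit v) (bit v)"
    by (cases v) (simp_all add: sum_lab)
  also have "strip x ys (map bit l') bs' (bit v) (bit v) = of_bool (bs' = map bit l')"
    using Cons.prems l bs by (intro Cons.IH) auto
  finally show ?case by (auto simp: l bs)
qed auto

lemma count_list_True_length:
  assumes "count_list l True = length l" shows "\<forall>x\<in>set l. x"
  using assms
proof (induction l)
  case (Cons a l)
  then show ?case using count_le_length[of l True] by (cases a) auto
qed simp

lemma no_Ten: "count_list bs Ten = 0 \<Longrightarrow> Ten \<notin> set bs"
  by (simp add: count_list_0_iff)

lemma bottom_weight_bit: "bottom_weight (bit v) (bit v) v = 1"
  by (cases v) (simp_all add: bottom_weight_def)

lemma bottom_weight_bit_nonzero: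
  assumes "bottom_weight (bit a) t v \<noteq> 0" "v \<Longrightarrow> a"
  shows "a = v \<and> t = bit v"
  using assms by (cases v; cases a; cases t) (simp_all add: bottom_weight_def)

text \<open>As NE and South sides agree, the first charge leaves no \<open>Ten\<close> on any
  column; all strips are frozen and copy the NW string to the South side. Once a South letter is
  one, sortedness makes all later ones too, and the content forces the same for \<open>l\<close>, as
  \<open>strip_frozen\<close> requires.\<close>

lemma string_sum_sorted_diag:
  assumes "sorted w" "length l = length w" "length ys = length w" "count_list l True = count_list w True"
  shows "string_sum ys l w w = of_bool (l = w)"
  using assms
proof (induction w arbitrary: l ys)
  case Nil
  then show ?case by (simp add: string_sum_def)
next
  case (Cons v w)
  then obtain a l' y ys' where l: "l = a # l'" and ys: "ys = y # ys'"
    by (auto simp: length_Suc_conv)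
  have len: "length l' = length w" "length ys' = length w"
    using Cons.prems(2,3) l ys by auto
  have "\<forall>x\<in>set w. x" if v
    using Cons.prems(1) that by auto
  then have w: "count_list w True = length w" if v
    using that by (induction w) auto
  have a: a if v
    using Cons.prems(4) w[OF that] len l count_le_length[of l' True] that by (cases a) auto
  have all: "\<forall>x\<in>set l'. x" if v
    using Cons.prems(4) w[OF that] len l a[OF that] that by (intro count_list_True_length) simp
  have frozen: "strip y ys' (map bit l') bs (bit v) (bit v) = (of_bool (bs = map bit l') :: 'a)"
    if "Ten \<notin> set bs" "length bs = length l'" for bs
    using that len all by (intro strip_frozen) auto
  have summand: "bottom_weight (bit a) t v * strip y ys' (map bit l') bs t (bit v) =
    (of_bool (a = v \<and> t = bit v \<and> bs = map bit l') :: 'a)" if "bs \<in> lab_lists (length l')" for bs t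
  proof (cases "bottom_weight (bit a) t v * strip y ys' (map bit l') bs t (bit v) = (0::'a)")
    case True
    have "strip y ys' (map bit l') (map bit l') (bit v) (bit v) = (1::'a)"
      using frozen[OF no_Ten] by simp
    then have "bottom_weight (bit v) (bit v) v * strip y ys' (map bit l') (map bit l') (bit v) (bit v) \<noteq> (0::'a)"
      by (simp add: bottom_weight_bit)
    with True have "\<not> (a = v \<and> t = bit v \<and> bs = map bit l')"
      by blast
    then show ?thesis using True by simp
  next
    case False
    then have nz: "bottom_weight (bit a) t v \<noteq> (0::'a)" "strip y ys' (map bit l') bs t (bit v) \<noteq> (0::'a)" by auto
    have "Ten \<notin> set bs"
      using strip_conserve(1)[OF nz(2)] bottom_weight_conserve(1)[OF nz(1)] by (intro no_Ten) simp
    then have "strip y ys' (map bit l') bs (bit v) (bit v) = (of_bool (bs = map bit l') :: 'a)"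
      using that by (intro frozen) (simp_all add: lab_lists_def)
    moreover have "a = v" "t = bit v"
      using bottom_weight_bit_nonzero[OF nz(1) a] by simp_all
    ultimately show ?thesis by (simp add: bottom_weight_bit)
  qed
  have "string_sum ys l (v # w) (v # w) = (\<Sum>bs\<in>lab_lists (length l'). \<Sum>t\<in>UNIV.
      bottom_weight (bit a) t v * strip y ys' (map bit l') bs t (bit v) * puzzle_sum ys' bs (map bit w) w)"
    by (simp add: string_sum_def l ys)
  also have "\<dots> = (\<Sum>bs\<in>lab_lists (length l'). \<Sum>t\<in>UNIV.
      of_bool (a = v \<and> t = bit v \<and> bs = map bit l') * puzzle_sum ys' bs (map bit w) w)"
    by (intro sum.cong refl) (simp only: summand)
  also have "\<dots> = (\<Sum>bs\<in>lab_lists (length l'). if bs = map bit l' then of_bool (a = v) * puzzle_sum ys' bs (map bit w) w else 0)"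
  proof (intro sum.cong refl)
    fix bs
    have "(\<Sum>t\<in>UNIV. of_bool (a = v \<and> t = bit v \<and> bs = map bit l') * puzzle_sum ys' bs (map bit w) w) =
      (\<Sum>t\<in>UNIV. if t = bit v then of_bool (a = v \<and> bs = map bit l') * puzzle_sum ys' bs (map bit w) w else 0)"
      by (intro sum.cong refl) simp
    then show "(\<Sum>t\<in>UNIV. of_bool (a = v \<and> t = bit v \<and> bs = map bit l') * puzzle_sum ys' bs (map bit w) w) =
      (if bs = map bit l' then of_bool (a = v) * puzzle_sum ys' bs (map bit w) w else 0)"
      by simp
  qed
  also have "\<dots> = of_bool (a = v) * string_sum ys' l' w w"
  proof -
    have "map bit l' \<in> lab_lists (length l')" by (simp add: lab_lists_def)
    then show ?thesis by (simp add: string_sum_def)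
  qed
  also have "\<dots> = of_bool (l = v # w)"
  proof (cases "a = v")
    case True
    then have "string_sum ys' l' w w = (of_bool (l' = w) :: 'a)"
    proof (intro Cons.IH)
      show "sorted w" using Cons.prems(1) by (simp only: sorted_wrt.simps)
      show "count_list l' True = count_list w True"
        using Cons.prems(4) unfolding l True by (simp split: if_splits)
    qed (rule len)+
    then show ?thesis using True l by simp
  qed (simp add: l)
  finally show ?case .
qed

lemma string_sum_sorted:
  assumes "sorted w" "w \<in> strings n k" "l \<in> strings n k" "m \<in> strings n k" "length ys = n"
  shows "string_sum ys l m w = of_bool (l = w \<and> m = w)"
proof (cases "m = w")
  case True
  have "string_sum ys l w w = of_bool (l = w)"
    using assms by (intro string_sum_sorted_diag) (simp_all add: strings_def)
  then show ?thesis using True by simp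
next
  case False
  have "\<not> prefix_dom w m"
    using False sorted_prefix_dom_eq[OF assms(1)] assms(2,4) by (auto simp: strings_def)
  then show ?thesis using False string_sum_prefix_dom by auto
qed

section \<open>Restrictions of Schubert classes\<close>

text \<open>The restriction of a class to a fixed point \<open>s\<close> is its structure constant with two equal indices.\<close>

definition restr :: "'a::comm_ring_1 list \<Rightarrow> bool list \<Rightarrow> bool list \<Rightarrow> 'a" where
  "restr ys l s = string_sum ys l s s"

lemma swap_at_eq_self: "Suc i < length s \<Longrightarrow> s ! i = s ! Suc i \<Longrightarrow> swap_at i s = s"
  by (rule nth_equalityI) (auto simp: nth_swap_at)

lemma not_prefix_dom_swap_at:
  assumes "Suc i < length s" "desc i s" shows "\<not> prefix_dom (swap_at i s) s"
proof
  assume "prefix_dom (swap_at i s) s"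
  then have "ones (Suc i) s \<le> ones (Suc i) (swap_at i s)" by (simp add: prefix_dom_def)
  then show False using ones_swap_at[OF assms, of "Suc i"] by simp
qed

lemma act_cong:
  "F xs = G xs \<Longrightarrow> F (swap_at i xs) = G (swap_at i xs) \<Longrightarrow> act u i F xs = act u i G xs"
  by (simp add: act_def)

lemma act_mult_left: "act u i (\<lambda>xs. c * F xs) xs = c * act u i F xs"
  by (simp add: act_def algebra_simps)

lemma act_mult_right: "act u i (\<lambda>xs. F xs * c) xs = act u i F xs * c"
  by (simp add: act_def algebra_simps)

lemma distinct_swap_at [simp]: "Suc i < length ys \<Longrightarrow> distinct (swap_at i ys) \<longleftrightarrow> distinct ys"
  by (metis mset_swap Suc_lessD swap_at_def mset_eq_imp_distinct_iff)

lemma set_swap_at [simp]: "Suc i < length ys \<Longrightarrow> set (swap_at i ys) = set ys"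
  by (metis mset_swap Suc_lessD swap_at_def mset_eq_setD)

text \<open>The exchange relation is used twice with south side \<open>t\<close>, the string with the descent removed, and
  \<open>m = t\<close>, respectively \<open>m = s\<close>. Terms with \<open>m = s\<close> and south side \<open>t\<close> vanish by triangularity; the
  remaining equations agree after cancelling the root.\<close>

lemma restr_swap_at_desc:
  fixes ys :: "'a::idom list"
  assumes "Suc i < length ys" "length l = length ys" "length s = length ys" "distinct ys" "desc i s"
  shows "restr ys l s = act (ys ! Suc i - ys ! i) i (\<lambda>l. restr (swap_at i ys) l (swap_at i s)) l"
proof -
  let ?u = "ys ! Suc i - ys ! i" and ?ys = "swap_at i ys"
  define t where "t = swap_at i s"
  have t: "length t = length ys" "asc i t" "swap_at i t = s" "\<not> desc i t"
    using assms by (auto simp: t_def nth_swap_at desc_def asc_def)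
  have u: "?u \<noteq> 0"
    using assms by (simp add: nth_eq_iff_index_eq)
  have nd: "\<not> prefix_dom t s"
    using not_prefix_dom_swap_at[of i s] assms by (simp add: t_def)
  then have 0: "string_sum zs l' s t = 0" for zs :: "'a list" and l'
    using string_sum_prefix_dom by blast
  have "string_sum ys l t t + ?u * string_sum ys l t s = act ?u i (\<lambda>l. string_sum ?ys l t t) l"
    using string_sum_exchange[of i ys l t t] assms t by (simp add: coact_def act_def)
  moreover have "string_sum ys l s t + ?u * string_sum ys l s s = act ?u i (\<lambda>l. string_sum ?ys l s t + ?u * string_sum ?ys l t t) l"
    using string_sum_exchange[of i ys l s t] assms t by (simp add: coact_def act_def[of _ _ _ s] t_def)
  ultimately have "?u * string_sum ys l s s = ?u * act ?u i (\<lambda>l. string_sum ?ys l t t) l"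
    by (simp add: 0 act_mult_left)
  then show ?thesis using u by (simp add: restr_def t_def)
qed

text \<open>For equal letters this is the exchange relation itself. At an ascent the relation for
  the swapped data is inverted: R with parameters \<open>u\<close> and \<open>- u\<close> are
  inverse to each other since N squares to zero.\<close>

lemma restr_swap_at:
  fixes ys :: "'a::idom list"
  assumes "Suc i < length ys" "length l = length ys" "length s = length ys" "distinct ys"
  shows "restr ys l s = act (ys ! Suc i - ys ! i) i (\<lambda>l. restr (swap_at i ys) l (swap_at i s)) l"
proof -
  consider "desc i s" | "s ! i = s ! Suc i" | "asc i s"
    by (auto simp: desc_def asc_def)
  then show ?thesis
  proof cases
    case 1
    then show ?thesis using restr_swap_at_desc assms by blast
  next
    case 2
    then have "\<not> asc i s" "\<not> desc i s" "swap_at i s = s"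
      using assms by (auto simp: asc_def desc_def swap_at_eq_self)
    then show ?thesis
      using string_sum_exchange[of i ys l s s] assms by (simp add: restr_def coact_def act_def)
  next
    case 3
    let ?ys = "swap_at i ys" and ?s = "swap_at i s"
    have *: "restr ?ys l' ?s = act (ys ! i - ys ! Suc i) i (\<lambda>l. restr ys l s) l'" if "length l' = length ys" for l'
      using restr_swap_at_desc[of i ?ys l' ?s] assms that 3 by (simp add: desc_swap_at nth_swap_at)
    show ?thesis
    proof (cases "desc i l")
      case True
      then have "\<not> desc i (swap_at i l)" using assms by (auto simp: nth_swap_at desc_def)
      then show ?thesis using *[of l] *[of "swap_at i l"] assms True by (simp add: act_def algebra_simps)
    next
      case False
      then show ?thesis using *[of l] assms by (simp add: act_def)
    qed
  qed
qed

lemma restr_sorted: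
  "sorted w \<Longrightarrow> w \<in> strings n k \<Longrightarrow> l \<in> strings n k \<Longrightarrow> length ys = n \<Longrightarrow> restr ys l w = of_bool (l = w)"
  by (simp add: restr_def string_sum_sorted[of w n k])

lemma finite_strings [simp]: "finite (strings n k)"
  using finite_lists_length_eq[of "UNIV::bool set" n]
  by (rule finite_subset[rotated]) (auto simp: strings_def)

theorem restr_product:
  fixes ys :: "'a::idom list"
  assumes "length ys = n" "distinct ys" "l \<in> strings n k" "m \<in> strings n k" "s \<in> strings n k"
  shows "(\<Sum>v\<in>strings n k. string_sum ys l m v * restr ys v s) = restr ys l s * restr ys m s"
  using assms
proof (induction s arbitrary: ys l m rule: desc_induct)
  case (sorted s)
  have "(\<Sum>v\<in>strings n k. string_sum ys l m v * restr ys v s) = (\<Sum>v\<in>strings n k. if v = s then string_sum ys l m v else 0)"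
    using sorted by (intro sum.cong refl) (simp add: restr_sorted[of s n k])
  also have "\<dots> = string_sum ys l m s" using sorted by simp
  also have "\<dots> = restr ys l s * restr ys m s"
    using sorted by (simp add: restr_sorted[of s n k] string_sum_sorted[of s n k] of_bool_conj)
  finally show ?case .
next
  case (swap_at s i)
  let ?S = "strings n k" and ?u = "ys ! Suc i - ys ! i" and ?ys = "swap_at i ys" and ?s = "swap_at i s"
  have n: "length s = n" "Suc i < n" "length ys = n" and len: "length v = n" if "v \<in> ?S" for v
    using swap_at.prems swap_at.hyps that by (auto simp: strings_def)
  note n = n[OF swap_at.prems(5)]
  have IH: "(\<Sum>v\<in>?S. string_sum ?ys l' m' v * restr ?ys v ?s) = restr ?ys l' ?s * restr ?ys m' ?s"
    if "l' \<in> ?S" "m' \<in> ?S" for l' m'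
    using swap_at.prems n that by (intro swap_at.IH) simp_all
  have step: "restr ys v s = act ?u i (\<lambda>v. restr ?ys v ?s) v" if "v \<in> ?S" for v
    using n len[OF that] swap_at.prems by (intro restr_swap_at) simp_all
  have "(\<Sum>v\<in>?S. string_sum ys l m v * restr ys v s) = (\<Sum>v\<in>?S. string_sum ys l m v * act ?u i (\<lambda>v. restr ?ys v ?s) v)"
    by (intro sum.cong refl) (simp only: step)
  \<comment> \<open>Transposing moves R from the index of the class to the South side of the
    puzzles. There the exchange relation splits it over \<open>l\<close> and \<open>m\<close>, and
    each copy turns one factor at \<open>?s\<close> back into a restriction at
    \<open>s\<close>.\<close>
  also have "\<dots> = (\<Sum>v\<in>?S. coact ?u i (string_sum ys l m) v * restr ?ys v ?s)"
    using n len by (intro adjoint) simp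
  also have "\<dots> = (\<Sum>v\<in>?S. act ?u i (\<lambda>l. act ?u i (\<lambda>m. string_sum ?ys l m v) m) l * restr ?ys v ?s)"
    using n len swap_at.prems by (intro sum.cong refl) (simp add: string_sum_exchange)
  also have "\<dots> = act ?u i (\<lambda>l. act ?u i (\<lambda>m. \<Sum>v\<in>?S. string_sum ?ys l m v * restr ?ys v ?s) m) l"
    unfolding act_sum_right ..
  also have "\<dots> = act ?u i (\<lambda>l. act ?u i (\<lambda>m. restr ?ys l ?s * restr ?ys m ?s) m) l"
    using swap_at.prems n by (intro act_cong) (simp_all add: IH)
  also have "\<dots> = restr ys l s * restr ys m s"
    using swap_at.prems by (simp add: act_mult_left act_mult_right step)
  finally show ?case .
qed

lemma act_nonzeroE:
  assumes "act u i F xs \<noteq> 0"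
  obtains "F xs \<noteq> 0" | "desc i xs" "F (swap_at i xs) \<noteq> 0"
  using assms by (cases "F xs = 0"; cases "F (swap_at i xs) = 0") (auto simp: act_def split: if_splits)

lemma restr_prefix_dom:
  fixes ys :: "'a::idom list"
  assumes "restr ys l s \<noteq> 0" "distinct ys"
  shows "prefix_dom s l"
  using assms
proof (induction s arbitrary: ys l rule: desc_induct)
  case (sorted s)
  have "length l = length ys" "length s = length ys" "count_list l True = count_list s True"
    using string_sum_content string_sum_length sorted.prems(1) unfolding restr_def by blast+
  then have "restr ys l s = of_bool (l = s)"
    using sorted.hyps by (intro restr_sorted[of s "length ys" "count_list s True"]) (simp_all add: strings_def)
  then show ?case using sorted by (simp add: prefix_dom_refl split: if_splits)
next
  case (swap_at s i)
  have len: "length l = length ys" "length s = length ys"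
    using string_sum_length swap_at.prems(1) unfolding restr_def by blast+
  have d: "distinct (swap_at i ys)" and i: "Suc i < length l"
    using swap_at.prems swap_at.hyps len by simp_all
  have "act (ys ! Suc i - ys ! i) i (\<lambda>l. restr (swap_at i ys) l (swap_at i s)) l \<noteq> 0"
    using restr_swap_at[of i ys l s] len swap_at.prems swap_at.hyps by simp
  then show ?case
  proof (cases rule: act_nonzeroE)
    case 1
    then show ?thesis using swap_at.IH[OF _ d] prefix_dom_trans[OF prefix_dom_swap_at[OF swap_at.hyps]] by blast
  next
    case 2
    then have "prefix_dom (swap_at i s) (swap_at i l)" using swap_at.IH[OF _ d] by blast
    \<comment> \<open>Both strings regain a descent at \<open>i\<close>, which raises both prefix
      counts by one at the same length \<open>i + 1\<close>.\<close>
    then show ?thesis unfolding prefix_dom_def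
      using ones_swap_at[OF swap_at.hyps] ones_swap_at[OF i 2(1)] by simp
  qed
qed

text \<open>The permutation of places belonging to \<open>swap_at i\<close>: list positions start at
  0, places at 1.\<close>

definition transp_at :: "nat \<Rightarrow> nat \<Rightarrow> nat" where
  "transp_at i a = (if a = Suc i then Suc (Suc i) else if a = Suc (Suc i) then Suc i else a)"

lemma transp_at_transp_at [simp]: "transp_at i (transp_at i a) = a"
  by (simp add: transp_at_def)

text \<open>An adjacent transposition reverses the order of a single pair of places.\<close>

lemma inversions_swap_at:
  assumes "Suc i < length s" "desc i s"
  shows "bij_betw (map_prod (transp_at i) (transp_at i)) (inversions (swap_at i s)) (inversions s - {(Suc i, Suc (Suc i))})"
proof (rule bij_betw_byWitness[where f' = "map_prod (transp_at i) (transp_at i)"])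
  have s: "s ! i" "\<not> s ! Suc i" using assms(2) by (simp_all add: desc_bool)
  have place: "place (swap_at i s) (transp_at i a) = place s a" if "1 \<le> a" "a \<le> length s" for a
    using that assms(1) by (auto simp: place_def transp_at_def nth_swap_at)
  have place': "place s (transp_at i a) = place (swap_at i s) a" if "1 \<le> a" "a \<le> length s" for a
    using place[of "transp_at i a"] that assms(1) by (auto simp: transp_at_def split: if_splits)
  have bd: "1 \<le> transp_at i a \<and> transp_at i a \<le> length s" if "1 \<le> a" "a \<le> length s" for a
    using that assms(1) by (auto simp: transp_at_def)
  have mono: "transp_at i a < transp_at i b" if "a < b" "(a, b) \<noteq> (Suc i, Suc (Suc i))" for a b
    using that by (auto simp: transp_at_def)
  show "map_prod (transp_at i) (transp_at i) ` inversions (swap_at i s) \<subseteq> inversions s - {(Suc i, Suc (Suc i))}"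
  proof (rule image_subsetI)
    fix x assume "x \<in> inversions (swap_at i s)"
    then obtain a b where x: "x = (a, b)" and ab: "(a, b) \<in> inversions (swap_at i s)"
      by (cases x) auto
    then have *: "1 \<le> a" "a < b" "b \<le> length s" "place (swap_at i s) a" "\<not> place (swap_at i s) b"
      by (auto simp: inversions_def)
    have ne: "(a, b) \<noteq> (Suc i, Suc (Suc i))"
      using *(4) s assms(1) by (auto simp: place_def nth_swap_at)
    have "map_prod (transp_at i) (transp_at i) (a, b) \<in> inversions s"
      using * bd[of a] bd[of b] mono[OF _ ne] place'[of a] place'[of b] by (auto simp: inversions_def)
    moreover have "map_prod (transp_at i) (transp_at i) (a, b) \<noteq> (Suc i, Suc (Suc i))"
      using *(2) by (auto simp: transp_at_def split: if_splits)
    ultimately show "map_prod (transp_at i) (transp_at i) x \<in> inversions s - {(Suc i, Suc (Suc i))}"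
      unfolding x by simp
  qed
  show "map_prod (transp_at i) (transp_at i) ` (inversions s - {(Suc i, Suc (Suc i))}) \<subseteq> inversions (swap_at i s)"
  proof (rule image_subsetI)
    fix x assume "x \<in> inversions s - {(Suc i, Suc (Suc i))}"
    then obtain a b where x: "x = (a, b)" and ab: "(a, b) \<in> inversions s"
      and ne: "(a, b) \<noteq> (Suc i, Suc (Suc i))"
      by (cases x) auto
    then have *: "1 \<le> a" "a < b" "b \<le> length s" "place s a" "\<not> place s b"
      by (auto simp: inversions_def)
    show "map_prod (transp_at i) (transp_at i) x \<in> inversions (swap_at i s)"
      unfolding x using * bd[of a] bd[of b] mono[OF _ ne] place[of a] place[of b] by (auto simp: inversions_def)
  qed
qed auto

lemma finite_inversions [simp]: "finite (inversions s)"
  by (rule finite_subset[of _ "{..length s} \<times> {..length s}"]) (auto simp: inversions_def)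

lemma inversion_desc: "Suc i < length s \<Longrightarrow> desc i s \<Longrightarrow> (Suc i, Suc (Suc i)) \<in> inversions s"
  by (simp add: inversions_def place_def desc_bool)

lemma card_inversions_swap_at:
  assumes "Suc i < length s" "desc i s"
  shows "card (inversions s) = Suc (card (inversions (swap_at i s)))"
  using bij_betw_same_card[OF inversions_swap_at[OF assms]]
    card_Suc_Diff1[OF finite_inversions inversion_desc[OF assms]] by simp

lemma prod_inversions_swap_at:
  fixes f :: "nat \<Rightarrow> nat \<Rightarrow> 'a::comm_ring_1"
  assumes "Suc i < length s" "desc i s"
  shows "(\<Prod>(a, b)\<in>inversions s. f a b) =
    f (Suc i) (Suc (Suc i)) * (\<Prod>(a, b)\<in>inversions (swap_at i s). f (transp_at i a) (transp_at i b))"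
proof -
  have "(\<Prod>(a, b)\<in>inversions s. f a b) = f (Suc i) (Suc (Suc i)) *
      (\<Prod>(a, b)\<in>inversions s - {(Suc i, Suc (Suc i))}. f a b)"
    using inversion_desc[OF assms] by (subst prod.remove) auto
  also have "(\<Prod>(a, b)\<in>inversions s - {(Suc i, Suc (Suc i))}. f a b) =
      (\<Prod>(a, b)\<in>inversions (swap_at i s). f (transp_at i a) (transp_at i b))"
    by (subst prod.reindex_bij_betw[OF inversions_swap_at[OF assms], symmetric])
      (simp add: case_prod_beta)
  finally show ?thesis .
qed

lemma inversions_sorted: "sorted s \<Longrightarrow> inversions s = {}"
proof -
  assume "sorted s"
  have False if ab: "(a, b) \<in> inversions s" for a b
  proof -
    have "a - 1 \<le> b - 1" "b - 1 < length s" "s ! (a - 1)" "\<not> s ! (b - 1)"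
      using ab by (auto simp: inversions_def place_def)
    then show False using sorted_nth_mono[OF \<open>sorted s\<close>, of "a - 1" "b - 1"] by simp
  qed
  then show ?thesis by auto
qed

text \<open>In the recursion the first term vanishes, as \<open>swap_at i s\<close> does not
  dominate \<open>s\<close>; the second supplies the root of the removed inversion.\<close>

lemma restr_diag:
  fixes ys :: "'a::idom list"
  assumes "length s = length ys" "distinct ys"
  shows "restr ys s s = (\<Prod>(a, b)\<in>inversions s. ys ! (b - 1) - ys ! (a - 1))"
  using assms
proof (induction s arbitrary: ys rule: desc_induct)
  case (sorted s)
  have "restr ys s s = of_bool (s = s)"
    using sorted by (intro restr_sorted[of s "length ys" "count_list s True"]) (simp_all add: strings_def)
  then show ?case using sorted by (simp add: inversions_sorted)
next
  case (swap_at s i)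
  let ?ys = "swap_at i ys" and ?u = "ys ! Suc i - ys ! i"
  have i: "Suc i < length ys" using swap_at by simp
  have "restr ?ys s (swap_at i s) = 0"
    using restr_prefix_dom[of ?ys s "swap_at i s"] not_prefix_dom_swap_at[OF swap_at.hyps] swap_at.prems i by auto
  then have "restr ys s s = ?u * restr ?ys (swap_at i s) (swap_at i s)"
    using restr_swap_at[of i ys s s] swap_at.prems swap_at.hyps i by (simp add: act_def)
  also have "restr ?ys (swap_at i s) (swap_at i s) = (\<Prod>(a, b)\<in>inversions (swap_at i s). ?ys ! (b - 1) - ?ys ! (a - 1))"
    using swap_at.prems i by (intro swap_at.IH) simp_all
  also have "\<dots> = (\<Prod>(a, b)\<in>inversions (swap_at i s). ys ! (transp_at i b - 1) - ys ! (transp_at i a - 1))"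
  proof (intro prod.cong refl, clarify)
    fix a b assume "(a, b) \<in> inversions (swap_at i s)"
    then have "1 \<le> a" "a \<le> length ys" "1 \<le> b" "b \<le> length ys"
      using swap_at.prems by (auto simp: inversions_def)
    moreover have "?ys ! (c - 1) = ys ! (transp_at i c - 1)" if "1 \<le> c" "c \<le> length ys" for c
      using that i by (auto simp: nth_swap_at transp_at_def)
    ultimately show "?ys ! (b - 1) - ?ys ! (a - 1) = ys ! (transp_at i b - 1) - ys ! (transp_at i a - 1)"
      by simp
  qed
  also have "?u * \<dots> = (\<Prod>(a, b)\<in>inversions s. ys ! (b - 1) - ys ! (a - 1))"
    using prod_inversions_swap_at[OF swap_at.hyps, of "\<lambda>a b. ys ! (b - 1) - ys ! (a - 1)"] by simp
  finally show ?case .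
qed

section \<open>Congruences modulo a root and the GKM conditions\<close>

lemma dvd_diff_mult:
  fixes a b c d :: "'a::comm_ring_1"
  assumes "e dvd a - b" "e dvd c - d"
  shows "e dvd a * c - b * d"
proof -
  have "a * c - b * d = (a - b) * c + b * (c - d)" by (simp add: algebra_simps)
  then show ?thesis using assms by simp
qed

lemma dvd_diff_sum:
  fixes f g :: "'b \<Rightarrow> 'a::comm_ring_1"
  assumes "\<And>x. x \<in> A \<Longrightarrow> e dvd f x - g x"
  shows "e dvd sum f A - sum g A"
  using assms by (simp add: dvd_sum flip: sum_subtractf)

lemma strip_cong:
  assumes "list_all2 (\<lambda>a b. e dvd a - b) ys zs" "e dvd x - x'"
  shows "e dvd strip x ys as bs t s - strip x' zs as bs t s"
  using assms(1)
proof (induction ys zs arbitrary: as bs t rule: list_all2_induct)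
  case Nil
  then show ?case by (cases as; cases bs; simp)
next
  case (Cons y ys z zs)
  have "e dvd (y - x) - (z - x')"
    using dvd_diff[OF Cons(1) assms(2)] by (simp add: algebra_simps)
  then have "e dvd vertex_weight (y - x) a q t b - vertex_weight (z - x') a q t b" for a q b
    by (cases a; cases q; cases t; cases b; simp add: vertex_weight_def)
  then show ?case
    using Cons by (cases as; cases bs) (auto intro!: dvd_diff_sum dvd_diff_mult)
qed

lemma puzzle_sum_cong:
  assumes "list_all2 (\<lambda>a b. e dvd a - b) ys zs"
  shows "e dvd puzzle_sum ys as ms vs - puzzle_sum zs as ms vs"
  using assms
proof (induction ys zs arbitrary: as ms vs rule: list_all2_induct)
  case Nil
  then show ?case by (cases as; cases ms; cases vs; simp)
next
  case (Cons y ys z zs)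
  then show ?case
    by (cases as; cases ms; cases vs) (auto intro!: dvd_diff_sum dvd_diff_mult strip_cong)
qed

text \<open>At adjacent places the recursion shows that swapping \<open>ys\<close> and
  \<open>s\<close> together changes the restriction by a multiple of the root; swapping
  \<open>ys\<close> back does the same, because the two entries are congruent modulo the root.
  Otherwise conjugation by \<open>swap_at i\<close> brings \<open>q\<close> one place closer to
  \<open>p\<close> and carries the root along.\<close>

lemma restr_gkm:
  fixes ys :: "'a::idom list"
  assumes "p < q" "q < length ys" "length s = length ys" "length l = length ys" "distinct ys"
  shows "ys ! q - ys ! p dvd restr ys l s - restr ys l (s[p := s ! q, q := s ! p])"
  using assms
proof (induction q arbitrary: ys s l)
  case (Suc i)
  show ?case
  proof (cases "i = p")
    case True
    let ?u = "ys ! Suc p - ys ! p"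
    have i: "Suc p < length ys" using Suc.prems True by simp
    have "?u dvd ys ! p - ys ! Suc p"
      by (metis dvd_minus_iff dvd_refl minus_diff_eq)
    then have "list_all2 (\<lambda>a b. ?u dvd a - b) (swap_at p ys) ys"
      using i by (auto simp: list_all2_conv_all_nth nth_swap_at)
    then have "?u dvd restr (swap_at p ys) l (swap_at p s) - restr ys l (swap_at p s)"
      unfolding restr_def string_sum_def by (rule puzzle_sum_cong)
    moreover have "restr ys l s = act ?u p (\<lambda>l. restr (swap_at p ys) l (swap_at p s)) l"
      using Suc.prems i by (intro restr_swap_at) simp_all
    then have "?u dvd restr ys l s - restr (swap_at p ys) l (swap_at p s)"
      by (simp add: act_def)
    ultimately have "?u dvd restr ys l s - restr ys l (swap_at p s)"
      using dvd_add by fastforce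
    then show ?thesis using True by (simp add: swap_at_def)
  next
    case False
    then have pi: "p < i" using Suc.prems by simp
    let ?s = "s[p := s ! Suc i, Suc i := s ! p]" and ?u = "ys ! Suc i - ys ! i" and ?ys = "swap_at i ys"
    have sw: "swap_at i ?s = (swap_at i s)[p := swap_at i s ! i, i := swap_at i s ! p]"
      using Suc.prems pi by (intro nth_equalityI) (auto simp: nth_swap_at nth_list_update)
    have d: "ys ! Suc i - ys ! p = ?ys ! i - ?ys ! p"
      using Suc.prems pi by (simp add: nth_swap_at)
    have IH: "?ys ! i - ?ys ! p dvd restr ?ys l' (swap_at i s) - restr ?ys l' (swap_at i ?s)" if "length l' = length ys" for l'
      unfolding sw using Suc.prems pi that by (intro Suc.IH) simp_all
    have "restr ys l s - restr ys l ?s =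
        act ?u i (\<lambda>l. restr ?ys l (swap_at i s)) l - act ?u i (\<lambda>l. restr ?ys l (swap_at i ?s)) l"
      using Suc.prems by (simp add: restr_swap_at[of i ys])
    also have "\<dots> = act ?u i (\<lambda>l. restr ?ys l (swap_at i s) - restr ?ys l (swap_at i ?s)) l"
      by (simp add: act_def algebra_simps)
    finally show ?thesis
      unfolding d using IH[of l] IH[of "swap_at i l"] Suc.prems by (simp add: act_def)
  qed
qed simp

section \<open>Substitution in integer polynomials\<close>

abbreviation monomial :: "(nat \<Rightarrow> ypoly) \<Rightarrow> (nat \<Rightarrow>\<^sub>0 nat) \<Rightarrow> ypoly" where
  "monomial f m \<equiv> \<Prod>i\<in>Poly_Mapping.keys m. f i ^ Poly_Mapping.lookup m i"

lemma monomial_superset: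
  assumes "finite S" "Poly_Mapping.keys m \<subseteq> S"
  shows "monomial f m = (\<Prod>i\<in>S. f i ^ Poly_Mapping.lookup m i)"
  using assms by (intro prod.mono_neutral_left) (auto simp: in_keys_iff)

lemma monomial_add: "monomial f (m + m') = monomial f m * monomial f m'"
proof -
  let ?S = "Poly_Mapping.keys m \<union> Poly_Mapping.keys m'"
  have "monomial f (m + m') = (\<Prod>i\<in>?S. f i ^ Poly_Mapping.lookup (m + m') i)"
    by (intro monomial_superset) (auto dest: subsetD[OF keys_add])
  also have "\<dots> = (\<Prod>i\<in>?S. f i ^ Poly_Mapping.lookup m i) * (\<Prod>i\<in>?S. f i ^ Poly_Mapping.lookup m' i)"
    by (simp add: lookup_add power_add prod.distrib)
  also have "\<dots> = monomial f m * monomial f m'"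
    by (simp add: monomial_superset[of ?S])
  finally show ?thesis .
qed

lemma subst_poly_superset:
  assumes "finite S" "Poly_Mapping.keys q \<subseteq> S"
  shows "subst_poly f q = (\<Sum>m\<in>S. of_int (Poly_Mapping.lookup q m) * monomial f m)"
  unfolding subst_poly_def using assms by (intro sum.mono_neutral_left) (auto simp: in_keys_iff)

lemma subst_poly_add: "subst_poly f (p + q) = subst_poly f p + subst_poly f q"
proof -
  let ?S = "Poly_Mapping.keys p \<union> Poly_Mapping.keys q"
  have "subst_poly f (p + q) = (\<Sum>m\<in>?S. of_int (Poly_Mapping.lookup (p + q) m) * monomial f m)"
    by (intro subst_poly_superset) (auto dest: subsetD[OF keys_add])
  also have "\<dots> = (\<Sum>m\<in>?S. of_int (Poly_Mapping.lookup p m) * monomial f m) +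
      (\<Sum>m\<in>?S. of_int (Poly_Mapping.lookup q m) * monomial f m)"
    by (simp add: lookup_add distrib_right sum.distrib)
  also have "\<dots> = subst_poly f p + subst_poly f q"
    by (simp add: subst_poly_superset[of ?S])
  finally show ?thesis .
qed

lemma subst_poly_0 [simp]: "subst_poly f 0 = 0"
  by (simp add: subst_poly_def)

lemma subst_poly_uminus: "subst_poly f (- p) = - subst_poly f p"
  using subst_poly_add[of f p "- p"] by (simp add: eq_neg_iff_add_eq_0 add.commute)

lemma subst_poly_diff: "subst_poly f (p - q) = subst_poly f p - subst_poly f q"
  using subst_poly_add[of f p "- q"] by (simp add: subst_poly_uminus)

lemma subst_poly_sum: "subst_poly f (\<Sum>x\<in>A. g x) = (\<Sum>x\<in>A. subst_poly f (g x))"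
  by (induction A rule: infinite_finite_induct) (simp_all add: subst_poly_add)

lemma subst_poly_single: "subst_poly f (Poly_Mapping.single m c) = of_int c * monomial f m"
  by (simp add: subst_poly_def)

lemma sum_singles: "(\<Sum>m\<in>Poly_Mapping.keys p. Poly_Mapping.single m (Poly_Mapping.lookup p m)) = p"
  by (intro poly_mapping_eqI)
    (auto simp: lookup_sum lookup_single when_def in_keys_iff sum.delta' cong: if_cong)

text \<open>Substitution is a ring homomorphism. By bilinearity it suffices to treat single
  terms.\<close>

lemma subst_poly_mult: "subst_poly f (p * q) = subst_poly f p * subst_poly f q"
proof -
  let ?s = "\<lambda>p m. Poly_Mapping.single m (Poly_Mapping.lookup p m) :: ypoly"
  have "subst_poly f (p * q) = subst_poly f ((\<Sum>m\<in>Poly_Mapping.keys p. ?s p m) * (\<Sum>m\<in>Poly_Mapping.keys q. ?s q m))"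
    by (simp only: sum_singles)
  also have "\<dots> = (\<Sum>m\<in>Poly_Mapping.keys p. \<Sum>m'\<in>Poly_Mapping.keys q. subst_poly f (?s p m * ?s q m'))"
    by (simp add: sum_product subst_poly_sum)
  also have "\<dots> = (\<Sum>m\<in>Poly_Mapping.keys p. \<Sum>m'\<in>Poly_Mapping.keys q. subst_poly f (?s p m) * subst_poly f (?s q m'))"
    by (simp add: mult_single subst_poly_single monomial_add mult_ac)
  also have "\<dots> = subst_poly f p * subst_poly f q"
    by (simp add: subst_poly_single subst_poly_def[of f p] subst_poly_def[of f q] sum_product)
  finally show ?thesis .
qed

lemma subst_poly_1 [simp]: "subst_poly f 1 = 1"
  using subst_poly_single[of f 0 1] by simp

lemma subst_poly_prod: "subst_poly f (\<Prod>x\<in>A. g x) = (\<Prod>x\<in>A. subst_poly f (g x))"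
  by (induction A rule: infinite_finite_induct) (simp_all add: subst_poly_mult)

lemma subst_poly_yvar [simp]: "subst_poly f (yvar i) = f i"
  by (simp add: yvar_def subst_poly_single)

lemma yvar_power: "yvar i ^ n = Poly_Mapping.single (Poly_Mapping.single i n) 1"
  by (induction n) (simp_all add: yvar_def mult_single flip: single_add)

lemma prod_single_1: "(\<Prod>x\<in>A. Poly_Mapping.single (g x) (1::int)) = Poly_Mapping.single (\<Sum>x\<in>A. g x) 1"
  by (induction A rule: infinite_finite_induct) (simp_all add: mult_single)

lemma monomial_yvar: "monomial yvar m = Poly_Mapping.single m 1"
proof -
  have "(\<Sum>i\<in>Poly_Mapping.keys m. Poly_Mapping.single i (Poly_Mapping.lookup m i)) = m"
    by (intro poly_mapping_eqI)
      (auto simp: lookup_sum lookup_single when_def in_keys_iff sum.delta' cong: if_cong)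
  then show ?thesis by (simp add: yvar_power prod_single_1)
qed

lemma of_int_mult_single: "of_int c * Poly_Mapping.single m (1::int) = Poly_Mapping.single m c"
proof -
  have "of_int c * Poly_Mapping.single m (1::int) = Poly_Mapping.single 0 (of_int c) * Poly_Mapping.single m 1"
    by (simp only: single_of_int)
  then show ?thesis by (simp add: mult_single)
qed

lemma subst_poly_id: "subst_poly yvar p = p"
  unfolding subst_poly_def monomial_yvar of_int_mult_single by (rule sum_singles)

lemma dvd_diff_prod:
  fixes f g :: "'b \<Rightarrow> 'a::comm_ring_1"
  assumes "\<And>x. x \<in> A \<Longrightarrow> e dvd f x - g x"
  shows "e dvd prod f A - prod g A"
  using assms by (induction A rule: infinite_finite_induct) (simp_all add: dvd_diff_mult)

lemma dvd_diff_power: "e dvd a - b \<Longrightarrow> e dvd a ^ n - (b::'a::comm_ring_1) ^ n"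
  by (induction n) (simp_all add: dvd_diff_mult)

lemma subst_poly_cong:
  assumes "\<And>i. e dvd f i - g i"
  shows "e dvd subst_poly f p - subst_poly g p"
  unfolding subst_poly_def
  by (intro dvd_diff_sum dvd_diff_mult dvd_diff_prod dvd_diff_power assms) simp

lemma HT_pt_0 [simp]: "0 \<in> HT_pt n" and HT_pt_1 [simp]: "1 \<in> HT_pt n"
  by (simp_all add: HT_pt_def)

lemma HT_pt_add: "p \<in> HT_pt n \<Longrightarrow> q \<in> HT_pt n \<Longrightarrow> p + q \<in> HT_pt n"
  unfolding HT_pt_def using keys_add[of p q] by auto

lemma HT_pt_uminus: "p \<in> HT_pt n \<Longrightarrow> - p \<in> HT_pt n"
  by (simp add: HT_pt_def)

lemma HT_pt_diff: "p \<in> HT_pt n \<Longrightarrow> q \<in> HT_pt n \<Longrightarrow> p - q \<in> HT_pt n"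
  using HT_pt_add[of p n "- q"] HT_pt_uminus[of q n] by simp

lemma HT_pt_mult: "p \<in> HT_pt n \<Longrightarrow> q \<in> HT_pt n \<Longrightarrow> p * q \<in> HT_pt n"
proof -
  assume "p \<in> HT_pt n" "q \<in> HT_pt n"
  then have "Poly_Mapping.keys (a + b) \<subseteq> {1..n}" if "a \<in> Poly_Mapping.keys p" "b \<in> Poly_Mapping.keys q" for a b
    using that subset_trans[OF keys_add[of a b]] unfolding HT_pt_def by simp
  then show ?thesis
    unfolding HT_pt_def using keys_mult[of p q] by blast
qed

lemma HT_pt_sum: "(\<And>x. x \<in> A \<Longrightarrow> f x \<in> HT_pt n) \<Longrightarrow> sum f A \<in> HT_pt n"
  by (induction A rule: infinite_finite_induct) (simp_all add: HT_pt_add)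

lemma HT_pt_prod: "(\<And>x. x \<in> A \<Longrightarrow> f x \<in> HT_pt n) \<Longrightarrow> prod f A \<in> HT_pt n"
  by (induction A rule: infinite_finite_induct) (simp_all add: HT_pt_mult)

lemma HT_pt_power: "p \<in> HT_pt n \<Longrightarrow> p ^ e \<in> HT_pt n"
  by (induction e) (simp_all add: HT_pt_mult)

lemma HT_pt_yvar: "i \<in> {1..n} \<Longrightarrow> yvar i \<in> HT_pt n"
  by (simp add: HT_pt_def yvar_def)

lemma HT_pt_of_int: "of_int c \<in> HT_pt n"
  unfolding HT_pt_def by (simp flip: single_of_int)

lemma HT_pt_subst_poly: "(\<And>i. f i \<in> HT_pt n) \<Longrightarrow> subst_poly f p \<in> HT_pt n"
  unfolding subst_poly_def by (intro HT_pt_sum HT_pt_mult HT_pt_prod HT_pt_power HT_pt_of_int)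

lemma subst_poly_retract:
  assumes "p \<in> HT_pt n"
  shows "subst_poly (\<lambda>i. if i \<in> {1..n} then yvar i else 0) p = p"
proof -
  have "i \<in> {1..n}" if "m \<in> Poly_Mapping.keys p" "i \<in> Poly_Mapping.keys m" for m i
    using that assms unfolding HT_pt_def by blast
  then have "subst_poly (\<lambda>i. if i \<in> {1..n} then yvar i else 0) p = subst_poly yvar p"
    unfolding subst_poly_def
    by (intro sum.cong refl arg_cong2[where f = times] prod.cong) (simp only: if_True)
  then show ?thesis by (simp add: subst_poly_id)
qed

text \<open>Setting the variables outside \<open>{1..n}\<close> to zero makes a quotient lie in the smaller ring.\<close>

lemma HT_pt_dvd:
  assumes "p \<in> HT_pt n" "d \<in> HT_pt n" "d dvd p"
  obtains q where "q \<in> HT_pt n" "p = q * d"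
proof -
  let ?r = "subst_poly (\<lambda>i. if i \<in> {1..n} then yvar i else 0)"
  obtain q where "p = d * q" using assms(3) by (rule dvdE)
  then have "?r p = ?r d * ?r q" by (simp only: subst_poly_mult)
  then have "p = ?r q * d"
    using subst_poly_retract[OF assms(1)] subst_poly_retract[OF assms(2)] by (simp only: mult.commute)
  moreover have "?r q \<in> HT_pt n" by (intro HT_pt_subst_poly) (simp add: HT_pt_yvar)
  ultimately show thesis using that by blast
qed

lemma yvar_inject [simp]: "yvar i = yvar j \<longleftrightarrow> i = j"
proof
  assume "yvar i = yvar j"
  then have "Poly_Mapping.keys (yvar i) = Poly_Mapping.keys (yvar j)" by simp
  then have "Poly_Mapping.single i (1::nat) = Poly_Mapping.single j 1" by (simp add: yvar_def)
  then have "Poly_Mapping.keys (Poly_Mapping.single i (1::nat)) = Poly_Mapping.keys (Poly_Mapping.single j (1::nat))" by simp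
  then show "i = j" by simp
qed simp

section \<open>Degrees and divisibility by products of roots\<close>

definition monomial_degree :: "(nat \<Rightarrow>\<^sub>0 nat) \<Rightarrow> nat" where
  "monomial_degree m = (\<Sum>i\<in>Poly_Mapping.keys m. Poly_Mapping.lookup m i)"

lemma monomial_degree_add: "monomial_degree (a + b) = monomial_degree a + monomial_degree b"
proof -
  let ?S = "Poly_Mapping.keys a \<union> Poly_Mapping.keys b"
  have *: "monomial_degree m = (\<Sum>i\<in>?S. Poly_Mapping.lookup m i)" if "Poly_Mapping.keys m \<subseteq> ?S" for m
    unfolding monomial_degree_def using that by (intro sum.mono_neutral_left) (auto simp: in_keys_iff)
  show ?thesis using keys_add[of a b] by (simp add: * lookup_add sum.distrib)
qed

lemma homogeneous_monomial_degree: "homogeneous d p \<longleftrightarrow> (\<forall>m\<in>Poly_Mapping.keys p. monomial_degree m = d)"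
  by (simp add: homogeneous_def monomial_degree_def)

lemma homogeneous_add: "homogeneous d p \<Longrightarrow> homogeneous d q \<Longrightarrow> homogeneous d (p + q)"
  unfolding homogeneous_def using keys_add[of p q] by blast

lemma homogeneous_uminus: "homogeneous d p \<Longrightarrow> homogeneous d (- p)"
  by (simp add: homogeneous_def)

lemma homogeneous_diff: "homogeneous d p \<Longrightarrow> homogeneous d q \<Longrightarrow> homogeneous d (p - q)"
  using homogeneous_add[of d p "- q"] homogeneous_uminus[of d q] by simp

lemma homogeneous_mult: "homogeneous d p \<Longrightarrow> homogeneous e q \<Longrightarrow> homogeneous (d + e) (p * q)"
  unfolding homogeneous_monomial_degree using keys_mult[of p q] by (force simp: monomial_degree_add)

lemma homogeneous_0 [simp]: "homogeneous d 0" and homogeneous_1 [simp]: "homogeneous 0 1"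
  by (simp_all add: homogeneous_def)

lemma homogeneous_yvar [simp]: "homogeneous (Suc 0) (yvar i)"
  by (simp add: homogeneous_def yvar_def)

lemma homogeneous_prod: "(\<And>x. x \<in> A \<Longrightarrow> homogeneous 1 (f x)) \<Longrightarrow> homogeneous (card A) (prod f A)"
proof (induction A rule: infinite_finite_induct)
  case (insert x A)
  then show ?case using homogeneous_mult[of 1 "f x" "card A" "prod f A"] by simp
qed simp_all

text \<open>Each monomial of \<open>h * q\<close> has a monomial of \<open>h\<close> as a
  factor.\<close>

lemma homogeneous_dvd_degree:
  assumes "homogeneous d p" "homogeneous e h" "h dvd p" "p \<noteq> 0"
  shows "e \<le> d"
proof -
  obtain q where p: "p = h * q" using assms(3) by (auto simp: dvd_def)
  obtain m where m: "m \<in> Poly_Mapping.keys p" using assms(4) by fastforce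
  then obtain a b where "m = a + b" "a \<in> Poly_Mapping.keys h"
    using keys_mult[of h q] p by blast
  then show ?thesis using m assms(1,2) by (auto simp: homogeneous_monomial_degree monomial_degree_add)
qed

text \<open>Substituting \<open>y_i\<close> for \<open>y_j\<close> kills \<open>p\<close> but no
  other root of the set, since pairs occur in increasing order only. Hence it kills the quotient
  \<open>q\<close>, and \<open>q\<close> is congruent to its substituted form modulo the new
  root.\<close>

lemma prod_root_differences_dvd:
  assumes "finite I" "\<And>i j. (i, j) \<in> I \<Longrightarrow> i < j" "\<And>i j. (i, j) \<in> I \<Longrightarrow> yvar j - yvar i dvd p"
  shows "(\<Prod>(i, j)\<in>I. yvar j - yvar i) dvd p"
  using assms
proof (induction I rule: finite_induct)
  case (insert x I)
  obtain i j where x: "x = (i, j)" by (cases x)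
  have ij: "i < j" "yvar j - yvar i dvd p" using insert.prems x by auto
  let ?D = "\<Prod>(i, j)\<in>I. yvar j - yvar i" and ?h = "yvar(j := yvar i)"
  have "?D dvd p" using insert by simp
  then obtain q where q: "p = ?D * q" by (auto simp: dvd_def)
  have D: "subst_poly ?h ?D \<noteq> 0"
  proof -
    have "subst_poly ?h ?D = (\<Prod>(a, b)\<in>I. ?h b - ?h a)"
      by (simp add: subst_poly_prod case_prod_beta subst_poly_diff)
    moreover have "?h b - ?h a \<noteq> 0" if "(a, b) \<in> I" for a b
    proof -
      have "a < b" "(a, b) \<noteq> (i, j)" using that insert x by auto
      then show ?thesis using ij by (auto simp: fun_upd_def)
    qed
    ultimately show ?thesis using insert.hyps by (auto simp: prod_zero_iff)
  qed
  have "subst_poly ?h p = 0"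
    using ij by (auto simp: dvd_def subst_poly_mult subst_poly_diff)
  then have 0: "subst_poly ?h q = 0" using D by (simp add: q subst_poly_mult)
  have "yvar j - yvar i dvd subst_poly yvar q - subst_poly ?h q"
    by (intro subst_poly_cong) auto
  then have "yvar j - yvar i dvd q" by (simp add: 0 subst_poly_id)
  then show ?case using insert.hyps x by (simp add: q mult.commute mult_dvd_mono)
qed simp

section \<open>Nonnegativity in the differences of consecutive variables\<close>

definition nonneg_poly :: "nat \<Rightarrow> ypoly \<Rightarrow> bool" where
  "nonneg_poly n q \<longleftrightarrow> (\<forall>m\<in>Poly_Mapping.keys q. Poly_Mapping.keys m \<subseteq> {1..<n}) \<and>
     (\<forall>m. Poly_Mapping.lookup q m \<ge> 0)"

lemma nonneg_in_differences_iff: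
  "nonneg_in_differences n p \<longleftrightarrow>
    (\<exists>q. nonneg_poly n q \<and> p = subst_poly (\<lambda>i. yvar (i + 1) - yvar i) q)"
  by (simp add: nonneg_in_differences_def nonneg_poly_def conj_assoc)

lemma nonneg_poly_add: "nonneg_poly n p \<Longrightarrow> nonneg_poly n q \<Longrightarrow> nonneg_poly n (p + q)"
  unfolding nonneg_poly_def using keys_add[of p q] by (simp add: lookup_add) blast

lemma Sum_any_nonneg:
  fixes f :: "'b \<Rightarrow> int" shows "(\<And>x. f x \<ge> 0) \<Longrightarrow> Sum_any f \<ge> 0"
  by (simp add: Sum_any.expand_set sum_nonneg)

lemma nonneg_poly_mult:
  assumes "nonneg_poly n p" "nonneg_poly n q"
  shows "nonneg_poly n (p * q)"
proof -
  have "Poly_Mapping.lookup (p * q) m \<ge> 0" for m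
    unfolding lookup_mult using assms
    by (intro Sum_any_nonneg mult_nonneg_nonneg) (auto simp: nonneg_poly_def when_def)
  moreover have "Poly_Mapping.keys (a + b) \<subseteq> {1..<n}"
    if "a \<in> Poly_Mapping.keys p" "b \<in> Poly_Mapping.keys q" for a b
    using that subset_trans[OF keys_add[of a b]] assms unfolding nonneg_poly_def by simp
  then have "Poly_Mapping.keys m \<subseteq> {1..<n}" if "m \<in> Poly_Mapping.keys (p * q)" for m
    using subsetD[OF keys_mult that] by auto
  ultimately show ?thesis by (simp add: nonneg_poly_def)
qed

lemma nonneg_in_differences_sum:
  assumes "\<And>x. x \<in> A \<Longrightarrow> nonneg_in_differences n (f x)"
  shows "nonneg_in_differences n (sum f A)"
  using assms
proof (induction A rule: infinite_finite_induct)
  case (insert x A)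
  let ?f = "\<lambda>i. yvar (i + 1) - yvar i"
  obtain q where q: "nonneg_poly n q" "f x = subst_poly ?f q"
    using insert.prems[of x] by (auto simp: nonneg_in_differences_iff)
  obtain r where r: "nonneg_poly n r" "sum f A = subst_poly ?f r"
    using insert.IH insert.prems by (auto simp: nonneg_in_differences_iff)
  show ?case
    unfolding nonneg_in_differences_iff sum.insert[OF insert.hyps] q(2) r(2)
    by (intro exI[of _ "q + r"] conjI nonneg_poly_add q r subst_poly_add[symmetric])
qed (auto simp: nonneg_in_differences_iff nonneg_poly_def intro!: exI[of _ 0])

lemma nonneg_in_differences_prod:
  assumes "\<And>x. x \<in> A \<Longrightarrow> nonneg_in_differences n (f x)"
  shows "nonneg_in_differences n (prod f A)"
  using assms
proof (induction A rule: infinite_finite_induct)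
  case (insert x A)
  let ?f = "\<lambda>i. yvar (i + 1) - yvar i"
  obtain q where q: "nonneg_poly n q" "f x = subst_poly ?f q"
    using insert.prems[of x] by (auto simp: nonneg_in_differences_iff)
  obtain r where r: "nonneg_poly n r" "prod f A = subst_poly ?f r"
    using insert.IH insert.prems by (auto simp: nonneg_in_differences_iff)
  show ?case
    unfolding nonneg_in_differences_iff prod.insert[OF insert.hyps] q(2) r(2)
    by (intro exI[of _ "q * r"] conjI nonneg_poly_mult q r subst_poly_mult[symmetric])
qed (auto simp: nonneg_in_differences_iff nonneg_poly_def lookup_one when_def intro!: exI[of _ 1])

lemma nonneg_in_differences_root:
  assumes "1 \<le> i" "i < j" "j \<le> n"
  shows "nonneg_in_differences n (yvar j - yvar i)"
proof -
  have "nonneg_in_differences n (\<Sum>t = i..<j. yvar (t + 1) - yvar t)"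
  proof (intro nonneg_in_differences_sum)
    fix t assume "t \<in> {i..<j}"
    then have "nonneg_poly n (yvar t)"
      using assms by (simp add: nonneg_poly_def yvar_def lookup_single when_def)
    then show "nonneg_in_differences n (yvar (t + 1) - yvar t)"
      unfolding nonneg_in_differences_iff by (intro exI[of _ "yvar t"]) simp
  qed
  also have "(\<Sum>t = i..<j. yvar (t + 1) - yvar t) = yvar j - yvar i"
    using sum_Suc_diff'[of i j yvar] assms by simp
  finally show ?thesis .
qed

section \<open>Equivariant Schubert classes\<close>

definition yvars :: "nat \<Rightarrow> ypoly list" where
  "yvars n = map yvar [1..<Suc n]"

lemma yvars_simps [simp]: "length (yvars n) = n" "i < n \<Longrightarrow> yvars n ! i = yvar (Suc i)" "distinct (yvars n)"
  by (simp_all add: yvars_def distinct_map inj_on_def del: upt_Suc)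

lemma strip_HT_pt: "set ys \<subseteq> HT_pt n \<Longrightarrow> x \<in> HT_pt n \<Longrightarrow> strip x ys as bs t s \<in> HT_pt n"
proof (induction x ys as bs t s rule: strip.induct)
  case (2 x y ys a as b bs t s)
  then have "vertex_weight (y - x) a q t b \<in> HT_pt n" for q
    by (simp add: vertex_weight_def HT_pt_diff)
  then show ?case using 2 by (auto intro!: HT_pt_sum HT_pt_mult)
qed simp_all

lemma puzzle_sum_HT_pt: "set ys \<subseteq> HT_pt n \<Longrightarrow> puzzle_sum ys as ms vs \<in> HT_pt n"
proof (induction ys as ms vs rule: puzzle_sum.induct)
  case (2 y ys a as m ms v vs)
  then show ?case by (auto intro!: HT_pt_sum HT_pt_mult strip_HT_pt simp: bottom_weight_def)
qed simp_all

lemma set_yvars: "set (yvars n) \<subseteq> HT_pt n"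
  by (auto simp: yvars_def HT_pt_yvar)

text \<open>Both terms of the recursion have the same degree: removing a descent of \<open>l\<close>
  costs one inversion, and the root makes up for it.\<close>

lemma restr_homogeneous:
  assumes "\<And>y. y \<in> set ys \<Longrightarrow> homogeneous 1 y" "distinct ys"
    "length s = length ys" "length l = length ys" "count_list l True = count_list s True"
  shows "homogeneous (card (inversions l)) (restr ys l s)"
  using assms
proof (induction s arbitrary: ys l rule: desc_induct)
  case (sorted s)
  then have "restr ys l s = of_bool (l = s)"
    by (intro restr_sorted[of s "length ys" "count_list s True"]) (simp_all add: strings_def)
  then show ?case using sorted by (simp add: inversions_sorted of_bool_def)
next
  case (swap_at s i)
  let ?ys = "swap_at i ys"
  have i: "Suc i < length ys" "Suc i < length l" using swap_at.prems swap_at.hyps by simp_all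
  have IH: "homogeneous (card (inversions l')) (restr ?ys l' (swap_at i s))"
    if "length l' = length ys" "count_list l' True = count_list s True" for l'
  proof (rule swap_at.IH)
    show "homogeneous 1 y" if "y \<in> set ?ys" for y
      using swap_at.prems(1) that i by simp
  qed (use swap_at.prems swap_at.hyps that i in \<open>simp_all add: count_list_swap_at\<close>)
  have u: "homogeneous 1 (ys ! Suc i - ys ! i)"
    using i by (intro homogeneous_diff swap_at.prems(1)) simp_all
  have "homogeneous (card (inversions l)) ((ys ! Suc i - ys ! i) * restr ?ys (swap_at i l) (swap_at i s))" if "desc i l"
    using homogeneous_mult[OF u IH[of "swap_at i l"]] swap_at.prems i card_inversions_swap_at[OF i(2) that]
    by (simp add: count_list_swap_at)
  then have "homogeneous (card (inversions l)) (act (ys ! Suc i - ys ! i) i (\<lambda>l. restr ?ys l (swap_at i s)) l)"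
    using IH[of l] swap_at.prems by (simp add: act_def homogeneous_add)
  then show ?case using restr_swap_at[of i ys l s] swap_at.prems i by simp
qed

lemma count_True_sum: "count_list l True = (\<Sum>i<length l. of_bool (l ! i))"
  by (induction l) (simp_all add: sum.lessThan_Suc_shift del: sum.lessThan_Suc)

lemma ones_sum: "j \<le> length l \<Longrightarrow> ones j l = (\<Sum>i<j. of_bool (l ! i))"
  by (simp add: ones_def count_True_sum)

lemma dominates_iff_prefix_dom:
  assumes "length l = length l'"
  shows "dominates l' l \<longleftrightarrow> prefix_dom l' l"
proof -
  have *: "(\<Sum>i = Suc 0..j. of_bool (place l i)) = ones j l" if "j \<le> length l" for j l
    using that by (simp add: ones_sum place_def sum.atLeast1_atMost_eq del: sum_of_bool_eq)
  have **: "ones j l = ones (min j (length l)) l" for j l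
    by (cases "j \<le> length l") (simp_all add: ones_def)
  have "prefix_dom l' l \<longleftrightarrow> (\<forall>j\<le>length l. ones j l \<le> ones j l')"
    unfolding prefix_dom_def using ** assms by (metis min.cobounded2)
  also have "\<dots> \<longleftrightarrow> (\<forall>j\<in>{1..length l}. ones j l \<le> ones j l')"
    by (metis atLeastAtMost_iff less_one linorder_not_le ones_simps(1) order_refl)
  also have "\<dots> \<longleftrightarrow> dominates l' l"
    unfolding dominates_def using assms by (simp add: * del: sum_of_bool_eq)
  finally show ?thesis ..
qed

text \<open>The GKM conditions speak of strings that agree off two places; equal content then leaves
  only an exchange of two different letters.\<close>

lemma transposed_strings:
  assumes "s \<in> strings n k" "s' \<in> strings n k" "s \<noteq> s'" "p < n" "q < n"
    and eq: "\<And>x. x < n \<Longrightarrow> x \<noteq> p \<Longrightarrow> x \<noteq> q \<Longrightarrow> s ! x = s' ! x"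
  shows "p \<noteq> q" "s' = s[p := s ! q, q := s ! p]"
proof -
  have len: "length s = n" "length s' = n" using assms(1,2) by (auto simp: strings_def)
  have sums: "(\<Sum>i<n. of_bool (s ! i) :: nat) = (\<Sum>i<n. of_bool (s' ! i))"
  proof -
    have "count_list s True = count_list s' True" using assms(1,2) by (simp add: strings_def)
    then show ?thesis unfolding count_True_sum len .
  qed
  have rest: "(\<Sum>i\<in>{..<n} - {p, q}. of_bool (s ! i) :: nat) = (\<Sum>i\<in>{..<n} - {p, q}. of_bool (s' ! i))"
    using eq by (intro sum.cong) auto
  show pq: "p \<noteq> q"
  proof
    assume "p = q"
    then have "s ! p = s' ! p"
      using sums rest assms(4)
      by (simp add: sum.remove[of "{..<n}" p] of_bool_def del: sum_of_bool_eq split: if_splits)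
    then have "s ! x = s' ! x" if "x < n" for x
      using eq[OF that] \<open>p = q\<close> by (cases "x = p") auto
    then show False
      using assms(3) len by (auto simp: list_eq_iff_nth_eq)
  qed
  have split: "(\<Sum>i<n. f i :: nat) = f p + (f q + (\<Sum>i\<in>{..<n} - {p, q}. f i))" for f
  proof -
    have "{..<n} - {p, q} = {..<n} - {p} - {q}" by auto
    then show ?thesis using assms(4,5) pq
      by (simp add: sum.remove[of "{..<n}" p] sum.remove[of "{..<n} - {p}" q])
  qed
  have two: "of_bool (s ! p) + (of_bool (s ! q) :: nat) = of_bool (s' ! p) + of_bool (s' ! q)"
    using sums rest unfolding split by simp
  have "\<not> (s ! p = s' ! p \<and> s ! q = s' ! q)"
  proof
    assume *: "s ! p = s' ! p \<and> s ! q = s' ! q"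
    have "s ! x = s' ! x" if "x < n" for x
      using eq[OF that] * by (cases "x = p"; cases "x = q") auto
    then show False
      using assms(3) len by (auto simp: list_eq_iff_nth_eq)
  qed
  with two have "s' ! p = s ! q \<and> s' ! q = s ! p"
    by (auto simp: of_bool_def split: if_splits)
  then have swapped: "s' ! p = s ! q" "s' ! q = s ! p" by blast+
  show "s' = s[p := s ! q, q := s ! p]"
  proof (rule nth_equalityI)
    fix x assume "x < length s'"
    then show "s' ! x = s[p := s ! q, q := s ! p] ! x"
      using eq[of x] swapped len assms(4,5) by (cases "x = q"; cases "x = p") simp_all
  qed (simp add: len)
qed

text \<open>Moving a one to the right from \<open>p\<close> to \<open>q\<close> lowers the prefix
  counts by one exactly at the lengths \<open>j\<close> with \<open>p < j\<close> and
  \<open>j \<le> q\<close>.\<close>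

lemma rank_transposed:
  assumes "p < q" "q < length s" "s ! p" "\<not> s ! q"
  shows "rank (s[p := s ! q, q := s ! p]) < rank s"
proof -
  let ?s = "s[p := s ! q, q := s ! p]"
  have *: "ones j ?s + of_bool (p < j) = ones j s + of_bool (q < j)" if "j \<le> length s" for j
    using that
  proof (induction j)
    case (Suc j)
    then have "ones (Suc j) s = ones j s + of_bool (s ! j)" "ones (Suc j) ?s = ones j ?s + of_bool (?s ! j)"
      by (simp_all add: ones_Suc)
    then show ?case using Suc assms by (auto simp: nth_list_update less_Suc_eq split: if_splits)
  qed simp
  have "ones j ?s \<le> ones j s" if "j \<le> length s" for j
    using *[OF that] assms(1) by (cases "p < j"; cases "q < j") auto
  moreover have "ones q ?s < ones q s"
    using *[of q] assms by simp
  ultimately show ?thesis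
    unfolding rank_def using assms(2) by (auto intro!: sum_strict_mono_ex1 bexI[of _ q])
qed

text \<open>Removing a descent lowers both sides by one and keeps \<open>sort s\<close>, which
  depends only on the content. Strict dominance thereby becomes a strict inequality of
  degrees.\<close>

lemma card_inversions_rank: "rank s = card (inversions s) + rank (sort s)"
proof (induction s rule: desc_induct)
  case (sorted s)
  then show ?case by (simp add: inversions_sorted sorted_sort_id)
next
  case (swap_at s i)
  have "mset (swap_at i s) = mset s"
    using swap_at.hyps by (simp add: swap_at_def mset_swap)
  then have "sort (swap_at i s) = sort s"
    by (metis mset_sort properties_for_sort sorted_sort)
  then show ?case using swap_at rank_swap_at card_inversions_swap_at by simp
qed

lemma card_inversions_less:
  assumes "prefix_dom v l" "v \<noteq> l" "v \<in> strings n k" "l \<in> strings n k"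
  shows "card (inversions l) < card (inversions v)"
proof -
  have "sort v = sort l"
    using assms(3,4) by (intro sorted_same_content) (simp_all add: strings_def flip: count_mset)
  moreover have "rank l < rank v" using assms by (intro prefix_dom_rank_less) (simp_all add: strings_def)
  ultimately show ?thesis by (simp add: card_inversions_rank[of v] card_inversions_rank[of l])
qed

definition schubert_fun :: "nat \<Rightarrow> nat \<Rightarrow> bool list \<Rightarrow> bool list \<Rightarrow> ypoly" where
  "schubert_fun n k l s = (if s \<in> strings n k then restr (yvars n) l s else 0)"

lemma diff_dvd_commute: "a - b dvd c \<longleftrightarrow> b - a dvd (c::'a::comm_ring_1)"
  by (metis minus_diff_eq minus_dvd_iff)

lemma restr_yvars_gkm:
  assumes "l \<in> strings n k" "s \<in> strings n k" "s' \<in> strings n k" "i \<in> {1..n}" "j \<in> {1..n}"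
    "\<forall>m\<in>{1..n} - {i, j}. place s m = place s' m"
  shows "yvar i - yvar j dvd restr (yvars n) l s - restr (yvars n) l s'"
proof (cases "s = s'")
  case False
  obtain p q where pq: "i = Suc p" "j = Suc q" "p < n" "q < n"
    using assms(4,5) by (cases i; cases j) auto
  have "s ! x = s' ! x" if "x < n" "x \<noteq> p" "x \<noteq> q" for x
    using assms(6)[rule_format, of "Suc x"] that pq by (simp add: place_def)
  then have tr: "p \<noteq> q" "s' = s[p := s ! q, q := s ! p]"
    using transposed_strings[OF assms(2,3) False pq(3,4)] by blast+
  have len: "length s = n" "length l = n" using assms by (auto simp: strings_def)
  show ?thesis
  proof (cases "p < q")
    case True
    then show ?thesis
      using restr_gkm[of p q "yvars n" s l] len pq tr by (subst diff_dvd_commute) simp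
  next
    case False
    then show ?thesis
      using restr_gkm[of q p "yvars n" s l] len pq tr by (simp add: list_update_swap)
  qed
qed simp

lemma schubert_fun_class:
  assumes "l \<in> strings n k"
  shows "is_schubert_class n k l (schubert_fun n k l)"
proof -
  have ht: "restr (yvars n) l s \<in> HT_pt n" for s
    unfolding restr_def string_sum_def by (intro puzzle_sum_HT_pt set_yvars)
  have gkm: "\<exists>q\<in>HT_pt n. restr (yvars n) l s - restr (yvars n) l s' = q * (yvar i - yvar j)"
    if "s \<in> strings n k" "s' \<in> strings n k" "i \<in> {1..n}" "j \<in> {1..n}"
      "\<forall>m\<in>{1..n} - {i, j}. place s m = place s' m" for s s' i j
  proof -
    have "yvar i - yvar j \<in> HT_pt n" using that by (intro HT_pt_diff HT_pt_yvar)
    from HT_pt_dvd[OF HT_pt_diff[OF ht ht] this restr_yvars_gkm[OF assms that]] show ?thesis by metis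
  qed
  have "schubert_fun n k l \<in> HT_Gr n k"
    unfolding HT_Gr_def schubert_fun_def using gkm ht by simp
  moreover have "dominates s l" if "s \<in> strings n k" "schubert_fun n k l s \<noteq> 0" for s
    using that assms restr_prefix_dom[of "yvars n" l s] by (simp add: schubert_fun_def dominates_iff_prefix_dom strings_def)
  moreover have "schubert_fun n k l l = (\<Prod>(i, j)\<in>inversions l. yvar j - yvar i)"
  proof -
    have "schubert_fun n k l l = (\<Prod>(i, j)\<in>inversions l. yvars n ! (j - 1) - yvars n ! (i - 1))"
      using assms by (simp add: schubert_fun_def restr_diag strings_def)
    also have "\<dots> = (\<Prod>(i, j)\<in>inversions l. yvar j - yvar i)"
      using assms by (intro prod.cong) (auto simp: inversions_def strings_def)
    finally show ?thesis .
  qed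
  moreover have "homogeneous (card (inversions l)) (schubert_fun n k l s)" if "s \<in> strings n k" for s
  proof -
    have "homogeneous 1 y" if "y \<in> set (yvars n)" for y
      using that by (auto simp: yvars_def)
    then have "homogeneous (card (inversions l)) (restr (yvars n) l s)"
      using that assms by (intro restr_homogeneous) (simp_all add: strings_def)
    then show ?thesis using that by (simp add: schubert_fun_def)
  qed
  ultimately show ?thesis by (auto simp: is_schubert_class_def)
qed

lemma HT_Gr_gkm:
  assumes "\<alpha> \<in> HT_Gr n k" "s \<in> strings n k" "s' \<in> strings n k" "i \<in> {1..n}" "j \<in> {1..n}"
    "\<forall>m\<in>{1..n} - {i, j}. place s m = place s' m"
  shows "yvar i - yvar j dvd \<alpha> s - \<alpha> s'"
  using assms unfolding HT_Gr_def by fastforce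

text \<open>At a minimal point of its support the difference of two candidates would be divisible by
  a product of more roots than its degree allows.\<close>

lemma schubert_class_unique:
  assumes l: "l \<in> strings n k" and "is_schubert_class n k l \<alpha>" "is_schubert_class n k l \<beta>"
  shows "\<alpha> = \<beta>"
proof (rule ccontr)
  assume "\<alpha> \<noteq> \<beta>"
  define D where "D = (\<lambda>s. \<alpha> s - \<beta> s)"
  have out: "D s = 0" if "s \<notin> strings n k" for s
    using assms that by (simp add: D_def is_schubert_class_def HT_Gr_def)
  obtain s0 where "D s0 \<noteq> 0" using \<open>\<alpha> \<noteq> \<beta>\<close> by (auto simp: D_def fun_eq_iff)
  then obtain s where s: "D s \<noteq> 0" and min: "\<And>t. D t \<noteq> 0 \<Longrightarrow> rank s \<le> rank t"
    using ex_has_least_nat[of "\<lambda>s. D s \<noteq> 0" s0 rank] by blast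
  have st: "s \<in> strings n k" using s out by blast
  then have len: "length s = n" by (simp add: strings_def)
  have "\<alpha> s \<noteq> 0 \<or> \<beta> s \<noteq> 0" using s by (auto simp: D_def)
  then have "dominates s l" using assms st by (auto simp: is_schubert_class_def)
  then have prefix_dom: "prefix_dom s l" using l len by (simp add: dominates_iff_prefix_dom strings_def)
  have ne: "s \<noteq> l" using s assms by (auto simp: D_def is_schubert_class_def)
  have roots: "yvar j - yvar i dvd D s" if ij: "(i, j) \<in> inversions s" for i j
  proof -
    have *: "1 \<le> i" "i < j" "j \<le> n" "s ! (i - 1)" "\<not> s ! (j - 1)"
      using ij len by (auto simp: inversions_def place_def)
    let ?t = "s[i - 1 := s ! (j - 1), j - 1 := s ! (i - 1)]"
    have t: "?t \<in> strings n k"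
    proof -
      have "mset ?t = mset s" using * len by (intro mset_swap) simp_all
      then show ?thesis using st by (simp add: strings_def flip: count_mset)
    qed
    have "rank ?t < rank s" using * len by (intro rank_transposed) simp_all
    then have "D ?t = 0" using min[of ?t] by linarith
    moreover have "yvar i - yvar j dvd D s - D ?t"
    proof -
      have agree: "\<forall>m\<in>{1..n} - {i, j}. place s m = place ?t m"
      proof
        fix m assume "m \<in> {1..n} - {i, j}"
        then have "m - 1 \<noteq> i - 1" "m - 1 \<noteq> j - 1" using * by auto
        then show "place s m = place ?t m" by (simp add: place_def)
      qed
      have "i \<in> {1..n}" "j \<in> {1..n}" "\<alpha> \<in> HT_Gr n k" "\<beta> \<in> HT_Gr n k"
        using * assms(2,3) by (simp_all add: is_schubert_class_def)
      then have "yvar i - yvar j dvd \<alpha> s - \<alpha> ?t" "yvar i - yvar j dvd \<beta> s - \<beta> ?t"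
        using HT_Gr_gkm[OF _ st t _ _ agree] by blast+
      then have "yvar i - yvar j dvd (\<alpha> s - \<alpha> ?t) - (\<beta> s - \<beta> ?t)" by (rule dvd_diff)
      then show ?thesis by (simp add: D_def algebra_simps)
    qed
    ultimately have "yvar i - yvar j dvd D s" by simp
    then show ?thesis by (simp only: diff_dvd_commute[of "yvar j"])
  qed
  have deg: "homogeneous (card (inversions l)) (D s)"
    unfolding D_def using assms st by (intro homogeneous_diff) (auto simp: is_schubert_class_def)
  have deg': "homogeneous (card (inversions s)) (\<Prod>(i, j)\<in>inversions s. yvar j - yvar i)"
    by (intro homogeneous_prod) (auto intro!: homogeneous_diff)
  have "(\<Prod>(i, j)\<in>inversions s. yvar j - yvar i) dvd D s"
    by (intro prod_root_differences_dvd finite_inversions roots) (simp_all add: inversions_def)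
  then have "card (inversions s) \<le> card (inversions l)"
    by (rule homogeneous_dvd_degree[OF deg deg' _ s])
  with card_inversions_less[OF prefix_dom ne st l] show False by linarith
qed

lemma schubert_eq: "l \<in> strings n k \<Longrightarrow> schubert n k l = schubert_fun n k l"
  unfolding schubert_def using schubert_fun_class schubert_class_unique by (intro the_equality) blast+

lemma sum_fun_apply: "(\<Sum>v\<in>A. f v) x = (\<Sum>v\<in>A. f v x)"
  by (induction A rule: infinite_finite_induct) simp_all

lemma restr_diag_nonzero:
  fixes ys :: "'a::idom list"
  assumes "length s = length ys" "distinct ys"
  shows "restr ys s s \<noteq> 0"
proof -
  have "ys ! (b - 1) \<noteq> ys ! (a - 1)" if "(a, b) \<in> inversions s" for a b
    using that assms by (auto simp: inversions_def nth_eq_iff_index_eq)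
  then show ?thesis using assms by (auto simp: restr_diag)
qed

text \<open>At a point \<open>s\<close> of least rank in the support of \<open>c\<close> only the
  diagonal term survives: another class that is nonzero at \<open>s\<close> has an index of smaller
  rank, hence coefficient zero.\<close>

lemma schubert_independent:
  assumes "\<And>v. v \<notin> strings n k \<Longrightarrow> c v = 0"
    and "\<And>s. s \<in> strings n k \<Longrightarrow> (\<Sum>v\<in>strings n k. c v * restr (yvars n) v s) = 0"
  shows "c v = 0"
proof (rule ccontr)
  assume "c v \<noteq> 0"
  then obtain s where s: "c s \<noteq> 0" and min: "\<And>t. c t \<noteq> 0 \<Longrightarrow> rank s \<le> rank t"
    using ex_has_least_nat[of "\<lambda>s. c s \<noteq> 0" v rank] by blast
  have st: "s \<in> strings n k" using s assms(1) by blast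
  have "c t * restr (yvars n) t s = (if t = s then c s * restr (yvars n) s s else 0)" if "t \<in> strings n k" for t
  proof (cases "t = s")
    case False
    have "c t = 0" if "prefix_dom s t"
      using prefix_dom_rank_less[of s t] min[of t] that False st \<open>t \<in> strings n k\<close> by (force simp: strings_def)
    then show ?thesis using False restr_prefix_dom[of "yvars n" t s] by auto
  qed simp
  then have "(\<Sum>v\<in>strings n k. c v * restr (yvars n) v s) = (\<Sum>t\<in>strings n k. if t = s then c s * restr (yvars n) s s else 0)"
    by (intro sum.cong refl)
  then have "c s * restr (yvars n) s s = 0" using assms(2)[OF st] st by simp
  then show False using s restr_diag_nonzero[of s "yvars n"] st by (simp add: strings_def)
qed

theorem schubert_product:
  assumes "l \<in> strings n k" "m \<in> strings n k"
  shows "schubert n k l * schubert n k m = (\<Sum>v\<in>strings n k. string_sum (yvars n) l m v *\<^sub>T schubert n k v)"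
proof
  fix s
  have "(schubert n k l * schubert n k m) s = schubert_fun n k l s * schubert_fun n k m s"
    using assms by (simp add: schubert_eq)
  also have "\<dots> = (\<Sum>v\<in>strings n k. string_sum (yvars n) l m v * schubert_fun n k v s)"
    using restr_product[of "yvars n" n l k m s] assms by (simp add: schubert_fun_def)
  also have "\<dots> = (\<Sum>v\<in>strings n k. string_sum (yvars n) l m v *\<^sub>T schubert n k v) s"
    by (simp add: sum_fun_apply scale_def schubert_eq)
  finally show "(schubert n k l * schubert n k m) s = \<dots>" .
qed

theorem structure_constant_eq:
  assumes "l \<in> strings n k" "m \<in> strings n k" "v \<in> strings n k"
  shows "structure_constant n k l m v = string_sum (yvars n) l m v"
proof -
  define c where "c = (\<lambda>v. if v \<in> strings n k then string_sum (yvars n) l m v else 0)"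
  have ht: "string_sum (yvars n) l m v \<in> HT_pt n" for v
    unfolding string_sum_def by (intro puzzle_sum_HT_pt set_yvars)
  have prod: "schubert n k l * schubert n k m = (\<Sum>v\<in>strings n k. c v *\<^sub>T schubert n k v)"
    unfolding schubert_product[OF assms(1,2)] c_def by (intro sum.cong) simp_all
  have "structure_constant n k l m = c"
    unfolding structure_constant_def
  proof (rule the_equality)
    show "(\<forall>v\<in>strings n k. c v \<in> HT_pt n) \<and> (\<forall>v. v \<notin> strings n k \<longrightarrow> c v = 0) \<and>
      schubert n k l * schubert n k m = (\<Sum>v\<in>strings n k. c v *\<^sub>T schubert n k v)"
      using ht prod by (simp add: c_def)
  next
    fix d assume d: "(\<forall>v\<in>strings n k. d v \<in> HT_pt n) \<and> (\<forall>v. v \<notin> strings n k \<longrightarrow> d v = 0) \<and>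
      schubert n k l * schubert n k m = (\<Sum>v\<in>strings n k. d v *\<^sub>T schubert n k v)"
    have ind: "(\<Sum>v\<in>strings n k. (d v - c v) * restr (yvars n) v s) = 0" if "s \<in> strings n k" for s
    proof -
      have *: "(\<Sum>v\<in>strings n k. e v *\<^sub>T schubert n k v) s = (\<Sum>v\<in>strings n k. e v * restr (yvars n) v s)" for e
        using that by (simp add: sum_fun_apply scale_def schubert_eq schubert_fun_def)
      have "(\<Sum>v\<in>strings n k. d v *\<^sub>T schubert n k v) = (\<Sum>v\<in>strings n k. c v *\<^sub>T schubert n k v)"
        using d prod by metis
      then have "(\<Sum>v\<in>strings n k. d v * restr (yvars n) v s) = (\<Sum>v\<in>strings n k. c v * restr (yvars n) v s)"
        by (simp only: *[symmetric])
      then show ?thesis unfolding left_diff_distrib sum_subtractf by simp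
    qed
    have "d v - c v = 0" for v
      by (rule schubert_independent[where c = "\<lambda>v. d v - c v", OF _ ind]) (use d in \<open>simp_all add: c_def\<close>)
    then show "d = c" by (simp add: fun_eq_iff)
  qed
  then show ?thesis using assms by (simp add: c_def)
qed

section \<open>Puzzles and edge labelings\<close>

text \<open>All edges of a piece, including the edge inside a rhombus. That edge is labelled \<^term>\<open>Some Ten\<close> in an
  ordinary rhombus and \<^term>\<open>None :: lab option\<close> in an equivariant piece.\<close>

fun full_labels :: "piece \<Rightarrow> (edge \<times> lab option) set" where
  "full_labels (Triangle t x) = tri_edges t \<times> {Some (bit x)}"
| "full_labels (RhombusNS a b) =
     {(NWSE a (b + 1), Some Zero), (NWSE a b, Some Zero), (SWNE a (b + 1), Some One),
      (SWNE (a + 1) b, Some One), (EW a (b + 1), Some Ten)}"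
| "full_labels (RhombusSWNE a b) =
     {(SWNE a b, Some Zero), (SWNE (a + 1) b, Some Zero), (EW a (b + 1), Some One),
      (EW a b, Some One), (NWSE a b, Some Ten)}"
| "full_labels (RhombusNWSE a b) =
     {(EW a (b + 1), Some Zero), (EW (a + 1) b, Some Zero), (NWSE a b, Some One),
      (NWSE (a + 1) b, Some One), (SWNE (a + 1) b, Some Ten)}"
| "full_labels (Equivariant a b) =
     {(NWSE a (b + 1), Some One), (NWSE a b, Some One), (SWNE a (b + 1), Some Zero),
      (SWNE (a + 1) b, Some Zero), (EW a (b + 1), None)}"

text \<open>Possible labels (NW, NE, S) of an upward and (SW, SE, N) of a downward triangle.\<close>

definition up_triples :: "(lab \<times> lab \<times> lab option) set" where
  "up_triples = {(Zero, Zero, Some Zero), (Ten, One, Some Zero), (One, One, Some One),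
     (Zero, Ten, Some One), (One, Zero, Some Ten), (Zero, One, None)}"

definition down_triples :: "(lab \<times> lab \<times> lab option) set" where
  "down_triples = {(Zero, Zero, Some Zero), (One, Ten, Some Zero), (One, One, Some One),
     (Ten, Zero, Some One), (Zero, One, Some Ten), (One, Zero, None)}"

definition is_bit :: "lab option \<Rightarrow> bool" where
  "is_bit y \<longleftrightarrow> y = Some Zero \<or> y = Some One"

text \<open>The outer sides must carry bits because the other labels mark the inside of a rhombus,
  which would stick out of the big triangle.\<close>

definition valid_labeling :: "nat \<Rightarrow> (edge \<Rightarrow> lab option) \<Rightarrow> bool" where
  "valid_labeling n g \<longleftrightarrow>
     (\<forall>a b. a + b < n \<longrightarrow> (\<exists>x y. g (SWNE a b) = Some x \<and> g (NWSE a b) = Some y \<and> (x, y, g (EW a b)) \<in> up_triples)) \<and>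
     (\<forall>a b. Suc (a + b) < n \<longrightarrow> (\<exists>x y. g (NWSE a b) = Some x \<and> g (SWNE (Suc a) b) = Some y \<and>
        (x, y, g (EW a (Suc b))) \<in> down_triples)) \<and>
     (\<forall>b<n. is_bit (g (SWNE 0 b))) \<and> (\<forall>a b. Suc (a + b) = n \<longrightarrow> is_bit (g (NWSE a b))) \<and> (\<forall>a<n. is_bit (g (EW a 0)))"

definition agrees :: "(edge \<Rightarrow> lab option) \<Rightarrow> piece \<Rightarrow> bool" where
  "agrees g p \<longleftrightarrow> (\<forall>(e, y)\<in>full_labels p. g e = y)"

text \<open>The labels alone determine the decomposition, as the glued edges are visible in them:
  each triangle lies in exactly one fitting piece (\<open>cover\<close>,
  \<open>agrees_unique\<close>).\<close>

definition puzzle_of :: "nat \<Rightarrow> (edge \<Rightarrow> lab option) \<Rightarrow> piece set" where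
  "puzzle_of n g = {p. piece_triangles p \<subseteq> triangles n \<and> agrees g p}"

lemma full_labels_edge: "t \<in> piece_triangles p \<Longrightarrow> e \<in> tri_edges t \<Longrightarrow> \<exists>y. (e, y) \<in> full_labels p"
  by (cases p) auto

lemma full_labels_triangle: "(e, y) \<in> full_labels p \<Longrightarrow> \<exists>t\<in>piece_triangles p. e \<in> tri_edges t"
  by (cases p) auto

lemma piece_labels_full_labels: "(e, x) \<in> piece_labels p \<longleftrightarrow> (e, Some (bit x)) \<in> full_labels p"
proof -
  have [simp]: "Zero = bit b \<longleftrightarrow> \<not> b" "One = bit b \<longleftrightarrow> b" "Ten = bit b \<longleftrightarrow> False" for b
    by (cases b; simp)+
  show ?thesis by (cases p) auto
qed

lemma full_labels_glue: "(e, y) \<in> full_labels p \<Longrightarrow> \<not> is_bit y \<Longrightarrow> e \<in> tri_edges t \<Longrightarrow> t \<in> piece_triangles p"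
  by (cases p; cases t) (auto simp: is_bit_def bit_def split: if_splits)

lemma full_labels_functional: "(e, y) \<in> full_labels p \<Longrightarrow> (e, z) \<in> full_labels p \<Longrightarrow> y = z"
  by (cases p) auto

lemma agrees_unique:
  assumes "agrees g p" "agrees g q" "t \<in> piece_triangles p" "t \<in> piece_triangles q"
  shows "p = q"
proof -
  have [simp]: "Zero = bit b \<longleftrightarrow> \<not> b" "One = bit b \<longleftrightarrow> b" "Ten = bit b \<longleftrightarrow> False" for b
    by (cases b; simp)+
  show ?thesis
    using assms by (cases p; cases q; cases t) (auto simp: agrees_def)
qed

lemma agrees_up:
  assumes "agrees g p" "Up a b \<in> piece_triangles p"
  shows "\<exists>x y. g (SWNE a b) = Some x \<and> g (NWSE a b) = Some y \<and> (x, y, g (EW a b)) \<in> up_triples"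
  using assms by (cases p) (auto simp: agrees_def up_triples_def bit_def)

lemma agrees_down:
  assumes "agrees g p" "Down a b \<in> piece_triangles p"
  shows "\<exists>x y. g (NWSE a b) = Some x \<and> g (SWNE (Suc a) b) = Some y \<and> (x, y, g (EW a (Suc b))) \<in> down_triples"
  using assms by (cases p) (auto simp: agrees_def down_triples_def bit_def)

lemma triangles_iff [simp]:
  "Up a b \<in> triangles n \<longleftrightarrow> a + b < n" "Down a b \<in> triangles n \<longleftrightarrow> Suc (a + b) < n"
  by (auto simp: triangles_def)

lemma valid_labeling_up:
  assumes "valid_labeling n g" "a + b < n"
  obtains x y where "g (SWNE a b) = Some x" "g (NWSE a b) = Some y" "(x, y, g (EW a b)) \<in> up_triples"
  using assms unfolding valid_labeling_def by blast

lemma valid_labeling_down: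
  assumes "valid_labeling n g" "Suc (a + b) < n"
  obtains x y where "g (NWSE a b) = Some x" "g (SWNE (Suc a) b) = Some y" "(x, y, g (EW a (Suc b))) \<in> down_triples"
  using assms unfolding valid_labeling_def by blast

text \<open>The triple of the triangle selects the piece. A glue label in it occurs in just one
  triple of the upward triangle across that edge, which fixes the remaining labels of the
  rhombus.\<close>

lemma cover_down:
  assumes g: "valid_labeling n g" and n: "Suc (a + b) < n"
  shows "\<exists>p\<in>puzzle_of n g. Down a b \<in> piece_triangles p"
proof -
  obtain x y where d: "g (NWSE a b) = Some x" "g (SWNE (Suc a) b) = Some y" "(x, y, g (EW a (Suc b))) \<in> down_triples"
    using valid_labeling_down[OF g n] .
  obtain x1 y1 where u1: "g (SWNE a b) = Some x1" "g (NWSE a b) = Some y1" "(x1, y1, g (EW a b)) \<in> up_triples"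
    using valid_labeling_up[OF g, of a b] n by auto
  obtain x2 y2 where u2: "g (SWNE a (Suc b)) = Some x2" "g (NWSE a (Suc b)) = Some y2" "(x2, y2, g (EW a (Suc b))) \<in> up_triples"
    using valid_labeling_up[OF g, of a "Suc b"] n by auto
  obtain x3 y3 where u3: "g (SWNE (Suc a) b) = Some x3" "g (NWSE (Suc a) b) = Some y3" "(x3, y3, g (EW (Suc a) b)) \<in> up_triples"
    using valid_labeling_up[OF g, of "Suc a" b] n by auto
  consider "(x, y, g (EW a (Suc b))) = (Zero, Zero, Some Zero)" | "(x, y, g (EW a (Suc b))) = (One, One, Some One)"
    | "(x, y, g (EW a (Suc b))) = (One, Ten, Some Zero)" | "(x, y, g (EW a (Suc b))) = (Ten, Zero, Some One)"
    | "(x, y, g (EW a (Suc b))) = (Zero, One, Some Ten)" | "(x, y, g (EW a (Suc b))) = (One, Zero, None)"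
    using d(3) unfolding down_triples_def by blast
  then show ?thesis
  proof cases
    case 1
    then have "Triangle (Down a b) False \<in> puzzle_of n g"
      using d n by (auto simp: puzzle_of_def agrees_def)
    then show ?thesis by force
  next
    case 2
    then have "Triangle (Down a b) True \<in> puzzle_of n g"
      using d n by (auto simp: puzzle_of_def agrees_def)
    then show ?thesis by force
  next
    case 3
    then have "RhombusNWSE a b \<in> puzzle_of n g"
      using d u3 n by (auto simp: puzzle_of_def agrees_def up_triples_def)
    then show ?thesis by force
  next
    case 4
    then have "RhombusSWNE a b \<in> puzzle_of n g"
      using d u1 n by (auto simp: puzzle_of_def agrees_def up_triples_def)
    then show ?thesis by force
  next
    case 5
    then have "RhombusNS a b \<in> puzzle_of n g"
      using d u2 n by (auto simp: puzzle_of_def agrees_def up_triples_def)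
    then show ?thesis by force
  next
    case 6
    then have "Equivariant a b \<in> puzzle_of n g"
      using d u2 n by (auto simp: puzzle_of_def agrees_def up_triples_def)
    then show ?thesis by force
  qed
qed

lemma cover_up:
  assumes g: "valid_labeling n g" and n: "a + b < n"
  shows "\<exists>p\<in>puzzle_of n g. Up a b \<in> piece_triangles p"
proof -
  obtain x y where u: "g (SWNE a b) = Some x" "g (NWSE a b) = Some y" "(x, y, g (EW a b)) \<in> up_triples"
    using valid_labeling_up[OF g n] .
  \<comment> \<open>An upward triangle on an outer side has no neighbour there; the bits on the
    boundary exclude a glue label on that side.\<close>
  have bd: "a = 0 \<Longrightarrow> x \<noteq> Ten" "Suc (a + b) = n \<Longrightarrow> y \<noteq> Ten" "b = 0 \<Longrightarrow> is_bit (g (EW a b))"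
  proof -
    have "a = 0 \<Longrightarrow> is_bit (g (SWNE a b))" "Suc (a + b) = n \<Longrightarrow> is_bit (g (NWSE a b))" "b = 0 \<Longrightarrow> is_bit (g (EW a b))"
      using g n unfolding valid_labeling_def by simp_all
    then show "a = 0 \<Longrightarrow> x \<noteq> Ten" "Suc (a + b) = n \<Longrightarrow> y \<noteq> Ten" "b = 0 \<Longrightarrow> is_bit (g (EW a b))"
      using u(1,2) n by (auto simp: is_bit_def)
  qed
  consider "(x, y, g (EW a b)) = (Zero, Zero, Some Zero)" | "(x, y, g (EW a b)) = (One, One, Some One)"
    | "(x, y, g (EW a b)) = (Ten, One, Some Zero)" | "(x, y, g (EW a b)) = (Zero, Ten, Some One)"
    | "(x, y, g (EW a b)) = (One, Zero, Some Ten)" | "(x, y, g (EW a b)) = (Zero, One, None)"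
    using u(3) unfolding up_triples_def by blast
  then show ?thesis
  proof cases
    case 1
    then have "Triangle (Up a b) False \<in> puzzle_of n g"
      using u n by (auto simp: puzzle_of_def agrees_def)
    then show ?thesis by force
  next
    case 2
    then have "Triangle (Up a b) True \<in> puzzle_of n g"
      using u n by (auto simp: puzzle_of_def agrees_def)
    then show ?thesis by force
  next
    case 3
    then obtain a' where a: "a = Suc a'" using bd(1) by (cases a) auto
    obtain x1 y1 where "g (NWSE a' b) = Some x1" "g (SWNE (Suc a') b) = Some y1" "(x1, y1, g (EW a' (Suc b))) \<in> down_triples"
      using valid_labeling_down[OF g, of a' b] n a by auto
    then have "RhombusNWSE a' b \<in> puzzle_of n g"
      using 3 u n a by (auto simp: puzzle_of_def agrees_def down_triples_def)
    then show ?thesis using a by force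
  next
    case 4
    then have "Suc (a + b) \<noteq> n" using bd(2) by blast
    with n have "Suc (a + b) < n" by simp
    moreover obtain x1 y1 where "g (NWSE a b) = Some x1" "g (SWNE (Suc a) b) = Some y1" "(x1, y1, g (EW a (Suc b))) \<in> down_triples"
      using valid_labeling_down[OF g calculation] .
    ultimately have "RhombusSWNE a b \<in> puzzle_of n g"
      using 4 u n by (auto simp: puzzle_of_def agrees_def down_triples_def)
    then show ?thesis by force
  next
    case 5
    then obtain b' where b: "b = Suc b'" using bd(3) by (cases b) (auto simp: is_bit_def)
    obtain x1 y1 where "g (NWSE a b') = Some x1" "g (SWNE (Suc a) b') = Some y1" "(x1, y1, g (EW a (Suc b'))) \<in> down_triples"
      using valid_labeling_down[OF g, of a b'] n b by auto
    then have "RhombusNS a b' \<in> puzzle_of n g"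
      using 5 u n b by (auto simp: puzzle_of_def agrees_def down_triples_def)
    then show ?thesis using b by force
  next
    case 6
    then obtain b' where b: "b = Suc b'" using bd(3) by (cases b) (auto simp: is_bit_def)
    obtain x1 y1 where "g (NWSE a b') = Some x1" "g (SWNE (Suc a) b') = Some y1" "(x1, y1, g (EW a (Suc b'))) \<in> down_triples"
      using valid_labeling_down[OF g, of a b'] n b by auto
    then have "Equivariant a b' \<in> puzzle_of n g"
      using 6 u n b by (auto simp: puzzle_of_def agrees_def down_triples_def)
    then show ?thesis using b by force
  qed
qed

lemma cover:
  assumes "valid_labeling n g" "t \<in> triangles n"
  shows "\<exists>p\<in>puzzle_of n g. t \<in> piece_triangles p"
proof (cases t)
  case (Up a b)
  then show ?thesis using cover_up[OF assms(1)] assms(2) by simp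
next
  case (Down a b)
  then show ?thesis using cover_down[OF assms(1)] assms(2) by simp
qed

lemma puzzle_of_puzzles:
  assumes "valid_labeling n g"
  shows "puzzle_of n g \<in> puzzles n"
proof -
  have cov: "(\<Union>p\<in>puzzle_of n g. piece_triangles p) = triangles n"
    using cover[OF assms] by (auto simp: puzzle_of_def simp del: triangles_iff)
  have disj: "piece_triangles p \<inter> piece_triangles q = {}"
    if "p \<in> puzzle_of n g" "q \<in> puzzle_of n g" "p \<noteq> q" for p q
  proof -
    have "agrees g p" "agrees g q" using that by (simp_all add: puzzle_of_def)
    from agrees_unique[OF this] that(3) show ?thesis by blast
  qed
  have lab: "x = y" if "p \<in> puzzle_of n g" "q \<in> puzzle_of n g"
    "(e, x) \<in> piece_labels p" "(e, y) \<in> piece_labels q" for p q e x y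
  proof -
    have "g e = Some (bit x)" "g e = Some (bit y)"
      using that by (auto simp: puzzle_of_def agrees_def piece_labels_full_labels)
    then show ?thesis by simp
  qed
  show ?thesis
    unfolding puzzles_def
    by (intro CollectI conjI ballI allI impI) (rule cov, erule (2) disj, erule (3) lab)
qed

definition edges :: "nat \<Rightarrow> edge set" where
  "edges n = (\<Union>t\<in>triangles n. tri_edges t)"

lemma edges_Up: "a + b < n \<Longrightarrow> e \<in> tri_edges (Up a b) \<Longrightarrow> e \<in> edges n"
  unfolding edges_def by (intro UN_I[of "Up a b"]) simp_all

lemma edgesE:
  assumes "e \<in> edges n"
  obtains a b where "a + b < n" "e \<in> tri_edges (Up a b)" | a b where "Suc (a + b) < n" "e \<in> tri_edges (Down a b)"
proof -
  from assms obtain t where "t \<in> triangles n" "e \<in> tri_edges t" by (auto simp: edges_def)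
  then show thesis using that by (cases t) simp_all
qed

lemma edges_iff [simp]:
  "EW a b \<in> edges n \<longleftrightarrow> a + b < n" "SWNE a b \<in> edges n \<longleftrightarrow> a + b < n" "NWSE a b \<in> edges n \<longleftrightarrow> a + b < n"
  by (auto elim: edgesE intro: edges_Up[of a b])

lemma edge_covered:
  assumes "valid_labeling n g" "e \<in> edges n"
  obtains p where "p \<in> puzzle_of n g" "(e, g e) \<in> full_labels p"
proof -
  obtain t where t: "t \<in> triangles n" "e \<in> tri_edges t" using assms(2) by (auto simp: edges_def)
  obtain p where p: "p \<in> puzzle_of n g" "t \<in> piece_triangles p" using cover[OF assms(1) t(1)] by blast
  obtain y where y: "(e, y) \<in> full_labels p" using full_labels_edge[OF p(2) t(2)] by blast
  then have "g e = y" using p(1) by (auto simp: puzzle_of_def agrees_def)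
  then show thesis using that p(1) y by blast
qed

lemma edge_label_puzzle_of:
  assumes "valid_labeling n g" "e \<in> edges n" "g e = Some (bit x)"
  shows "edge_label (puzzle_of n g) e = x"
  unfolding edge_label_def
proof (rule the_equality)
  obtain p where "p \<in> puzzle_of n g" "(e, g e) \<in> full_labels p" using edge_covered[OF assms(1,2)] .
  then show "\<exists>p\<in>puzzle_of n g. (e, x) \<in> piece_labels p"
    using assms(3) by (auto simp: piece_labels_full_labels)
next
  fix z assume "\<exists>p\<in>puzzle_of n g. (e, z) \<in> piece_labels p"
  then have "g e = Some (bit z)" by (auto simp: puzzle_of_def agrees_def piece_labels_full_labels)
  then show "z = x" using assms(3) by simp
qed

lemma puzzle_of_inject:
  assumes "valid_labeling n g" "valid_labeling n h" "puzzle_of n g = puzzle_of n h" "e \<in> edges n"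
  shows "g e = h e"
proof -
  obtain p where p: "p \<in> puzzle_of n g" "(e, g e) \<in> full_labels p" using edge_covered[OF assms(1,4)] .
  then have "agrees h p" unfolding assms(3) by (simp add: puzzle_of_def)
  then show ?thesis using p(2) by (auto simp: agrees_def)
qed

lemma Equivariant_puzzle_of:
  assumes "valid_labeling n g"
  shows "Equivariant a b \<in> puzzle_of n g \<longleftrightarrow> Suc (a + b) < n \<and> g (EW a (Suc b)) = None"
proof
  assume R: "Suc (a + b) < n \<and> g (EW a (Suc b)) = None"
  obtain x y where "g (NWSE a b) = Some x" "g (SWNE (Suc a) b) = Some y" "(x, y, g (EW a (Suc b))) \<in> down_triples"
    using valid_labeling_down[OF assms, of a b] R by auto
  moreover obtain x2 y2 where "g (SWNE a (Suc b)) = Some x2" "g (NWSE a (Suc b)) = Some y2" "(x2, y2, g (EW a (Suc b))) \<in> up_triples"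
    using valid_labeling_up[OF assms, of a "Suc b"] R by auto
  ultimately show "Equivariant a b \<in> puzzle_of n g"
    using R by (auto simp: puzzle_of_def agrees_def up_triples_def down_triples_def)
qed (auto simp: puzzle_of_def agrees_def)

definition label_of :: "piece set \<Rightarrow> edge \<Rightarrow> lab option" where
  "label_of P e = (THE y. \<exists>p\<in>P. (e, y) \<in> full_labels p)"

lemma puzzle_disjoint:
  "P \<in> puzzles n \<Longrightarrow> p \<in> P \<Longrightarrow> q \<in> P \<Longrightarrow> t \<in> piece_triangles p \<Longrightarrow> t \<in> piece_triangles q \<Longrightarrow> p = q"
  unfolding puzzles_def by blast

text \<open>Matching of bits is part of the definition of a puzzle. Any other label sits inside a
  piece, and that piece contains both triangles at the edge.\<close>

lemma puzzle_full_labels_unique: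
  assumes P: "P \<in> puzzles n" and pq: "p \<in> P" "q \<in> P" and e: "(e, y) \<in> full_labels p" "(e, z) \<in> full_labels q"
  shows "y = z"
proof (cases "is_bit y \<and> is_bit z")
  case True
  then have "\<exists>x. y = Some (bit x)" "\<exists>x. z = Some (bit x)"
    unfolding is_bit_def by (metis bit_simps(1,2))+
  then obtain x x' where "y = Some (bit x)" "z = Some (bit x')" by blast
  then show ?thesis
    using P pq e unfolding puzzles_def by (force simp: piece_labels_full_labels)
next
  case False
  obtain t where t: "t \<in> piece_triangles p" "e \<in> tri_edges t" using full_labels_triangle[OF e(1)] by blast
  obtain s where s: "s \<in> piece_triangles q" "e \<in> tri_edges s" using full_labels_triangle[OF e(2)] by blast
  have "p = q"
    using False full_labels_glue[OF e(1) _ s(2)] full_labels_glue[OF e(2) _ t(2)] puzzle_disjoint[OF P pq] s t by blast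
  then show ?thesis using e full_labels_functional by blast
qed

lemma label_of_eq:
  assumes "P \<in> puzzles n" "p \<in> P" "(e, y) \<in> full_labels p"
  shows "label_of P e = y"
  unfolding label_of_def
proof (rule the_equality)
  show "\<exists>p\<in>P. (e, y) \<in> full_labels p" using assms by blast
  show "z = y" if "\<exists>p\<in>P. (e, z) \<in> full_labels p" for z
    using that assms puzzle_full_labels_unique by blast
qed

lemma label_of_agrees: "P \<in> puzzles n \<Longrightarrow> p \<in> P \<Longrightarrow> agrees (label_of P) p"
  unfolding agrees_def using label_of_eq by blast

lemma puzzle_cover:
  assumes "P \<in> puzzles n" "t \<in> triangles n"
  obtains p where "p \<in> P" "t \<in> piece_triangles p"
  using assms unfolding puzzles_def by blast

lemma puzzle_pieces: "P \<in> puzzles n \<Longrightarrow> p \<in> P \<Longrightarrow> piece_triangles p \<subseteq> triangles n"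
  unfolding puzzles_def by blast

lemma valid_labeling_label_of:
  assumes P: "P \<in> puzzles n"
  shows "valid_labeling n (label_of P)"
proof -
  let ?g = "label_of P"
  have ups: "\<exists>x y. ?g (SWNE a b) = Some x \<and> ?g (NWSE a b) = Some y \<and> (x, y, ?g (EW a b)) \<in> up_triples"
    if "a + b < n" for a b
  proof -
    have "Up a b \<in> triangles n" using that by simp
    then obtain p where "p \<in> P" "Up a b \<in> piece_triangles p"
      by (rule puzzle_cover[OF P])
    then show ?thesis using agrees_up label_of_agrees[OF P] by blast
  qed
  have downs: "\<exists>x y. ?g (NWSE a b) = Some x \<and> ?g (SWNE (Suc a) b) = Some y \<and> (x, y, ?g (EW a (Suc b))) \<in> down_triples"
    if "Suc (a + b) < n" for a b
  proof -
    have "Down a b \<in> triangles n" using that by simp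
    then obtain p where "p \<in> P" "Down a b \<in> piece_triangles p"
      by (rule puzzle_cover[OF P])
    then show ?thesis using agrees_down label_of_agrees[OF P] by blast
  qed
  have edge: "\<exists>p\<in>P. (e, ?g e) \<in> full_labels p" if e: "e \<in> edges n" for e
  proof -
    obtain t where t: "t \<in> triangles n" "e \<in> tri_edges t" using e by (auto simp: edges_def)
    obtain p where p: "p \<in> P" "t \<in> piece_triangles p" using puzzle_cover[OF P t(1)] .
    then show ?thesis using full_labels_edge[OF p(2) t(2)] label_of_eq[OF P p(1)] p(1) by blast
  qed
  have "is_bit (?g (SWNE 0 b))" if b: "b < n" for b
  proof -
    obtain p where "(SWNE 0 b, ?g (SWNE 0 b)) \<in> full_labels p" using edge[of "SWNE 0 b"] b by auto
    then show ?thesis by (cases p) (auto simp: is_bit_def bit_def)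
  qed
  moreover have "is_bit (?g (NWSE a b))" if ab: "Suc (a + b) = n" for a b
  proof -
    obtain p where p: "p \<in> P" "(NWSE a b, ?g (NWSE a b)) \<in> full_labels p" using edge[of "NWSE a b"] ab by auto
    \<comment> \<open>The only piece with a glue label on this edge; its downward triangle lies
      outside the big triangle.\<close>
    then have "p \<noteq> RhombusSWNE a b" using puzzle_pieces[OF P p(1)] ab by auto
    then show ?thesis using p(2) by (cases p) (auto simp: is_bit_def bit_def)
  qed
  moreover have "is_bit (?g (EW a 0))" if a: "a < n" for a
  proof -
    obtain p where "(EW a 0, ?g (EW a 0)) \<in> full_labels p" using edge[of "EW a 0"] a by auto
    then show ?thesis by (cases p) (auto simp: is_bit_def bit_def)
  qed
  ultimately show ?thesis unfolding valid_labeling_def using ups downs by blast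
qed

lemma puzzle_of_label_of:
  assumes P: "P \<in> puzzles n"
  shows "puzzle_of n (label_of P) = P"
proof (intro set_eqI iffI)
  fix p assume "p \<in> P"
  then show "p \<in> puzzle_of n (label_of P)"
    using puzzle_pieces[OF P] label_of_agrees[OF P] by (auto simp: puzzle_of_def)
next
  fix p assume p: "p \<in> puzzle_of n (label_of P)"
  have "\<exists>t. t \<in> piece_triangles p" by (cases p) auto
  then obtain t where t: "t \<in> piece_triangles p" "t \<in> triangles n" using p by (auto simp: puzzle_of_def)
  obtain q where q: "q \<in> P" "t \<in> piece_triangles q" using puzzle_cover[OF P t(2)] .
  then show "p \<in> P"
    using agrees_unique[OF _ label_of_agrees[OF P q(1)] t(1) q(2)] p by (auto simp: puzzle_of_def)
qed

lemma puzzle_of_cong: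
  assumes "\<And>e. e \<in> edges n \<Longrightarrow> g e = h e"
  shows "puzzle_of n g = puzzle_of n h"
proof -
  have "agrees g p \<longleftrightarrow> agrees h p" if "piece_triangles p \<subseteq> triangles n" for p
  proof -
    have "g e = h e" if "(e, y) \<in> full_labels p" for e y
      using full_labels_triangle[OF that] \<open>piece_triangles p \<subseteq> triangles n\<close> by (intro assms) (auto simp: edges_def)
    then show ?thesis by (auto simp: agrees_def)
  qed
  then show ?thesis by (auto simp: puzzle_of_def)
qed

lemma valid_labeling_cong:
  assumes "\<And>e. e \<in> edges n \<Longrightarrow> g e = h e" "valid_labeling n g"
  shows "valid_labeling n h"
proof -
  have *: "h (SWNE a b) = g (SWNE a b)" "h (NWSE a b) = g (NWSE a b)" "h (EW a b) = g (EW a b)"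
    if "a + b < n" for a b
    using that assms(1) by simp_all
  show ?thesis
    using assms(2) unfolding valid_labeling_def by (auto simp: *)
qed

text \<open>Entry \<open>a\<close> of a configuration lists the labels of the edges \<open>SWNE a b\<close> and those of the edges \<open>NWSE a b\<close>,
  for \<open>b < n - a\<close>.\<close>

type_synonym config = "(lab list \<times> lab list) list"

fun raw_configs :: "nat \<Rightarrow> config set" where
  "raw_configs 0 = {[]}"
| "raw_configs (Suc n) = (\<lambda>(X, Y, C). (X, Y) # C) ` (lab_lists (Suc n) \<times> lab_lists (Suc n) \<times> raw_configs n)"

definition first_column :: "config \<Rightarrow> lab list" where
  "first_column C = (case C of [] \<Rightarrow> [] | XY # C \<Rightarrow> fst XY)"

definition right_ends :: "config \<Rightarrow> lab list" where
  "right_ends C = map (\<lambda>XY. last (snd XY)) C"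

text \<open>The strip with its inner labels fixed. \<open>Y\<close> runs up the NE line and is one
  longer than \<open>as\<close>: at vertex \<open>b\<close> the label \<open>Y ! Suc b\<close>
  enters and \<open>Y ! b\<close> leaves.\<close>

definition strip_weight :: "'a::comm_ring_1 \<Rightarrow> 'a list \<Rightarrow> lab list \<Rightarrow> lab list \<Rightarrow> lab list \<Rightarrow> 'a" where
  "strip_weight x ys as bs Y = (\<Prod>b<length as. vertex_weight (ys ! b - x) (as ! b) (Y ! Suc b) (Y ! b) (bs ! b))"

fun config_weight :: "'a::comm_ring_1 list \<Rightarrow> config \<Rightarrow> bool list \<Rightarrow> 'a" where
  "config_weight (y # ys) (XY # C) (v # vs) =
     bottom_weight (hd (fst XY)) (hd (snd XY)) v * strip_weight y ys (tl (fst XY)) (first_column C) (snd XY) * config_weight ys C vs"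
| "config_weight _ _ _ = 1"

lemma finite_raw_configs [simp]: "finite (raw_configs n)"
  by (induction n) simp_all

lemma raw_configs_Suc: "C \<in> raw_configs (Suc n) \<longleftrightarrow>
    (\<exists>X Y C'. C = (X, Y) # C' \<and> X \<in> lab_lists (Suc n) \<and> Y \<in> lab_lists (Suc n) \<and> C' \<in> raw_configs n)"
  by (auto simp: image_iff)

lemma strip_sum:
  assumes "length as = length ys" "length bs = length ys"
  shows "strip x ys as bs t s = (\<Sum>Y\<in>lab_lists (length ys). strip_weight x ys as bs (t # Y) * of_bool (last (t # Y) = s))"
  using assms
proof (induction ys arbitrary: as bs t)
  case Nil
  then show ?case by (simp add: lab_lists_0 strip_weight_def)
next
  case (Cons y ys)
  then obtain a as' b bs' where as: "as = a # as'" and bs: "bs = b # bs'"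
    by (auto simp: length_Suc_conv)
  have w: "strip_weight x (y # ys) as bs (t # q # Y) = vertex_weight (y - x) a q t b * strip_weight x ys as' bs' (q # Y)" for q Y
    by (simp add: strip_weight_def as bs prod.lessThan_Suc_shift del: prod.lessThan_Suc)
  have "strip x (y # ys) as bs t s = (\<Sum>q\<in>UNIV. vertex_weight (y - x) a q t b *
      (\<Sum>Y\<in>lab_lists (length ys). strip_weight x ys as' bs' (q # Y) * of_bool (last (q # Y) = s)))"
    unfolding as bs strip.simps using Cons.prems as bs by (simp only: Cons.IH list.size add_right_cancel)
  also have "\<dots> = (\<Sum>Y\<in>lab_lists (length (y # ys)). strip_weight x (y # ys) as bs (t # Y) * of_bool (last (t # Y) = s))"
    by (simp add: sum_lab_lists_Suc w sum_distrib_left mult.assoc del: sum_mult_of_bool_eq)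
  finally show ?case .
qed

lemma first_column_in_lab_lists: "C \<in> raw_configs n \<Longrightarrow> first_column C \<in> lab_lists n"
  by (cases n) (auto simp: first_column_def lab_lists_def)

text \<open>Unfolds the transfer matrix recursion into one sum over all labelings of the slanted
  edges.\<close>

lemma puzzle_sum_configs:
  assumes "length ys = n" "length as = n" "length ms = n" "length vs = n"
  shows "puzzle_sum ys as ms vs = (\<Sum>C | C \<in> raw_configs n \<and> first_column C = as \<and> right_ends C = ms. config_weight ys C vs)"
  using assms
proof (induction n arbitrary: ys as ms vs)
  case 0
  have "{C. C \<in> raw_configs 0 \<and> first_column C = [] \<and> right_ends C = []} = {[]}"
    by (auto simp: first_column_def right_ends_def)
  then show ?case using 0 by simp
next
  case (Suc n)
  obtain y ys' a as' m ms' v vs' where ys: "ys = y # ys'" and as: "as = a # as'"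
    and ms: "ms = m # ms'" and vs: "vs = v # vs'"
    using Suc.prems by (auto simp: length_Suc_conv)
  have len: "length ys' = n" "length as' = n" "length ms' = n" "length vs' = n"
    using Suc.prems ys as ms vs by simp_all
  let ?T = "{C. C \<in> raw_configs n \<and> right_ends C = ms'}" and ?Y = "{Y. Y \<in> lab_lists (Suc n) \<and> last Y = m}"
  let ?k = "\<lambda>bs Y. bottom_weight a (hd Y) v * strip_weight y ys' as' bs Y"
  have K: "(\<Sum>t\<in>UNIV. bottom_weight a t v * strip y ys' as' bs t m) = (\<Sum>Y\<in>?Y. ?k bs Y)" if "bs \<in> lab_lists n" for bs
  proof -
    have "(\<Sum>t\<in>UNIV. bottom_weight a t v * strip y ys' as' bs t m) =
      (\<Sum>t\<in>UNIV. bottom_weight a t v * (\<Sum>Y\<in>lab_lists n. strip_weight y ys' as' bs (t # Y) * of_bool (last (t # Y) = m)))"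
      using that len by (simp add: strip_sum lab_lists_def)
    also have "\<dots> = (\<Sum>Y\<in>lab_lists (Suc n). ?k bs Y * of_bool (last Y = m))"
      by (simp add: sum_lab_lists_Suc sum_distrib_left mult.assoc del: sum_mult_of_bool_eq)
    also have "\<dots> = (\<Sum>Y\<in>lab_lists (Suc n). if last Y = m then ?k bs Y else 0)"
      by (intro sum.cong refl) simp
    also have "\<dots> = (\<Sum>Y\<in>?Y. ?k bs Y)"
      by (rule sum.inter_filter[symmetric]) simp
    finally show ?thesis .
  qed
  have "puzzle_sum ys as ms vs = (\<Sum>bs\<in>lab_lists n. (\<Sum>t\<in>UNIV. bottom_weight a t v * strip y ys' as' bs t m) * puzzle_sum ys' bs ms' vs')"
    unfolding ys as ms vs using len by (simp add: sum_distrib_right)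
  also have "\<dots> = (\<Sum>bs\<in>lab_lists n. (\<Sum>Y\<in>?Y. ?k bs Y) * puzzle_sum ys' bs ms' vs')"
    by (intro sum.cong refl) (simp only: K)
  \<comment> \<open>The configurations of the remaining triangle are grouped by their first column,
    which absorbs the sum over \<open>bs\<close>.\<close>
  also have "\<dots> = (\<Sum>bs\<in>lab_lists n. \<Sum>C | C \<in> ?T \<and> first_column C = bs. (\<Sum>Y\<in>?Y. ?k (first_column C) Y) * config_weight ys' C vs')"
  proof (intro sum.cong refl)
    fix bs assume "bs \<in> lab_lists n"
    then have "puzzle_sum ys' bs ms' vs' = (\<Sum>C | C \<in> raw_configs n \<and> first_column C = bs \<and> right_ends C = ms'. config_weight ys' C vs')"
      using len by (intro Suc.IH) (simp_all add: lab_lists_def)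
    also have "{C. C \<in> raw_configs n \<and> first_column C = bs \<and> right_ends C = ms'} = {C. C \<in> ?T \<and> first_column C = bs}" by auto
    finally show "(\<Sum>Y\<in>?Y. ?k bs Y) * puzzle_sum ys' bs ms' vs' =
        (\<Sum>C | C \<in> ?T \<and> first_column C = bs. (\<Sum>Y\<in>?Y. ?k (first_column C) Y) * config_weight ys' C vs')"
      by (simp add: sum_distrib_left)
  qed
  also have "\<dots> = (\<Sum>C\<in>?T. (\<Sum>Y\<in>?Y. ?k (first_column C) Y) * config_weight ys' C vs')"
    by (rule sum.group) (auto intro: first_column_in_lab_lists)
  also have "\<dots> = (\<Sum>(C, Y)\<in>?T \<times> ?Y. ?k (first_column C) Y * config_weight ys' C vs')"
    by (simp add: sum_distrib_right sum.cartesian_product)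
  also have "\<dots> = (\<Sum>C\<in>(\<lambda>(C, Y). (as, Y) # C) ` (?T \<times> ?Y). config_weight ys C vs)"
    by (subst sum.reindex) (auto simp: inj_on_def ys vs as intro!: sum.cong)
  also have "(\<lambda>(C, Y). (as, Y) # C) ` (?T \<times> ?Y) = {C. C \<in> raw_configs (Suc n) \<and> first_column C = as \<and> right_ends C = ms}"
  proof (rule set_eqI)
    fix C
    have "as \<in> lab_lists (Suc n)" using Suc.prems(2) by (simp add: lab_lists_def)
    moreover have "C \<in> (\<lambda>(C, Y). (as, Y) # C) ` (?T \<times> ?Y) \<longleftrightarrow> (\<exists>Y C'. C = (as, Y) # C' \<and> Y \<in> ?Y \<and> C' \<in> ?T)"
      by (auto simp: image_iff)
    moreover note raw_configs_Suc[of C n]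
    ultimately show "C \<in> (\<lambda>(C, Y). (as, Y) # C) ` (?T \<times> ?Y) \<longleftrightarrow>
        C \<in> {C. C \<in> raw_configs (Suc n) \<and> first_column C = as \<and> right_ends C = ms}"
      unfolding ms by (cases C) (auto simp: first_column_def right_ends_def)
  qed
  finally show ?case .
qed

lemma raw_configs_iff:
  "C \<in> raw_configs n \<longleftrightarrow> length C = n \<and> (\<forall>a<n. length (fst (C ! a)) = n - a \<and> length (snd (C ! a)) = n - a)"
proof (induction n arbitrary: C)
  case (Suc n)
  show ?case
  proof (cases C)
    case (Cons XY C')
    have "C \<in> raw_configs (Suc n) \<longleftrightarrow> fst XY \<in> lab_lists (Suc n) \<and> snd XY \<in> lab_lists (Suc n) \<and> C' \<in> raw_configs n"
      unfolding Cons raw_configs_Suc by (cases XY) simp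
    also have "\<dots> \<longleftrightarrow> length C = Suc n \<and>
        (\<forall>a<Suc n. length (fst (C ! a)) = Suc n - a \<and> length (snd (C ! a)) = Suc n - a)"
      unfolding Suc.IH Cons by (auto simp: lab_lists_def All_less_Suc2)
    finally show ?thesis .
  qed (simp add: raw_configs_Suc del: raw_configs.simps)
qed simp

text \<open>Horizontal labels are functions of the slanted ones and are not stored in a
  configuration. \<open>None\<close> is also the default for pairs in no admissible triple; the test
  for \<open>up_triples\<close> rejects these.\<close>

definition south_label :: "lab \<Rightarrow> lab \<Rightarrow> lab option" where
  "south_label a s = (if (a, s) \<in> {(Zero, Zero), (Ten, One)} then Some Zero
     else if (a, s) \<in> {(One, One), (Zero, Ten)} then Some One
     else if (a, s) = (One, Zero) then Some Ten else None)"

lemma south_label_up_triples: "(a, s, h) \<in> up_triples \<Longrightarrow> h = south_label a s"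
  by (auto simp: up_triples_def south_label_def)

lemma vertex_weight_alt: "vertex_weight u a s t b = (if (a, s, south_label a s) \<in> up_triples \<and> (t, b, south_label a s) \<in> down_triples
    then if south_label a s = None then u else 1 else 0)"
  by (cases a; cases s; cases t; cases b; simp add: vertex_weight_def south_label_def up_triples_def down_triples_def)

lemma bottom_weight_alt: "bottom_weight a t v = of_bool ((a, t, Some (bit v)) \<in> up_triples)"
  by (cases a; cases t; cases v; simp add: bottom_weight_def up_triples_def)

fun config_label :: "config \<Rightarrow> edge \<Rightarrow> lab option" where
  "config_label C (SWNE a b) = Some (fst (C ! a) ! b)"
| "config_label C (NWSE a b) = Some (snd (C ! a) ! b)"
| "config_label C (EW a b) = south_label (fst (C ! a) ! b) (snd (C ! a) ! b)"

lemma config_weight_nth: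
  assumes "C \<in> raw_configs n" "length ys = n" "length vs = n"
  shows "config_weight ys C vs = (\<Prod>a<n. bottom_weight (fst (C ! a) ! 0) (snd (C ! a) ! 0) (vs ! a) *
    (\<Prod>b<n - Suc a. vertex_weight (ys ! Suc (a + b) - ys ! a) (fst (C ! a) ! Suc b) (snd (C ! a) ! Suc b)
       (snd (C ! a) ! b) (fst (C ! Suc a) ! b)))"
  using assms
proof (induction n arbitrary: ys C vs)
  case (Suc n)
  then obtain X Y C' y ys' v vs' where C: "C = (X, Y) # C'" and ys: "ys = y # ys'" and vs: "vs = v # vs'"
    and XY: "length X = Suc n" "length Y = Suc n" and C': "C' \<in> raw_configs n"
    by (auto simp: length_Suc_conv lab_lists_def raw_configs_Suc simp del: raw_configs.simps)
  have len: "length C' = n" using C' by (simp add: raw_configs_iff)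
  have "first_column C' ! b = fst (C' ! 0) ! b" if "b < n" for b
    using len that by (cases C') (auto simp: first_column_def)
  then have "strip_weight y ys' (tl X) (first_column C') Y =
      (\<Prod>b<n. vertex_weight (ys ! Suc b - y) (X ! Suc b) (Y ! Suc b) (Y ! b) (fst (C ! Suc 0) ! b))"
    unfolding strip_weight_def using XY by (intro prod.cong) (simp_all add: nth_tl C ys)
  moreover have "hd X = X ! 0" "hd Y = Y ! 0" using XY by (simp_all add: hd_conv_nth flip: length_greater_0_conv)
  moreover have "config_weight ys' C' vs' = (\<Prod>a<n. bottom_weight (fst (C' ! a) ! 0) (snd (C' ! a) ! 0) (vs' ! a) *
    (\<Prod>b<n - Suc a. vertex_weight (ys' ! Suc (a + b) - ys' ! a) (fst (C' ! a) ! Suc b) (snd (C' ! a) ! Suc b)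
       (snd (C' ! a) ! b) (fst (C' ! Suc a) ! b)))"
    using Suc.prems C' ys vs by (intro Suc.IH) simp_all
  ultimately show ?case
    by (simp add: C ys vs prod.lessThan_Suc_shift del: prod.lessThan_Suc)
qed simp

text \<open>Groups the local conditions in the same way as the weights: bottom triangles, then pairs
  of triangles along a horizontal edge.\<close>

definition valid :: "nat \<Rightarrow> config \<Rightarrow> bool list \<Rightarrow> bool" where
  "valid n C v \<longleftrightarrow>
     (\<forall>a<n. (fst (C ! a) ! 0, snd (C ! a) ! 0, Some (bit (v ! a))) \<in> up_triples \<and> config_label C (EW a 0) = Some (bit (v ! a))) \<and>
     (\<forall>a<n. \<forall>b<n - Suc a. (fst (C ! a) ! Suc b, snd (C ! a) ! Suc b, config_label C (EW a (Suc b))) \<in> up_triples \<and>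
        (snd (C ! a) ! b, fst (C ! Suc a) ! b, config_label C (EW a (Suc b))) \<in> down_triples)"

text \<open>A local factor is 0 where a triple is inadmissible, a root at a horizontal edge labelled
  \<open>None\<close>, and 1 otherwise.\<close>

lemma config_weight_valid:
  assumes "C \<in> raw_configs n" "length ys = n" "length v = n"
  shows "config_weight ys C v = (if valid n C v then
    \<Prod>a<n. \<Prod>b<n - Suc a. if config_label C (EW a (Suc b)) = None then ys ! Suc (a + b) - ys ! a else 1 else 0)"
proof (cases "valid n C v")
  case True
  have B: "bottom_weight (fst (C ! a) ! 0) (snd (C ! a) ! 0) (v ! a) = (1 :: 'a)" if "a < n" for a
    using True that by (simp add: valid_def bottom_weight_alt)
  have V: "vertex_weight u (fst (C ! a) ! Suc b) (snd (C ! a) ! Suc b) (snd (C ! a) ! b) (fst (C ! Suc a) ! b) =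
      (if config_label C (EW a (Suc b)) = None then u else 1)" if "a < n" "b < n - Suc a" for a b and u :: 'a
    using True that by (simp add: valid_def vertex_weight_alt)
  have "config_weight ys C v = (\<Prod>a<n. \<Prod>b<n - Suc a. if config_label C (EW a (Suc b)) = None then ys ! Suc (a + b) - ys ! a else 1)"
    unfolding config_weight_nth[OF assms]
  proof (intro prod.cong refl)
    fix a assume "a \<in> {..<n}"
    then have a: "a < n" by simp
    have "(\<Prod>b<n - Suc a. vertex_weight (ys ! Suc (a + b) - ys ! a) (fst (C ! a) ! Suc b) (snd (C ! a) ! Suc b)
       (snd (C ! a) ! b) (fst (C ! Suc a) ! b)) =
      (\<Prod>b<n - Suc a. if config_label C (EW a (Suc b)) = None then ys ! Suc (a + b) - ys ! a else 1)"
      by (intro prod.cong refl V a) simp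
    then show "bottom_weight (fst (C ! a) ! 0) (snd (C ! a) ! 0) (v ! a) *
      (\<Prod>b<n - Suc a. vertex_weight (ys ! Suc (a + b) - ys ! a) (fst (C ! a) ! Suc b) (snd (C ! a) ! Suc b)
       (snd (C ! a) ! b) (fst (C ! Suc a) ! b)) =
      (\<Prod>b<n - Suc a. if config_label C (EW a (Suc b)) = None then ys ! Suc (a + b) - ys ! a else 1)"
      by (simp only: B[OF a] mult_1_left)
  qed
  then show ?thesis by (simp only: True if_True)
next
  case False
  then consider a where "a < n" "\<not> ((fst (C ! a) ! 0, snd (C ! a) ! 0, Some (bit (v ! a))) \<in> up_triples \<and> config_label C (EW a 0) = Some (bit (v ! a)))"
    | a b where "a < n" "b < n - Suc a" "\<not> ((fst (C ! a) ! Suc b, snd (C ! a) ! Suc b, config_label C (EW a (Suc b))) \<in> up_triples \<and>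
        (snd (C ! a) ! b, fst (C ! Suc a) ! b, config_label C (EW a (Suc b))) \<in> down_triples)"
    unfolding valid_def by blast
  then have "config_weight ys C v = 0"
  proof cases
    case 1
    then have "(fst (C ! a) ! 0, snd (C ! a) ! 0, Some (bit (v ! a))) \<notin> up_triples"
      using south_label_up_triples[of "fst (C ! a) ! 0" "snd (C ! a) ! 0" "Some (bit (v ! a))"] by auto
    then have "bottom_weight (fst (C ! a) ! 0) (snd (C ! a) ! 0) (v ! a) = (0 :: 'a)" by (simp add: bottom_weight_alt)
    then show ?thesis unfolding config_weight_nth[OF assms] using 1(1) by (intro prod_zero) (auto intro!: bexI[of _ a])
  next
    case 2
    then have "vertex_weight u (fst (C ! a) ! Suc b) (snd (C ! a) ! Suc b) (snd (C ! a) ! b) (fst (C ! Suc a) ! b) = 0" for u :: 'a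
      unfolding vertex_weight_alt by auto
    then have "(\<Prod>b<n - Suc a. vertex_weight (ys ! Suc (a + b) - ys ! a) (fst (C ! a) ! Suc b) (snd (C ! a) ! Suc b)
       (snd (C ! a) ! b) (fst (C ! Suc a) ! b)) = 0"
      using 2(2) by (intro prod_zero) auto
    then show ?thesis unfolding config_weight_nth[OF assms] using 2(1) by (intro prod_zero) (auto intro!: bexI[of _ a])
  qed
  then show ?thesis using False by simp
qed

lemma less_pairs: "a < n \<and> b < n - Suc a \<longleftrightarrow> Suc (a + b) < (n::nat)"
  by linarith

lemma config_label_outer:
  assumes "C \<in> raw_configs n" "first_column C = map bit l" "right_ends C = map bit m" "length l = n" "length m = n"
  shows "b < n \<Longrightarrow> config_label C (SWNE 0 b) = Some (bit (l ! b))"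
    and "a < n \<Longrightarrow> config_label C (NWSE a (n - 1 - a)) = Some (bit (m ! a))"
proof -
  have C: "length C = n" "\<And>a. a < n \<Longrightarrow> length (snd (C ! a)) = n - a"
    using assms(1) by (simp_all add: raw_configs_iff)
  show "config_label C (SWNE 0 b) = Some (bit (l ! b))" if "b < n"
  proof -
    have "fst (C ! 0) = map bit l" using assms(2) C(1) that by (cases C) (simp_all add: first_column_def)
    then show ?thesis using that assms(4) by simp
  qed
  show "config_label C (NWSE a (n - 1 - a)) = Some (bit (m ! a))" if a: "a < n"
  proof -
    have "last (snd (C ! a)) = map bit m ! a"
      using a C(1) unfolding assms(3)[symmetric] by (simp add: right_ends_def)
    moreover have "last (snd (C ! a)) = snd (C ! a) ! (n - 1 - a)"
      using C(2)[OF a] a by (subst last_conv_nth) auto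
    ultimately show ?thesis using a assms(5) by simp
  qed
qed

lemma is_bit_bit [simp]: "is_bit (Some (bit x))"
  by (cases x) (simp_all add: is_bit_def)

lemma binE: "is_bit y \<Longrightarrow> \<exists>x. y = Some (bit x)"
  unfolding is_bit_def by (metis bit_simps(1,2))

lemma valid_iff_valid_labeling:
  assumes "C \<in> raw_configs n" "first_column C = map bit l" "right_ends C = map bit m" "length l = n" "length m = n"
  shows "valid n C v \<longleftrightarrow> valid_labeling n (config_label C) \<and> (\<forall>a<n. config_label C (EW a 0) = Some (bit (v ! a)))"
proof
  assume v: "valid n C v"
  have south: "config_label C (EW a 0) = Some (bit (v ! a))" if "a < n" for a
    using v that by (simp add: valid_def)
  have "(fst (C ! a) ! b, snd (C ! a) ! b, config_label C (EW a b)) \<in> up_triples" if "a + b < n" for a b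
  proof (cases b)
    case 0
    then show ?thesis using v that south[of a] by (simp add: valid_def del: config_label.simps)
  next
    case (Suc c)
    then have "a < n" "c < n - Suc a" using that by simp_all
    then show ?thesis using v Suc by (simp add: valid_def)
  qed
  moreover have "(snd (C ! a) ! b, fst (C ! Suc a) ! b, config_label C (EW a (Suc b))) \<in> down_triples" if "Suc (a + b) < n" for a b
  proof -
    have "a < n" "b < n - Suc a" using that by simp_all
    then show ?thesis using v by (simp add: valid_def)
  qed
  moreover have "is_bit (config_label C (SWNE 0 b))" if "b < n" for b
    using config_label_outer(1)[OF assms that] by simp
  moreover have "is_bit (config_label C (NWSE a b))" if "Suc (a + b) = n" for a b
  proof -
    have "a < n" "b = n - 1 - a" using that by simp_all
    then show ?thesis using config_label_outer(2)[OF assms, of a] by simp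
  qed
  ultimately have "valid_labeling n (config_label C)" using south unfolding valid_labeling_def by (simp del: config_label.simps(3))
  then show "valid_labeling n (config_label C) \<and> (\<forall>a<n. config_label C (EW a 0) = Some (bit (v ! a)))" using south by blast
next
  assume v: "valid_labeling n (config_label C) \<and> (\<forall>a<n. config_label C (EW a 0) = Some (bit (v ! a)))"
  have ups: "(fst (C ! a) ! b, snd (C ! a) ! b, config_label C (EW a b)) \<in> up_triples" if ab: "a + b < n" for a b
  proof -
    obtain x y where "config_label C (SWNE a b) = Some x" "config_label C (NWSE a b) = Some y" "(x, y, config_label C (EW a b)) \<in> up_triples"
      using valid_labeling_up[of n "config_label C", OF _ ab] v by blast
    then show ?thesis by (simp del: config_label.simps(3))
  qed
  have "(snd (C ! a) ! b, fst (C ! Suc a) ! b, config_label C (EW a (Suc b))) \<in> down_triples" if ab: "Suc (a + b) < n" for a b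
  proof -
    obtain x y where "config_label C (NWSE a b) = Some x" "config_label C (SWNE (Suc a) b) = Some y" "(x, y, config_label C (EW a (Suc b))) \<in> down_triples"
      using valid_labeling_down[of n "config_label C", OF _ ab] v by blast
    then show ?thesis by (simp del: config_label.simps(3))
  qed
  moreover have "(fst (C ! a) ! 0, snd (C ! a) ! 0, Some (bit (v ! a))) \<in> up_triples" if "a < n" for a
    using ups[of a 0] v that by (simp del: config_label.simps(3))
  ultimately show "valid n C v"
    using v ups unfolding valid_def by (simp add: less_pairs del: config_label.simps(3))
qed

definition configs :: "nat \<Rightarrow> bool list \<Rightarrow> bool list \<Rightarrow> bool list \<Rightarrow> config set" where
  "configs n l m v = {C. (C \<in> raw_configs n \<and> first_column C = map bit l \<and> right_ends C = map bit m) \<and> valid n C v}"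

lemma string_sum_configs:
  assumes "length ys = n" "length l = n" "length m = n" "length v = n"
  shows "string_sum ys l m v = (\<Sum>C\<in>configs n l m v.
    \<Prod>(a, b) | Suc (a + b) < n \<and> config_label C (EW a (Suc b)) = None. ys ! Suc (a + b) - ys ! a)"
proof -
  let ?R = "{C. C \<in> raw_configs n \<and> first_column C = map bit l \<and> right_ends C = map bit m}"
  let ?w = "\<lambda>C. \<Prod>(a, b) | Suc (a + b) < n \<and> config_label C (EW a (Suc b)) = None. ys ! Suc (a + b) - ys ! a"
  have w: "(\<Prod>a<n. \<Prod>b<n - Suc a. if config_label C (EW a (Suc b)) = None then ys ! Suc (a + b) - ys ! a else 1) = ?w C" for C
  proof -
    have "(\<Prod>a<n. \<Prod>b<n - Suc a. if config_label C (EW a (Suc b)) = None then ys ! Suc (a + b) - ys ! a else 1) =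
      (\<Prod>(a, b)\<in>(SIGMA a:{..<n}. {..<n - Suc a}). if config_label C (EW a (Suc b)) = None then ys ! Suc (a + b) - ys ! a else 1)"
      by (rule prod.Sigma) simp_all
    also have "\<dots> = ?w C"
      by (rule prod.mono_neutral_cong_right) (auto simp: less_pairs split: if_splits)
    finally show ?thesis .
  qed
  have "string_sum ys l m v = (\<Sum>C\<in>?R. config_weight ys C v)"
    unfolding string_sum_def using assms by (intro puzzle_sum_configs) simp_all
  also have "\<dots> = (\<Sum>C\<in>?R. if valid n C v then ?w C else 0)"
  proof (intro sum.cong refl)
    fix C assume "C \<in> ?R"
    then have "C \<in> raw_configs n" by simp
    from config_weight_valid[OF this assms(1,4)] show "config_weight ys C v = (if valid n C v then ?w C else 0)"
      unfolding w .
  qed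
  also have "\<dots> = sum ?w {C \<in> ?R. valid n C v}"
    by (rule sum.inter_filter[symmetric]) simp
  also have "{C \<in> ?R. valid n C v} = configs n l m v"
    by (simp add: configs_def)
  finally show ?thesis .
qed

text \<open>The slanted labels are read off the puzzle; the horizontal ones then agree because an
  admissible upward triple determines its South label.\<close>

lemma config_of_puzzle:
  assumes P: "P \<in> puzzles n"
  obtains C where "C \<in> raw_configs n" "valid_labeling n (config_label C)" "puzzle_of n (config_label C) = P"
proof -
  let ?g = "label_of P"
  define C where "C = map (\<lambda>a. (map (\<lambda>b. the (?g (SWNE a b))) [0..<n - a], map (\<lambda>b. the (?g (NWSE a b))) [0..<n - a])) [0..<n]"
  have C: "C \<in> raw_configs n" by (simp add: raw_configs_iff C_def)
  have "config_label C (SWNE a b) = ?g (SWNE a b) \<and> config_label C (NWSE a b) = ?g (NWSE a b) \<and> config_label C (EW a b) = ?g (EW a b)"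
    if ab: "a + b < n" for a b
  proof -
    obtain x y where g: "?g (SWNE a b) = Some x" "?g (NWSE a b) = Some y" "(x, y, ?g (EW a b)) \<in> up_triples"
      using valid_labeling_up[OF valid_labeling_label_of[OF P] ab] .
    have "a < n" "b < n - a" using ab by simp_all
    then have "fst (C ! a) ! b = x" "snd (C ! a) ! b = y" using g by (simp_all add: C_def)
    then show ?thesis using g south_label_up_triples[OF g(3)] by simp
  qed
  then have eq: "config_label C e = ?g e" if "e \<in> edges n" for e
    using that by (cases e) (simp_all del: config_label.simps)
  have "valid_labeling n (config_label C)"
    by (rule valid_labeling_cong[OF _ valid_labeling_label_of[OF P]]) (simp add: eq)
  moreover have "puzzle_of n (config_label C) = P"
    using puzzle_of_cong[of n "config_label C" ?g] eq puzzle_of_label_of[OF P] by simp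
  ultimately show thesis using that C by blast
qed

lemma config_label_inject:
  assumes "C \<in> raw_configs n" "D \<in> raw_configs n" "\<And>e. e \<in> edges n \<Longrightarrow> config_label C e = config_label D e"
  shows "C = D"
proof (rule nth_equalityI)
  show "length C = length D" using assms(1,2) by (simp add: raw_configs_iff)
next
  fix a assume "a < length C"
  then have a: "a < n" using assms(1) by (simp add: raw_configs_iff)
  have len: "length (fst (C ! a)) = n - a" "length (snd (C ! a)) = n - a"
    "length (fst (D ! a)) = n - a" "length (snd (D ! a)) = n - a"
    using assms(1,2) a by (simp_all add: raw_configs_iff)
  have "fst (C ! a) = fst (D ! a)"
    using len assms(3)[of "SWNE a _"] by (intro nth_equalityI) simp_all
  moreover have "snd (C ! a) = snd (D ! a)"
    using len assms(3)[of "NWSE a _"] by (intro nth_equalityI) simp_all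
  ultimately show "C ! a = D ! a" by (rule prod_eqI)
qed

lemma boundary_puzzle_of:
  assumes C: "C \<in> raw_configs n" and g: "valid_labeling n (config_label C)"
  shows "map bit (side_NW n (puzzle_of n (config_label C))) = first_column C"
    and "map bit (side_NE n (puzzle_of n (config_label C))) = right_ends C"
    and "a < n \<Longrightarrow> config_label C (EW a 0) = Some (bit (rev (side_S n (puzzle_of n (config_label C))) ! a))"
proof -
  let ?l = "edge_label (puzzle_of n (config_label C))"
  have label: "config_label C e = Some (bit (?l e))" if "e \<in> edges n" "is_bit (config_label C e)" for e
    using binE[OF that(2)] edge_label_puzzle_of[OF g that(1)] by auto
  have len: "length C = n" "\<And>a. a < n \<Longrightarrow> length (fst (C ! a)) = n - a" "\<And>a. a < n \<Longrightarrow> length (snd (C ! a)) = n - a"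
    using C by (simp_all add: raw_configs_iff)
  have bins: "b < n \<Longrightarrow> is_bit (config_label C (SWNE 0 b))" "Suc (a + b) = n \<Longrightarrow> is_bit (config_label C (NWSE a b))"
    "a < n \<Longrightarrow> is_bit (config_label C (EW a 0))" for a b
    using g unfolding valid_labeling_def by blast+
  show "map bit (side_NW n (puzzle_of n (config_label C))) = first_column C"
  proof (rule nth_equalityI)
    have "length (first_column C) = n" using first_column_in_lab_lists[OF C] by (simp add: lab_lists_def)
    then show "length (map bit (side_NW n (puzzle_of n (config_label C)))) = length (first_column C)"
      by (simp add: side_NW_def)
  next
    fix b assume "b < length (map bit (side_NW n (puzzle_of n (config_label C))))"
    then have b: "b < n" by (simp add: side_NW_def)
    then have "first_column C = fst (C ! 0)" using len(1) by (cases C) (simp_all add: first_column_def)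
    then show "map bit (side_NW n (puzzle_of n (config_label C))) ! b = first_column C ! b"
      using label[OF _ bins(1)[OF b]] b by (simp add: side_NW_def)
  qed
  show "map bit (side_NE n (puzzle_of n (config_label C))) = right_ends C"
  proof (rule nth_equalityI)
    show "length (map bit (side_NE n (puzzle_of n (config_label C)))) = length (right_ends C)"
      using len(1) by (simp add: side_NE_def right_ends_def)
  next
    fix a assume "a < length (map bit (side_NE n (puzzle_of n (config_label C))))"
    then have a: "a < n" by (simp add: side_NE_def)
    then have "last (snd (C ! a)) = snd (C ! a) ! (n - 1 - a)"
      using len(3)[OF a] by (subst last_conv_nth) auto
    moreover have "is_bit (config_label C (NWSE a (n - 1 - a)))" using a by (intro bins(2)) simp
    ultimately show "map bit (side_NE n (puzzle_of n (config_label C))) ! a = right_ends C ! a"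
      using label[of "NWSE a (n - 1 - a)"] a len(1) by (simp add: side_NE_def right_ends_def)
  qed
  show "config_label C (EW a 0) = Some (bit (rev (side_S n (puzzle_of n (config_label C))) ! a))" if a: "a < n"
  proof -
    have "rev (side_S n (puzzle_of n (config_label C))) ! a = ?l (EW a 0)"
      using a by (simp add: side_S_def rev_map)
    then show ?thesis using label[of "EW a 0"] bins(3)[OF a] a by (simp del: config_label.simps)
  qed
qed

lemma map_bit_inject: "map bit l = map bit l' \<longleftrightarrow> l = l'"
  by (rule inj_map_eq_map) (simp add: inj_def)

theorem bij_configs_puzzles:
  assumes "length l = n" "length m = n" "length v = n"
  shows "bij_betw (\<lambda>C. puzzle_of n (config_label C)) (configs n l m v) {P \<in> puzzles n. boundary_is n P l m v}"
proof -
  have configs: "C \<in> configs n l m v \<longleftrightarrow> C \<in> raw_configs n \<and> valid_labeling n (config_label C) \<and> boundary_is n (puzzle_of n (config_label C)) l m v" for C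
  proof (cases "C \<in> raw_configs n \<and> valid_labeling n (config_label C)")
    case True
    let ?P = "puzzle_of n (config_label C)"
    note bd = boundary_puzzle_of[of C n]
    have "rev (side_S n ?P) = v \<longleftrightarrow> (\<forall>a<n. config_label C (EW a 0) = Some (bit (v ! a)))"
      using bd(3) True assms(3) by (simp add: list_eq_iff_nth_eq side_S_def del: config_label.simps)
    then have "boundary_is n ?P l m v \<longleftrightarrow> first_column C = map bit l \<and> right_ends C = map bit m \<and> (\<forall>a<n. config_label C (EW a 0) = Some (bit (v ! a)))"
      using bd(1,2) True by (metis boundary_is_def map_bit_inject)
    then show ?thesis
      using valid_iff_valid_labeling[of C n l m v] True assms unfolding configs_def by auto
  next
    case False
    then show ?thesis
      using valid_iff_valid_labeling[of C n l m v] assms unfolding configs_def by auto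
  qed
  show ?thesis
    unfolding bij_betw_def
  proof
    show "inj_on (\<lambda>C. puzzle_of n (config_label C)) (configs n l m v)"
    proof (rule inj_onI)
      fix C D assume CD: "C \<in> configs n l m v" "D \<in> configs n l m v" "puzzle_of n (config_label C) = puzzle_of n (config_label D)"
      then show "C = D"
        unfolding configs using puzzle_of_inject[of n "config_label C" "config_label D"] config_label_inject[of C n D] by blast
    qed
    show "(\<lambda>C. puzzle_of n (config_label C)) ` configs n l m v = {P \<in> puzzles n. boundary_is n P l m v}"
    proof (intro set_eqI iffI)
      fix P assume "P \<in> (\<lambda>C. puzzle_of n (config_label C)) ` configs n l m v"
      then show "P \<in> {P \<in> puzzles n. boundary_is n P l m v}"
        using puzzle_of_puzzles configs by blast
    next
      fix P assume P: "P \<in> {P \<in> puzzles n. boundary_is n P l m v}"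
      then have "P \<in> puzzles n" by blast
      then obtain C where "C \<in> raw_configs n" "valid_labeling n (config_label C)" "puzzle_of n (config_label C) = P"
        by (rule config_of_puzzle)
      then show "P \<in> (\<lambda>C. puzzle_of n (config_label C)) ` configs n l m v"
        using P configs[of C] by blast
    qed
  qed
qed

lemma puzzles_finite: "finite (puzzles n)"
proof (rule finite_subset)
  show "puzzles n \<subseteq> (\<lambda>C. puzzle_of n (config_label C)) ` raw_configs n"
    using config_of_puzzle by blast
qed simp

section \<open>The structure constants\<close>

lemma puzzle_weight_puzzle_of:
  assumes "valid_labeling n (config_label C)"
  shows "puzzle_weight (puzzle_of n (config_label C)) =
    (\<Prod>(a, b) | Suc (a + b) < n \<and> config_label C (EW a (Suc b)) = None. yvars n ! Suc (a + b) - yvars n ! a)"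
  unfolding puzzle_weight_def Equivariant_puzzle_of[OF assms]
  \<comment> \<open>Position \<open>a\<close> of \<open>yvars n\<close> holds
    \<open>yvar (a + 1)\<close>, which gives the shifted indices in
    \<open>puzzle_weight\<close>.\<close>
  by (intro prod.cong refl) (auto simp del: config_label.simps)

lemma sum_puzzle_weight:
  assumes "length l = n" "length m = n" "length v = n"
  shows "(\<Sum>P \<in> {P \<in> puzzles n. boundary_is n P l m v}. puzzle_weight P) = string_sum (yvars n) l m v"
proof -
  have "(\<Sum>P \<in> {P \<in> puzzles n. boundary_is n P l m v}. puzzle_weight P) =
    (\<Sum>C\<in>configs n l m v. puzzle_weight (puzzle_of n (config_label C)))"
    by (rule sum.reindex_bij_betw[OF bij_configs_puzzles[OF assms], symmetric])
  also have "\<dots> = (\<Sum>C\<in>configs n l m v.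
    \<Prod>(a, b) | Suc (a + b) < n \<and> config_label C (EW a (Suc b)) = None. yvars n ! Suc (a + b) - yvars n ! a)"
  proof (intro sum.cong refl puzzle_weight_puzzle_of)
    fix C assume "C \<in> configs n l m v"
    then show "valid_labeling n (config_label C)"
      using valid_iff_valid_labeling[of C n l m v] assms unfolding configs_def by blast
  qed
  also have "\<dots> = string_sum (yvars n) l m v"
    using assms by (intro string_sum_configs[symmetric]) simp_all
  finally show ?thesis .
qed

text \<open>At increasing integer parameters all weights are positive, so an existing puzzle makes the
  sum nonzero and the conservation law applies.\<close>

lemma puzzle_south_content:
  assumes P: "P \<in> puzzles n" "boundary_is n P l m v" and len: "length l = n" "length m = n" "length v = n"
  shows "count_list l True = count_list v True"
proof -
  let ?ys = "map int [0..<n]"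
  let ?w = "\<lambda>C. \<Prod>(a, b) | Suc (a + b) < n \<and> config_label C (EW a (Suc b)) = None. ?ys ! Suc (a + b) - ?ys ! a"
  have "configs n l m v \<noteq> {}"
    using bij_betw_imp_surj_on[OF bij_configs_puzzles[OF len]] P by blast
  moreover have "finite (configs n l m v)"
    by (rule finite_subset[of _ "raw_configs n"]) (auto simp: configs_def)
  moreover have "?w C > 0" for C
    by (intro prod_pos) auto
  ultimately have "(\<Sum>C\<in>configs n l m v. ?w C) > 0"
    by (intro sum_pos) simp_all
  then have "string_sum ?ys l m v \<noteq> 0"
    using string_sum_configs[of ?ys n l m v] len by simp
  then show ?thesis by (rule string_sum_content)
qed

lemma nonneg_puzzle_weight:
  assumes "P \<in> puzzles n"
  shows "nonneg_in_differences n (puzzle_weight P)"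
  unfolding puzzle_weight_def
proof (intro nonneg_in_differences_prod)
  fix x assume "x \<in> {(a, b). Equivariant a b \<in> P}"
  then obtain a b where x: "x = (a, b)" and "Equivariant a b \<in> P" by blast
  then have "Down a b \<in> triangles n" using puzzle_pieces[OF assms] by fastforce
  then have "nonneg_in_differences n (yvar (a + b + 2) - yvar (a + 1))"
    by (intro nonneg_in_differences_root) simp_all
  then show "nonneg_in_differences n (case x of (a, b) \<Rightarrow> yvar (a + b + 2) - yvar (a + 1))"
    by (simp add: x)
qed

lemma scale_sum_left: "(\<Sum>x\<in>A. f x) *\<^sub>T \<alpha> = (\<Sum>x\<in>A. f x *\<^sub>T \<alpha>)"
  by (rule ext) (simp add: scale_def sum_fun_apply sum_distrib_right)

theorem theorem2:
  fixes n k :: nat and l m v :: "bool list"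
  assumes "k \<le> n"
    and "l \<in> strings n k" and "m \<in> strings n k" and "v \<in> strings n k"
  shows
    "(structure_constant n k l m v =
        (\<Sum>P \<in> {P \<in> puzzles n. boundary_is n P l m v}. puzzle_weight P)
      \<and> nonneg_in_differences n (structure_constant n k l m v))
     \<and> schubert n k l * schubert n k m =
        (\<Sum>P \<in> {P \<in> puzzles n. side_NW n P = l \<and> side_NE n P = m}.
            puzzle_weight P *\<^sub>T schubert n k (rev (side_S n P)))"
proof (intro conjI)
  let ?P = "{P \<in> puzzles n. side_NW n P = l \<and> side_NE n P = m}"
  have len: "length l = n" "length m = n" and len': "length w = n" if "w \<in> strings n k" for w
    using assms that by (simp_all add: strings_def)
  note len = len[OF assms(2)]
  have sum: "string_sum (yvars n) l m w = (\<Sum>P \<in> {P \<in> puzzles n. boundary_is n P l m w}. puzzle_weight P)"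
    if "w \<in> strings n k" for w
    using sum_puzzle_weight len len'[OF that] by simp
  show c: "structure_constant n k l m v = (\<Sum>P \<in> {P \<in> puzzles n. boundary_is n P l m v}. puzzle_weight P)"
    using structure_constant_eq[OF assms(2-4)] sum[OF assms(4)] by simp
  show "nonneg_in_differences n (structure_constant n k l m v)"
    unfolding c by (intro nonneg_in_differences_sum nonneg_puzzle_weight) simp
  \<comment> \<open>The second formula leaves the South side free, so its content has to be derived
    before the puzzles can be grouped by a South string in \<open>strings n k\<close>.\<close>
  have south: "rev (side_S n P) \<in> strings n k" if P: "P \<in> ?P" for P
  proof -
    have "length (rev (side_S n P)) = n" by (simp add: side_S_def)
    moreover from this have "count_list l True = count_list (rev (side_S n P)) True"
      using P len by (intro puzzle_south_content[of P n l m]) (simp_all add: boundary_is_def)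
    ultimately show ?thesis using assms(2) by (simp add: strings_def)
  qed
  have "schubert n k l * schubert n k m =
      (\<Sum>w\<in>strings n k. (\<Sum>P \<in> {P \<in> puzzles n. boundary_is n P l m w}. puzzle_weight P) *\<^sub>T schubert n k w)"
    unfolding schubert_product[OF assms(2,3)] by (intro sum.cong refl) (simp only: sum)
  also have "\<dots> = (\<Sum>w\<in>strings n k. \<Sum>P \<in> {P \<in> ?P. rev (side_S n P) = w}.
      puzzle_weight P *\<^sub>T schubert n k (rev (side_S n P)))"
    unfolding scale_sum_left by (intro sum.cong refl) (auto simp: boundary_is_def)
  also have "\<dots> = (\<Sum>P\<in>?P. puzzle_weight P *\<^sub>T schubert n k (rev (side_S n P)))"
    using puzzles_finite[of n] south by (intro sum.group) auto
  finally show "schubert n k l * schubert n k m = \<dots>" .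
qed

end
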